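(* Let $K$ be a field and let $\mathbf{A}$ be a noetherian standard graded $\mathrm{OI}$-algebra (or $\mathrm{FI}$-algebra, respectively) over $K$ such that every finitely generated $\mathrm{OI}$-module (or $\mathrm{FI}$-module, respectively) over $\mathbf{A}$ is noetherian. Let $\mathbf{M}$ be a finitely generated graded $\mathrm{OI}$-module (or $\mathrm{FI}$-module, respectively) over $\mathbf{A}$. Then for any $p\in\mathbb{N}$ one has $$m(\mathbf{M},p)=\max\{j\in\mathbb{Z} : \beta^{\mathbf{A}}_{S,p,j}(\mathbf{M})\ne0\text{ for some }S\}<\infty .$$ Moreover, there are integers $j_0(\mathbf{M},p)<\cdots<j_t(\mathbf{M},p)\le m(\mathbf{M},p)$ such that for any $S$ with $|S|\gg0$ we have $$\beta^{\mathbf{A}}_{S,p,j}(\mathbf{M})\ne0\quad\text{if and only if}\quad j\in\{j_0(\mathbf{M},p),\dots,j_t(\mathbf{M},p)\}.$$ Here $S$ denotes a totally ordered finite set (or a finite set, respectively).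
   Context: $[n]=\{1,\dots,n\}$, $[0]=\emptyset$, $\mathbb{N}$ is the set of positive integers. $\mathrm{FI}$ is the category of finite sets and injective maps; $\mathrm{OI}$ is the category of totally ordered finite sets and order-preserving injective maps. An $\mathrm{OI}$-algebra (resp. $\mathrm{FI}$-algebra) over $K$ is a covariant functor $\mathbf{A}$ from $\mathrm{OI}$ (resp. $\mathrm{FI}$) to commutative associative unital $K$-algebras with $\mathbf{A}(\emptyset)=K$; write $\mathbf{A}_S=\mathbf{A}(S)$. An $\mathrm{OI}$-module (resp. $\mathrm{FI}$-module) over $\mathbf{A}$ is a covariant functor $\mathbf{M}$ from $\mathrm{OI}$ (resp. $\mathrm{FI}$) to $K$-modules such that each $\mathbf{M}_S=\mathbf{M}(S)$ is also an $\mathbf{A}_S$-module and, for all morphisms $\tilde\varepsilon\colon\tilde S\to S$, $\varepsilon\colon S\to T$ and all $a\in\mathbf{A}_{\tilde S}$, $q\in\mathbf{M}_S$, one has $\mathbf{M}(\varepsilon)(\mathbf{A}(\tilde\varepsilon)(a)\cdot q)=\mathbf{A}(\varepsilon\circ\tilde\varepsilon)(a)\cdot\mathbf{M}(\varepsilon)(q)$. Morphisms are natural transformations with $\mathbf{A}_S$-linear components; this category is abelian with all notions defined pointwise. A submodule is a family of $\mathbf{A}_S$-submodules stable under all $\mathbf{M}(\varepsilon)$. $\mathbf{M}$ is finitely generated if some finite subset of $\coprod_{n\ge0}\mathbf{M}([n])$ lies in no proper submodule; it is noetherian if every submodule is finitely generated. $\mathbf{A}$ is noetherian if it is noetherian as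 a module over itself. $\mathbf{A}$ is standard graded if every $\mathbf{A}_S=\bigoplus_{d\ge0}\mathbf{A}_{S,d}$ is a commutative finitely generated $\mathbb{Z}$-graded $K$-algebra generated in degree $1$ with $\mathbf{A}_{S,0}=K$, and all maps $\mathbf{A}(\varepsilon)$ are homogeneous of degree $0$; $\mathfrak{m}_S=\bigoplus_{d\ge1}\mathbf{A}_{S,d}$. A graded module $\mathbf{M}$ over $\mathbf{A}$ is a module such that every $\mathbf{M}_S$ is a $\mathbb{Z}$-graded $\mathbf{A}_S$-module and all $\mathbf{M}(\varepsilon)$ are graded homomorphisms of degree $0$. Let $\mathbf{K}$ be the module over $\mathbf{A}$ with $\mathbf{K}_S=\mathbf{A}_S/\mathfrak{m}_S\cong K$ and the natural maps. The tensor product $\mathbf{M}\otimes_{\mathbf{A}}\mathbf{N}$ is defined componentwise by $\mathbf{M}_S\otimes_{\mathbf{A}_S}\mathbf{N}_S$, and $\mathrm{Tor}^{\mathbf{A}}_p(\mathbf{M},\mathbf{N})$ are its left-derived functors (so, for finitely generated $\mathbf{M}$ and $\mathbf{N}$, $\mathrm{Tor}_p^{\mathbf{A}}(\mathbf{M},\mathbf{N})_S=\mathrm{Tor}_p^{\mathbf{A}_S}(\mathbf{M}_S,\mathbf{N}_S)$). The graded Betti numbers are $\beta^{\mathbf{A}}_{S,p,j}(\mathbf{M})=\dim_K\bigl(\mathrm{Tor}^{\mathbf{A}}_p(\mathbf{M},\mathbf{K})_S\bigr)_j$. *)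

theory Defs
  imports "HOL-Algebra.Module" "HOL-Algebra.Subrings" "HOL-Algebra.Generated_Groups"
    "HOL-Library.Extended_Real"
begin

section \<open>The categories OI and FI\<close>

text \<open>
  An object is a pair \<open>(S, r)\<close> of a finite set \<open>S\<close> and a relation \<open>r\<close> on it: a (reflexive)
  total order for OI and the empty relation, i.e. no structure at all, for FI.  With this encoding
  the morphisms of both categories are the injective maps that preserve the relations.  HOL has no
  type of all finite sets; the underlying sets range over the finite subsets of \<^typ>\<open>nat\<close>, with
  arbitrary total orders.  These form a full subcategory that meets every isomorphism class.

  Morphisms are extensional functions (undefined outside the source), so that equality of
  morphisms is equality of functions.
\<close>

datatype index_cat = OI | FI

type_synonym obj = "nat set \<times> nat rel"

fun objs :: "index_cat \<Rightarrow> obj set" where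
  "objs OI = {(S, r). finite S \<and> linear_order_on S r}"
| "objs FI = {(S, r). finite S \<and> r = {}}"

fun interval_obj :: "index_cat \<Rightarrow> nat \<Rightarrow> obj" where
  "interval_obj OI n = ({1..n}, {(x, y). x \<in> {1..n} \<and> y \<in> {1..n} \<and> x \<le> y})"
| "interval_obj FI n = ({1..n}, {})"

definition mor :: "obj \<Rightarrow> obj \<Rightarrow> (nat \<Rightarrow> nat) set" where
  "mor S T = {f \<in> fst S \<rightarrow>\<^sub>E fst T. inj_on f (fst S) \<and> (\<forall>(x, y) \<in> snd S. (f x, f y) \<in> snd T)}"

abbreviation id_mor :: "obj \<Rightarrow> nat \<Rightarrow> nat" where
  "id_mor S \<equiv> (\<lambda>x \<in> fst S. x)"

abbreviation comp_mor :: "obj \<Rightarrow> (nat \<Rightarrow> nat) \<Rightarrow> (nat \<Rightarrow> nat) \<Rightarrow> nat \<Rightarrow> nat" where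
  "comp_mor S g f \<equiv> compose (fst S) g f"


section \<open>Algebras and modules over OI and FI\<close>

text \<open>
  The same record carries algebras over a field \<open>K\<close> (each \<open>Obj A S\<close> is a \<open>K\<close>-algebra in the sense
  of \<^locale>\<open>algebra\<close>) and modules over such an algebra (each \<open>Obj M S\<close> is an \<open>Obj A S\<close>-module in
  the sense of \<^locale>\<open>module\<close>; the ring multiplication and unit fields of the record
  \<open>Obj M S\<close> are then meaningless).
\<close>

record ('r, 'm) functr =
  Obj :: "obj \<Rightarrow> ('r, 'm) module"
  Map :: "obj \<Rightarrow> obj \<Rightarrow> (nat \<Rightarrow> nat) \<Rightarrow> 'm \<Rightarrow> 'm"

record ('r, 'm) gfunctr = "('r, 'm) functr" +
  Gr :: "obj \<Rightarrow> int \<Rightarrow> 'm set"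

locale set_functor =
  fixes C :: index_cat and F :: "('r, 'm, 'z) functr_scheme"
  assumes Map_closed: "\<lbrakk>S \<in> objs C; T \<in> objs C; \<epsilon> \<in> mor S T; x \<in> carrier (Obj F S)\<rbrakk>
      \<Longrightarrow> Map F S T \<epsilon> x \<in> carrier (Obj F T)"
    and Map_id: "\<lbrakk>S \<in> objs C; x \<in> carrier (Obj F S)\<rbrakk> \<Longrightarrow> Map F S S (id_mor S) x = x"
    and Map_comp: "\<lbrakk>S \<in> objs C; T \<in> objs C; U \<in> objs C; \<epsilon> \<in> mor S T; \<eta> \<in> mor T U;
        x \<in> carrier (Obj F S)\<rbrakk>
      \<Longrightarrow> Map F S U (comp_mor S \<eta> \<epsilon>) x = Map F T U \<eta> (Map F S T \<epsilon> x)"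

locale cat_algebra = set_functor C A
  for K :: "'k ring" and C :: index_cat and A :: "('k, 'a, 'z) functr_scheme" +
  assumes algebra_Obj: "S \<in> objs C \<Longrightarrow> algebra K (Obj A S)"
    and ring_hom_Map: "\<lbrakk>S \<in> objs C; T \<in> objs C; \<epsilon> \<in> mor S T\<rbrakk>
      \<Longrightarrow> Map A S T \<epsilon> \<in> ring_hom (Obj A S) (Obj A T)"
    and linear_Map: "\<lbrakk>S \<in> objs C; T \<in> objs C; \<epsilon> \<in> mor S T; k \<in> carrier K; x \<in> carrier (Obj A S)\<rbrakk>
      \<Longrightarrow> Map A S T \<epsilon> (k \<odot>\<^bsub>Obj A S\<^esub> x) = k \<odot>\<^bsub>Obj A T\<^esub> Map A S T \<epsilon> x"
    and Obj_empty: "bij_betw (\<lambda>k. k \<odot>\<^bsub>Obj A ({}, {})\<^esub> \<one>\<^bsub>Obj A ({}, {})\<^esub>)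
        (carrier K) (carrier (Obj A ({}, {})))"

text \<open>
  The \<open>K\<close>-module structure of \<open>Obj M S\<close> is the one obtained from the \<open>Obj A S\<close>-module structure by
  restriction along \<open>k \<mapsto> k \<cdot> 1\<close>; \<open>K\<close>-linearity of the maps is then the case \<open>a = k \<cdot> 1\<close>,
  \<open>\<delta> = id\<close> of \<open>Map_smult\<close>.
\<close>

locale cat_module = set_functor C M
  for C :: index_cat and A :: "('k, 'a, 'y) functr_scheme" and M :: "('a, 'm, 'z) functr_scheme" +
  assumes module_Obj: "S \<in> objs C \<Longrightarrow> module (Obj A S) (Obj M S)"
    and Map_add: "\<lbrakk>S \<in> objs C; T \<in> objs C; \<epsilon> \<in> mor S T;
        x \<in> carrier (Obj M S); y \<in> carrier (Obj M S)\<rbrakk>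
      \<Longrightarrow> Map M S T \<epsilon> (x \<oplus>\<^bsub>Obj M S\<^esub> y) = Map M S T \<epsilon> x \<oplus>\<^bsub>Obj M T\<^esub> Map M S T \<epsilon> y"
    and Map_smult: "\<lbrakk>R \<in> objs C; S \<in> objs C; T \<in> objs C; \<delta> \<in> mor R S; \<epsilon> \<in> mor S T;
        a \<in> carrier (Obj A R); q \<in> carrier (Obj M S)\<rbrakk>
      \<Longrightarrow> Map M S T \<epsilon> (Map A R S \<delta> a \<odot>\<^bsub>Obj M S\<^esub> q)
        = Map A R T (comp_mor R \<epsilon> \<delta>) a \<odot>\<^bsub>Obj M T\<^esub> Map M S T \<epsilon> q"

definition cat_submodule ::
  "index_cat \<Rightarrow> ('k, 'a, 'y) functr_scheme \<Rightarrow> ('a, 'm, 'z) functr_scheme \<Rightarrow> (obj \<Rightarrow> 'm set) \<Rightarrow> bool"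
where
  "cat_submodule C A M N \<longleftrightarrow>
    (\<forall>S \<in> objs C. submodule (N S) (Obj A S) (Obj M S)) \<and>
    (\<forall>S \<in> objs C. \<forall>T \<in> objs C. \<forall>\<epsilon> \<in> mor S T. Map M S T \<epsilon> ` N S \<subseteq> N T)"

definition restrict_functor ::
  "('a, 'm, 'z) functr_scheme \<Rightarrow> (obj \<Rightarrow> 'm set) \<Rightarrow> ('a, 'm, 'z) functr_scheme"
where
  "restrict_functor M N = M\<lparr>Obj := \<lambda>S. (Obj M S)\<lparr>carrier := N S\<rparr>\<rparr>"

definition finitely_generated ::
  "index_cat \<Rightarrow> ('k, 'a, 'y) functr_scheme \<Rightarrow> ('a, 'm, 'z) functr_scheme \<Rightarrow> bool"
where
  "finitely_generated C A M \<longleftrightarrow>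
    (\<exists>G \<subseteq> Sigma UNIV (\<lambda>n. carrier (Obj M (interval_obj C n))). finite G \<and>
      (\<forall>N. cat_submodule C A M N \<and> (\<forall>(n, q) \<in> G. q \<in> N (interval_obj C n))
        \<longrightarrow> (\<forall>S \<in> objs C. N S = carrier (Obj M S))))"

definition noetherian_module ::
  "index_cat \<Rightarrow> ('k, 'a, 'y) functr_scheme \<Rightarrow> ('a, 'm, 'z) functr_scheme \<Rightarrow> bool"
where
  "noetherian_module C A M \<longleftrightarrow>
    (\<forall>N. cat_submodule C A M N \<longrightarrow> finitely_generated C A (restrict_functor M N))"

definition self_module :: "('k, 'a, 'z) functr_scheme \<Rightarrow> ('a, 'a) functr" where
  "self_module A = \<lparr>Obj = \<lambda>S. \<lparr>carrier = carrier (Obj A S), mult = mult (Obj A S),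
      one = one (Obj A S), zero = zero (Obj A S), add = add (Obj A S), smult = mult (Obj A S)\<rparr>,
    Map = Map A\<rparr>"

definition noetherian_algebra :: "index_cat \<Rightarrow> ('k, 'a, 'z) functr_scheme \<Rightarrow> bool" where
  "noetherian_algebra C A \<longleftrightarrow> noetherian_module C A (self_module A)"


section \<open>Gradings\<close>

text \<open>Internal direct sum decomposition of an abelian group into subgroups \<open>G d\<close>.\<close>

definition grading :: "('m, 'z) ring_scheme \<Rightarrow> (int \<Rightarrow> 'm set) \<Rightarrow> bool" where
  "grading M G \<longleftrightarrow>
    (\<forall>d. subgroup (G d) (add_monoid M)) \<and>
    (\<forall>x \<in> carrier M. \<exists>!f. (\<forall>d. f d \<in> G d) \<and> finite {d. f d \<noteq> \<zero>\<^bsub>M\<^esub>} \<and>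
      x = finsum M f {d. f d \<noteq> \<zero>\<^bsub>M\<^esub>})"

definition subalgebra_generated :: "'k ring \<Rightarrow> ('k, 'a, 'z) module_scheme \<Rightarrow> 'a set \<Rightarrow> 'a set" where
  "subalgebra_generated K R X = \<Inter>{B. subring B R \<and> submodule B K R \<and> X \<subseteq> B}"

locale standard_graded_algebra = cat_algebra K C A
  for K :: "'k ring" and C :: index_cat and A :: "('k, 'a) gfunctr" +
  assumes Gr_grading: "S \<in> objs C \<Longrightarrow> grading (Obj A S) (Gr A S)"
    and Gr_submodule: "S \<in> objs C \<Longrightarrow> submodule (Gr A S d) K (Obj A S)"
    and Gr_mult: "\<lbrakk>S \<in> objs C; a \<in> Gr A S d; b \<in> Gr A S e\<rbrakk> \<Longrightarrow> a \<otimes>\<^bsub>Obj A S\<^esub> b \<in> Gr A S (d + e)"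
    and Gr_negative: "\<lbrakk>S \<in> objs C; d < 0\<rbrakk> \<Longrightarrow> Gr A S d = {\<zero>\<^bsub>Obj A S\<^esub>}"
    and Gr_0: "S \<in> objs C \<Longrightarrow>
      bij_betw (\<lambda>k. k \<odot>\<^bsub>Obj A S\<^esub> \<one>\<^bsub>Obj A S\<^esub>) (carrier K) (Gr A S 0)"
    and finitely_generated_Obj: "S \<in> objs C \<Longrightarrow>
      \<exists>X \<subseteq> carrier (Obj A S). finite X \<and> subalgebra_generated K (Obj A S) X = carrier (Obj A S)"
    and generated_in_degree_1: "S \<in> objs C \<Longrightarrow>
      subalgebra_generated K (Obj A S) (Gr A S 1) = carrier (Obj A S)"
    and Gr_Map: "\<lbrakk>S \<in> objs C; T \<in> objs C; \<epsilon> \<in> mor S T\<rbrakk> \<Longrightarrow> Map A S T \<epsilon> ` Gr A S d \<subseteq> Gr A T d"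

locale graded_cat_module = cat_module C A M
  for C :: index_cat and A :: "('k, 'a) gfunctr" and M :: "('a, 'm) gfunctr" +
  assumes Gr_grading: "S \<in> objs C \<Longrightarrow> grading (Obj M S) (Gr M S)"
    and Gr_smult: "\<lbrakk>S \<in> objs C; a \<in> Gr A S d; x \<in> Gr M S e\<rbrakk> \<Longrightarrow> a \<odot>\<^bsub>Obj M S\<^esub> x \<in> Gr M S (d + e)"
    and Gr_Map: "\<lbrakk>S \<in> objs C; T \<in> objs C; \<epsilon> \<in> mor S T\<rbrakk> \<Longrightarrow> Map M S T \<epsilon> ` Gr M S d \<subseteq> Gr M T d"

definition graded_hom ::
  "index_cat \<Rightarrow> ('k, 'a) gfunctr \<Rightarrow> ('a, 'm) gfunctr \<Rightarrow> ('a, 'n) gfunctr \<Rightarrow> (obj \<Rightarrow> 'm \<Rightarrow> 'n) \<Rightarrow> bool"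
where
  "graded_hom C A M N f \<longleftrightarrow>
    (\<forall>S \<in> objs C. f S \<in> carrier (Obj M S) \<rightarrow> carrier (Obj N S)) \<and>
    (\<forall>S \<in> objs C. \<forall>x \<in> carrier (Obj M S). \<forall>y \<in> carrier (Obj M S).
      f S (x \<oplus>\<^bsub>Obj M S\<^esub> y) = f S x \<oplus>\<^bsub>Obj N S\<^esub> f S y) \<and>
    (\<forall>S \<in> objs C. \<forall>a \<in> carrier (Obj A S). \<forall>x \<in> carrier (Obj M S).
      f S (a \<odot>\<^bsub>Obj M S\<^esub> x) = a \<odot>\<^bsub>Obj N S\<^esub> f S x) \<and>
    (\<forall>S \<in> objs C. \<forall>d. f S ` Gr M S d \<subseteq> Gr N S d) \<and>
    (\<forall>S \<in> objs C. \<forall>T \<in> objs C. \<forall>\<epsilon> \<in> mor S T. \<forall>x \<in> carrier (Obj M S).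
      f T (Map M S T \<epsilon> x) = Map N S T \<epsilon> (f S x))"


section \<open>Quotients, free modules and tensor products over a ring\<close>

definition quotient_module ::
  "('a, 'm, 'z) module_scheme \<Rightarrow> 'm set \<Rightarrow> ('a, 'm set) module"
where
  "quotient_module M N = \<lparr>carrier = a_rcosets\<^bsub>M\<^esub> N, mult = undefined, one = undefined,
    zero = N, add = set_add M, smult = (\<lambda>a X. \<Union>x \<in> X. N +>\<^bsub>M\<^esub> (a \<odot>\<^bsub>M\<^esub> x))\<rparr>"

text \<open>The free module on \<open>X\<close>: finitely supported functions that vanish outside \<open>X\<close>.\<close>

definition free_module :: "('a, 'z) ring_scheme \<Rightarrow> 'x set \<Rightarrow> ('a, 'x \<Rightarrow> 'a) module" where
  "free_module R X = \<lparr>carrier = {f. range f \<subseteq> carrier R \<and> {x. f x \<noteq> \<zero>\<^bsub>R\<^esub>} \<subseteq> X \<and> finite {x. f x \<noteq> \<zero>\<^bsub>R\<^esub>}},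
    mult = undefined, one = undefined, zero = (\<lambda>_. \<zero>\<^bsub>R\<^esub>),
    add = (\<lambda>f g x. f x \<oplus>\<^bsub>R\<^esub> g x), smult = (\<lambda>a f x. a \<otimes>\<^bsub>R\<^esub> f x)\<rparr>"

definition free_gen :: "('a, 'z) ring_scheme \<Rightarrow> 'x \<Rightarrow> 'x \<Rightarrow> 'a" where
  "free_gen R x = (\<lambda>y. if y = x then \<one>\<^bsub>R\<^esub> else \<zero>\<^bsub>R\<^esub>)"

definition module_span ::
  "('a, 'y) ring_scheme \<Rightarrow> ('a, 'm, 'z) module_scheme \<Rightarrow> 'm set \<Rightarrow> 'm set"
where
  "module_span R M X = \<Inter>{N. submodule N R M \<and> X \<subseteq> N}"

definition tensor_rel ::
  "('a, 'y) ring_scheme \<Rightarrow> ('a, 'm) module \<Rightarrow> ('a, 'n) module \<Rightarrow> ('m \<times> 'n \<Rightarrow> 'a) set"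
where
  "tensor_rel R M N = (let F = free_module R (carrier M \<times> carrier N); g = free_gen R in
    module_span R F
     ({g (x \<oplus>\<^bsub>M\<^esub> x', y) \<ominus>\<^bsub>F\<^esub> (g (x, y) \<oplus>\<^bsub>F\<^esub> g (x', y)) | x x' y.
         x \<in> carrier M \<and> x' \<in> carrier M \<and> y \<in> carrier N} \<union>
      {g (x, y \<oplus>\<^bsub>N\<^esub> y') \<ominus>\<^bsub>F\<^esub> (g (x, y) \<oplus>\<^bsub>F\<^esub> g (x, y')) | x y y'.
         x \<in> carrier M \<and> y \<in> carrier N \<and> y' \<in> carrier N} \<union>
      {g (a \<odot>\<^bsub>M\<^esub> x, y) \<ominus>\<^bsub>F\<^esub> (a \<odot>\<^bsub>F\<^esub> g (x, y)) | a x y.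
         a \<in> carrier R \<and> x \<in> carrier M \<and> y \<in> carrier N} \<union>
      {g (x, a \<odot>\<^bsub>N\<^esub> y) \<ominus>\<^bsub>F\<^esub> (a \<odot>\<^bsub>F\<^esub> g (x, y)) | a x y.
         a \<in> carrier R \<and> x \<in> carrier M \<and> y \<in> carrier N}))"

definition tensor ::
  "('a, 'y) ring_scheme \<Rightarrow> ('a, 'm) module \<Rightarrow> ('a, 'n) module \<Rightarrow> ('a, ('m \<times> 'n \<Rightarrow> 'a) set) module"
where
  "tensor R M N = quotient_module (free_module R (carrier M \<times> carrier N)) (tensor_rel R M N)"

definition pure_tensor ::
  "('a, 'y) ring_scheme \<Rightarrow> ('a, 'm) module \<Rightarrow> ('a, 'n) module \<Rightarrow> 'm \<Rightarrow> 'n \<Rightarrow> ('m \<times> 'n \<Rightarrow> 'a) set"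
where
  "pure_tensor R M N x y =
    tensor_rel R M N +>\<^bsub>free_module R (carrier M \<times> carrier N)\<^esub> free_gen R (x, y)"

definition tensor_Gr ::
  "('a, 'y) ring_scheme \<Rightarrow> ('a, 'm) module \<Rightarrow> (int \<Rightarrow> 'm set) \<Rightarrow> ('a, 'n) module \<Rightarrow> (int \<Rightarrow> 'n set)
    \<Rightarrow> int \<Rightarrow> ('m \<times> 'n \<Rightarrow> 'a) set set"
where
  "tensor_Gr R M G N H j = generate (add_monoid (tensor R M N))
    {pure_tensor R M N x y | x y i. x \<in> G i \<and> y \<in> H (j - i)}"

text \<open>
  The map \<open>f \<otimes> id : M \<otimes> N \<rightarrow> M' \<otimes> N\<close> induced by a linear map \<open>f : M \<rightarrow> M'\<close>: the class of
  \<open>\<Sum> u(x,y) \<cdot> (x,y)\<close> goes to that of \<open>\<Sum> u(x,y) \<cdot> (f x,y)\<close>.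
\<close>

definition tensor_map ::
  "('a, 'y) ring_scheme \<Rightarrow> ('a, 'm) module \<Rightarrow> ('a, 'm') module \<Rightarrow> ('a, 'n) module \<Rightarrow> ('m \<Rightarrow> 'm')
    \<Rightarrow> ('m \<times> 'n \<Rightarrow> 'a) set \<Rightarrow> ('m' \<times> 'n \<Rightarrow> 'a) set"
where
  "tensor_map R M M' N f X = (let F' = free_module R (carrier M' \<times> carrier N) in
    \<Union>u \<in> X. tensor_rel R M' N +>\<^bsub>F'\<^esub>
      finsum F' (\<lambda>(x, y). u (x, y) \<odot>\<^bsub>F'\<^esub> free_gen R (f x, y)) {z. u z \<noteq> \<zero>\<^bsub>R\<^esub>})"


section \<open>Tor\<close>

text \<open>
  Graded free modules are the direct sums of shifts of the representable modules
  \<open>T \<mapsto> \<Oplus>\<^bsub>\<epsilon> : D \<rightarrow> T\<^esub> A\<^sub>T\<close>: there is a family \<open>B\<close> of homogeneous elements \<open>b \<in> P\<^sub>D\<close> such that the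
  \<open>P(\<epsilon>)(b)\<close>, for \<open>(D, b) \<in> B\<close> and \<open>\<epsilon> : D \<rightarrow> T\<close>, form a basis of every \<open>P\<^sub>T\<close>.  They are
  projective, and every graded module is a quotient of one.
\<close>

definition graded_free :: "index_cat \<Rightarrow> ('k, 'a) gfunctr \<Rightarrow> ('a, 'p) gfunctr \<Rightarrow> bool" where
  "graded_free C A P \<longleftrightarrow> (\<exists>B.
    (\<forall>(D, b) \<in> B. D \<in> objs C \<and> (\<exists>d. b \<in> Gr P D d)) \<and>
    (\<forall>T \<in> objs C. \<forall>x \<in> carrier (Obj P T). \<exists>!c.
      c \<in> carrier (free_module (Obj A T) {(D, b, \<epsilon>). (D, b) \<in> B \<and> \<epsilon> \<in> mor D T}) \<and>
      x = finsum (Obj P T) (\<lambda>(D, b, \<epsilon>). c (D, b, \<epsilon>) \<odot>\<^bsub>Obj P T\<^esub> Map P D T \<epsilon> b)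
            {z. c z \<noteq> \<zero>\<^bsub>Obj A T\<^esub>}))"

text \<open>
  Complexes \<open>\<cdots> \<rightarrow> P\<^sub>2 \<rightarrow> P\<^sub>1 \<rightarrow> P\<^sub>0 \<rightarrow> M\<close>; \<open>Diff P n\<close> is the map from \<open>Term P (n + 1)\<close> to \<open>Term P n\<close>.
\<close>

record ('a, 'm, 'p) augmented_complex =
  Term :: "nat \<Rightarrow> ('a, 'p) gfunctr"
  Diff :: "nat \<Rightarrow> obj \<Rightarrow> 'p \<Rightarrow> 'p"
  Aug :: "obj \<Rightarrow> 'p \<Rightarrow> 'm"

definition graded_free_resolution ::
  "index_cat \<Rightarrow> ('k, 'a) gfunctr \<Rightarrow> ('a, 'm) gfunctr \<Rightarrow> ('a, 'm, 'p) augmented_complex \<Rightarrow> bool"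
where
  "graded_free_resolution C A M P \<longleftrightarrow>
    (\<forall>n. graded_cat_module C A (Term P n) \<and> graded_free C A (Term P n)) \<and>
    (\<forall>n. graded_hom C A (Term P (Suc n)) (Term P n) (Diff P n)) \<and>
    graded_hom C A (Term P 0) M (Aug P) \<and>
    (\<forall>S \<in> objs C.
      Aug P S ` carrier (Obj (Term P 0) S) = carrier (Obj M S) \<and>
      Diff P 0 S ` carrier (Obj (Term P 1) S)
        = {x \<in> carrier (Obj (Term P 0) S). Aug P S x = \<zero>\<^bsub>Obj M S\<^esub>} \<and>
      (\<forall>n. Diff P (Suc n) S ` carrier (Obj (Term P (Suc (Suc n))) S)
        = {x \<in> carrier (Obj (Term P (Suc n)) S). Diff P n S x = \<zero>\<^bsub>Obj (Term P n) S\<^esub>}))"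

text \<open>
  Tor is computed from some free resolution, which by the comparison theorem may be any.  The type
  \<^typ>\<open>('a + 'm) list \<Rightarrow> 'a\<close> is large enough for every graded module with elements of type \<^typ>\<open>'m\<close> to
  have a free resolution in it: there are countably many objects and morphisms, so starting from
  the free module on all homogeneous elements of \<open>M\<close> and then repeatedly on those of the kernel,
  each \<open>P\<^sub>n\<close> evaluated at an object has a basis of cardinality at most
  \<open>max(\<aleph>\<^sub>0, |'a|, |'m|) = |('a + 'm) list|\<close>.
\<close>

definition free_resolution ::
  "index_cat \<Rightarrow> ('k, 'a) gfunctr \<Rightarrow> ('a, 'm) gfunctr
    \<Rightarrow> ('a, 'm, ('a + 'm) list \<Rightarrow> 'a) augmented_complex"
where
  "free_resolution C A M = (SOME P. graded_free_resolution C A M P)"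

type_synonym ('a, 'm, 'n) tor_chain = "((('a + 'm) list \<Rightarrow> 'a) \<times> 'n \<Rightarrow> 'a) set"

definition tor_term ::
  "index_cat \<Rightarrow> ('k, 'a) gfunctr \<Rightarrow> ('a, 'm) gfunctr \<Rightarrow> ('a, 'n) gfunctr \<Rightarrow> nat \<Rightarrow> obj
    \<Rightarrow> ('a, ('a, 'm, 'n) tor_chain) module"
where
  "tor_term C A M N p S = tensor (Obj A S) (Obj (Term (free_resolution C A M) p) S) (Obj N S)"

definition tor_diff ::
  "index_cat \<Rightarrow> ('k, 'a) gfunctr \<Rightarrow> ('a, 'm) gfunctr \<Rightarrow> ('a, 'n) gfunctr \<Rightarrow> nat \<Rightarrow> obj
    \<Rightarrow> ('a, 'm, 'n) tor_chain \<Rightarrow> ('a, 'm, 'n) tor_chain"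
where
  "tor_diff C A M N p S = (let P = free_resolution C A M in
    tensor_map (Obj A S) (Obj (Term P (Suc p)) S) (Obj (Term P p) S) (Obj N S) (Diff P p S))"

fun tor_cycles ::
  "index_cat \<Rightarrow> ('k, 'a) gfunctr \<Rightarrow> ('a, 'm) gfunctr \<Rightarrow> ('a, 'n) gfunctr \<Rightarrow> nat \<Rightarrow> obj
    \<Rightarrow> ('a, 'm, 'n) tor_chain set"
where
  "tor_cycles C A M N 0 S = carrier (tor_term C A M N 0 S)"
| "tor_cycles C A M N (Suc p) S =
    {z \<in> carrier (tor_term C A M N (Suc p) S). tor_diff C A M N p S z = \<zero>\<^bsub>tor_term C A M N p S\<^esub>}"

definition tor_boundaries ::
  "index_cat \<Rightarrow> ('k, 'a) gfunctr \<Rightarrow> ('a, 'm) gfunctr \<Rightarrow> ('a, 'n) gfunctr \<Rightarrow> nat \<Rightarrow> obj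
    \<Rightarrow> ('a, 'm, 'n) tor_chain set"
where
  "tor_boundaries C A M N p S =
    tor_diff C A M N p S ` carrier (tor_term C A M N (Suc p) S)"

text \<open>The \<open>S\<close>-component of \<open>Tor\<^sub>p(M, N)\<close>, an \<open>Obj A S\<close>-module, and its graded pieces.\<close>

definition tor ::
  "index_cat \<Rightarrow> ('k, 'a) gfunctr \<Rightarrow> ('a, 'm) gfunctr \<Rightarrow> ('a, 'n) gfunctr \<Rightarrow> nat \<Rightarrow> obj
    \<Rightarrow> ('a, ('a, 'm, 'n) tor_chain set) module"
where
  "tor C A M N p S =
    quotient_module ((tor_term C A M N p S)\<lparr>carrier := tor_cycles C A M N p S\<rparr>)
      (tor_boundaries C A M N p S)"

definition tor_Gr ::
  "index_cat \<Rightarrow> ('k, 'a) gfunctr \<Rightarrow> ('a, 'm) gfunctr \<Rightarrow> ('a, 'n) gfunctr \<Rightarrow> nat \<Rightarrow> obj \<Rightarrow> int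
    \<Rightarrow> ('a, 'm, 'n) tor_chain set set"
where
  "tor_Gr C A M N p S j = (let Q = Term (free_resolution C A M) p in
    {tor_boundaries C A M N p S +>\<^bsub>tor_term C A M N p S\<^esub> z | z.
      z \<in> tor_cycles C A M N p S \<inter> tensor_Gr (Obj A S) (Obj Q S) (Gr Q S) (Obj N S) (Gr N S) j})"


section \<open>Graded Betti numbers\<close>

definition max_ideal :: "('k, 'a) gfunctr \<Rightarrow> obj \<Rightarrow> 'a set" where
  "max_ideal A S = generate (add_monoid (Obj A S)) (\<Union>d \<in> {1..}. Gr A S d)"

definition residue_module :: "('k, 'a) gfunctr \<Rightarrow> ('a, 'a set) gfunctr" where
  "residue_module A = \<lparr>
    Obj = \<lambda>S. quotient_module (Obj (self_module A) S) (max_ideal A S),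
    Map = \<lambda>S T \<epsilon> X. \<Union>x \<in> X. max_ideal A T +>\<^bsub>Obj A T\<^esub> Map A S T \<epsilon> x,
    Gr = \<lambda>S d. (\<lambda>a. max_ideal A S +>\<^bsub>Obj A S\<^esub> a) ` Gr A S d\<rparr>"

definition restrict_scalars ::
  "('k, 'a, 'y) module_scheme \<Rightarrow> ('a, 'm, 'z) module_scheme \<Rightarrow> ('k, 'm) module"
where
  "restrict_scalars R M = \<lparr>carrier = carrier M, mult = mult M, one = one M, zero = zero M,
    add = add M, smult = (\<lambda>k x. (k \<odot>\<^bsub>R\<^esub> \<one>\<^bsub>R\<^esub>) \<odot>\<^bsub>M\<^esub> x)\<rparr>"

text \<open>Dimension as the maximal size of a linearly independent set, \<open>\<infinity>\<close> if there is no maximum.\<close>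

definition linearly_independent ::
  "('k, 'y) ring_scheme \<Rightarrow> ('k, 'v, 'z) module_scheme \<Rightarrow> 'v set \<Rightarrow> bool"
where
  "linearly_independent K V B \<longleftrightarrow> finite B \<and> B \<subseteq> carrier V \<and>
    (\<forall>c \<in> B \<rightarrow> carrier K. finsum V (\<lambda>b. c b \<odot>\<^bsub>V\<^esub> b) B = \<zero>\<^bsub>V\<^esub> \<longrightarrow> (\<forall>b \<in> B. c b = \<zero>\<^bsub>K\<^esub>))"

definition vdim :: "('k, 'y) ring_scheme \<Rightarrow> ('k, 'v, 'z) module_scheme \<Rightarrow> enat" where
  "vdim K V = Sup {enat (card B) | B. linearly_independent K V B}"

definition betti ::
  "'k ring \<Rightarrow> index_cat \<Rightarrow> ('k, 'a) gfunctr \<Rightarrow> ('a, 'm) gfunctr \<Rightarrow> obj \<Rightarrow> nat \<Rightarrow> int \<Rightarrow> enat"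
where
  "betti K C A M S p j = (let N = residue_module A in
    vdim K (restrict_scalars (Obj A S) ((tor C A M N p S)\<lparr>carrier := tor_Gr C A M N p S j\<rparr>)))"

definition betti_degrees ::
  "'k ring \<Rightarrow> index_cat \<Rightarrow> ('k, 'a) gfunctr \<Rightarrow> ('a, 'm) gfunctr \<Rightarrow> nat \<Rightarrow> int set"
where
  "betti_degrees K C A M p = {j. \<exists>S \<in> objs C. betti K C A M S p j \<noteq> 0}"

text \<open>The supremum is \<open>-\<infinity>\<close> if all Betti numbers vanish.\<close>

definition max_degree ::
  "'k ring \<Rightarrow> index_cat \<Rightarrow> ('k, 'a) gfunctr \<Rightarrow> ('a, 'm) gfunctr \<Rightarrow> nat \<Rightarrow> ereal"
where
  "max_degree K C A M p = (SUP j \<in> betti_degrees K C A M p. ereal (of_int j))"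

end

theory Submission
  imports Defs "HOL-Library.Countable_Set"
begin

text \<open>
  Write \<open>P\<close> for the chosen graded free resolution of \<open>M\<close> and \<open>\<mm>\<close> for the irrelevant ideal of
  \<open>A\<^sub>S\<close>.  Since \<open>A\<^sub>S/\<mm>\<close> is cyclic, \<open>P\<^sub>p \<otimes> A\<^sub>S/\<mm>\<close> is \<open>P\<^sub>p/\<mm>P\<^sub>p\<close>, and \<open>Tor\<^sub>p\<close> is \<open>Z/B\<close> with
  \<open>Z = {x \<in> P\<^sub>p. dx \<in> \<mm>P\<^sub>p\<^sub>-\<^sub>1}\<close> and \<open>B = dP\<^sub>p\<^sub>+\<^sub>1 + \<mm>P\<^sub>p\<close>.  So the Betti number at \<open>(S, j)\<close> is nonzero
  exactly if \<open>Z\<^sub>S\<close> has an element of degree \<open>j\<close> outside \<open>B\<^sub>S\<close> (\<open>betti_nonzero_iff\<close>).  Both \<open>Z\<close> and \<open>B\<close>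
  are graded submodules of the OI- or FI-module \<open>P\<^sub>p\<close>, and everything follows once \<open>Z/B\<close> is known to
  be finitely generated.

  Suppose it is generated by homogeneous elements \<open>w\<^sub>k \<in> Z\<close> in the components at \<open>[n\<^sub>k]\<close>.  As \<open>\<mm>\<close> kills
  \<open>Z/B\<close>, its part of degree \<open>j\<close> is generated by the translates of those \<open>w\<^sub>k\<close> that have degree \<open>j\<close>
  (\<open>spanning_degree\<close>).  Hence only finitely many degrees occur.  Moreover, if \<open>n\<^sub>k \<le> |S| \<le> |T|\<close> for
  all \<open>k\<close>, then every morphism \<open>[n\<^sub>k] \<rightarrow> T\<close> factors through \<open>S\<close> (\<open>mor_factor\<close>), so if degree \<open>j\<close> does
  not occur at \<open>S\<close>, it does not occur at \<open>T\<close> either (\<open>spanning_vanishing_persists\<close>).  For large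
  \<open>S\<close> the set of occurring degrees is therefore constant.

  The resolution \<open>P\<close> is arbitrary, in particular not finitely generated, so the finite generation
  of \<open>Z/B\<close> does not come from that of \<open>P\<^sub>p\<close>.  Instead there are finitely generated submodules
  \<open>G\<^sub>n \<subseteq> P\<^sub>n\<close> with \<open>G\<^sub>0\<close> mapping onto \<open>M\<close> and \<open>dG\<^sub>n\<^sub>+\<^sub>1 \<supseteq> G\<^sub>n \<inter> ker d\<close>: noetherianity makes the right-hand
  side finitely generated, and one lifts its generators (\<open>exact_sequence_generators\<close>).  At a fixed
  \<open>S\<close> the modules \<open>P\<^sub>n\<close> are free over \<open>A\<^sub>S\<close>, and the usual construction of comparison maps yields
  linear maps \<open>\<gamma> : P\<^sub>n \<rightarrow> G\<^sub>n\<close> and a homotopy \<open>h\<close> with \<open>x = \<gamma>x + dhx + hdx\<close>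
  (\<open>compression_decomposition\<close>).  If \<open>x \<in> Z\<close>, the last two terms lie in \<open>B\<close>.  Thus \<open>Z = (Z \<inter> G\<^sub>p) + B\<close>,
  and \<open>Z \<inter> G\<^sub>p\<close> is finitely generated.  The maps \<open>\<gamma>\<close> and \<open>h\<close> are
  constructed for each \<open>S\<close> separately, without regard to the grading.

  Two constructions depend on the types of elements.  Noetherianity is given for modules with
  elements of type \<^typ>\<open>nat \<Rightarrow> 'a\<close>; it is transferred to \<open>G\<^sub>n\<close> along a map from the free module on its
  generators, realised in that type (\<open>submodule_of_finitely_generated\<close>).  And \<^const>\<open>free_resolution\<close>
  is a choice, about which nothing is known until a resolution with elements of type
  \<^typ>\<open>('a + 'm) list \<Rightarrow> 'a\<close> has been constructed (\<open>graded_free_resolution_exists\<close>).  Both use the same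
  free modules, whose basis elements are encoded in an arbitrary type.
\<close>

section \<open>Linear maps, submodules and free modules\<close>

definition linear_map ::
  "('a, 'y) ring_scheme \<Rightarrow> ('a, 'm, 'z) module_scheme \<Rightarrow> ('a, 'n, 'w) module_scheme \<Rightarrow> ('m \<Rightarrow> 'n) \<Rightarrow> bool"
where
  "linear_map R M N f \<longleftrightarrow> f \<in> carrier M \<rightarrow> carrier N \<and>
    (\<forall>x \<in> carrier M. \<forall>y \<in> carrier M. f (x \<oplus>\<^bsub>M\<^esub> y) = f x \<oplus>\<^bsub>N\<^esub> f y) \<and>
    (\<forall>a \<in> carrier R. \<forall>x \<in> carrier M. f (a \<odot>\<^bsub>M\<^esub> x) = a \<odot>\<^bsub>N\<^esub> f x)"

lemma linear_mapI:
  assumes "\<And>x. x \<in> carrier M \<Longrightarrow> f x \<in> carrier N"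
    and "\<And>x y. \<lbrakk>x \<in> carrier M; y \<in> carrier M\<rbrakk> \<Longrightarrow> f (x \<oplus>\<^bsub>M\<^esub> y) = f x \<oplus>\<^bsub>N\<^esub> f y"
    and "\<And>a x. \<lbrakk>a \<in> carrier R; x \<in> carrier M\<rbrakk> \<Longrightarrow> f (a \<odot>\<^bsub>M\<^esub> x) = a \<odot>\<^bsub>N\<^esub> f x"
  shows "linear_map R M N f"
  using assms by (auto simp: linear_map_def)

lemma linear_mapD:
  assumes "linear_map R M N f"
  shows "x \<in> carrier M \<Longrightarrow> f x \<in> carrier N"
    and "\<lbrakk>x \<in> carrier M; y \<in> carrier M\<rbrakk> \<Longrightarrow> f (x \<oplus>\<^bsub>M\<^esub> y) = f x \<oplus>\<^bsub>N\<^esub> f y"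
    and "\<lbrakk>a \<in> carrier R; x \<in> carrier M\<rbrakk> \<Longrightarrow> f (a \<odot>\<^bsub>M\<^esub> x) = a \<odot>\<^bsub>N\<^esub> f x"
  using assms by (auto simp: linear_map_def)

lemma linear_zero:
  assumes "linear_map R M N f" "module R M" "module R N"
  shows "f \<zero>\<^bsub>M\<^esub> = \<zero>\<^bsub>N\<^esub>"
proof -
  interpret M: module R M by fact
  interpret N: module R N by fact
  have "f \<zero>\<^bsub>M\<^esub> = f (\<zero>\<^bsub>R\<^esub> \<odot>\<^bsub>M\<^esub> \<zero>\<^bsub>M\<^esub>)" by simp
  also have "\<dots> = \<zero>\<^bsub>R\<^esub> \<odot>\<^bsub>N\<^esub> f \<zero>\<^bsub>M\<^esub>" using linear_mapD(3)[OF assms(1)] M.R.zero_closed M.M.zero_closed by blast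
  also have "\<dots> = \<zero>\<^bsub>N\<^esub>" using linear_mapD(1)[OF assms(1)] by simp
  finally show ?thesis .
qed

lemma (in abelian_group) minus_eq_zero_iff:
  assumes "x \<in> carrier G" "y \<in> carrier G"
  shows "x \<ominus> y = \<zero> \<longleftrightarrow> x = y"
  using assms add.inv_solve_right'[of \<zero> x y] by (auto simp: a_minus_def r_neg)

lemma (in module) smult_minus_one: "x \<in> carrier M \<Longrightarrow> (\<ominus> \<one>) \<odot>\<^bsub>M\<^esub> x = \<ominus>\<^bsub>M\<^esub> x"
  by (simp add: smult_l_minus)

lemma linear_a_inv:
  assumes "linear_map R M N f" "module R M" "module R N" "x \<in> carrier M"
  shows "f (\<ominus>\<^bsub>M\<^esub> x) = \<ominus>\<^bsub>N\<^esub> f x"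
proof -
  interpret M: module R M by fact
  interpret N: module R N by fact
  show ?thesis
    using linear_mapD(3)[OF assms(1), of "\<ominus>\<^bsub>R\<^esub> \<one>\<^bsub>R\<^esub>" x] linear_mapD(1)[OF assms(1)] assms(4)
    by (simp add: M.smult_minus_one N.smult_minus_one)
qed

lemma linear_minus:
  assumes "linear_map R M N f" "module R M" "module R N" "x \<in> carrier M" "y \<in> carrier M"
  shows "f (x \<ominus>\<^bsub>M\<^esub> y) = f x \<ominus>\<^bsub>N\<^esub> f y"
proof -
  interpret M: module R M by fact
  interpret N: module R N by fact
  show ?thesis
    using assms linear_mapD(2)[OF assms(1)] linear_a_inv[OF assms(1-3)]
    by (simp add: a_minus_def)
qed

lemma linear_comp:
  "linear_map R M N f \<Longrightarrow> linear_map R N L g \<Longrightarrow> linear_map R M L (\<lambda>x. g (f x))"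
  by (rule linear_mapI) (simp_all add: linear_mapD)

lemma linear_id: "linear_map R M M (\<lambda>x. x)"
  by (rule linear_mapI) simp_all

lemma linear_add:
  assumes "linear_map R M N f" "linear_map R M N g" "module R N"
  shows "linear_map R M N (\<lambda>x. f x \<oplus>\<^bsub>N\<^esub> g x)"
proof -
  interpret N: module R N by fact
  show ?thesis
    using assms by (intro linear_mapI) (simp_all add: linear_mapD N.M.a_ac N.smult_r_distr)
qed

lemma linear_uminus:
  assumes "linear_map R M N f" "module R N"
  shows "linear_map R M N (\<lambda>x. \<ominus>\<^bsub>N\<^esub> f x)"
proof -
  interpret N: module R N by fact
  show ?thesis
    using assms by (intro linear_mapI) (simp_all add: linear_mapD N.M.minus_add N.smult_r_minus)
qed

lemma linear_diff:
  assumes "linear_map R M N f" "linear_map R M N g" "module R N"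
  shows "linear_map R M N (\<lambda>x. f x \<ominus>\<^bsub>N\<^esub> g x)"
  unfolding a_minus_def by (intro linear_add linear_uminus assms)

lemma submodule_subset: "submodule H R M \<Longrightarrow> H \<subseteq> carrier M"
  using subgroup.subset[OF submodule.axioms(1)] by fastforce

lemma submodule_zero: "submodule H R M \<Longrightarrow> \<zero>\<^bsub>M\<^esub> \<in> H"
  by (auto simp: submodule_def dest: subgroup.one_closed)

lemma submodule_add: "submodule H R M \<Longrightarrow> x \<in> H \<Longrightarrow> y \<in> H \<Longrightarrow> x \<oplus>\<^bsub>M\<^esub> y \<in> H"
  using subgroup.m_closed[OF submodule.axioms(1), of H R M x y] by simp

lemma submodule_minus:
  "submodule H R M \<Longrightarrow> module R M \<Longrightarrow> x \<in> H \<Longrightarrow> y \<in> H \<Longrightarrow> x \<ominus>\<^bsub>M\<^esub> y \<in> H"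
  unfolding a_minus_def by (intro submodule_add module.submoduleE(3)) auto

lemma submodule_finsum:
  assumes "submodule H R M" "module R M" "\<And>i. i \<in> I \<Longrightarrow> f i \<in> H"
  shows "finsum M f I \<in> H"
proof -
  interpret module R M by fact
  show ?thesis using assms(3)
  proof (induction I rule: infinite_finite_induct)
    case (insert i I)
    then have "f i \<in> carrier M" "f \<in> I \<rightarrow> carrier M" using submodule_subset[OF assms(1)] by auto
    then show ?case using insert by (simp add: submodule_add[OF assms(1)])
  qed (simp_all add: submodule_zero[OF assms(1)])
qed

lemma submodule_vimage:
  assumes "linear_map R M N f" "module R M" "module R N" "submodule H R N"
  shows "submodule {x \<in> carrier M. f x \<in> H} R M"
proof -
  interpret M: module R M by fact
  interpret N: module R N by fact
  show ?thesis
    by (rule M.submoduleI)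
      (use linear_mapD[OF assms(1)] linear_zero[OF assms(1-3)] linear_a_inv[OF assms(1-3)]
          submodule_zero[OF assms(4)] N.submoduleE[OF assms(4)] in auto)
qed

lemma submodule_Int:
  assumes "submodule H R M" "submodule H' R M" "module R M"
  shows "submodule (H \<inter> H') R M"
proof -
  interpret M: module R M by fact
  show ?thesis
    by (rule M.submoduleI) (use M.submoduleE[OF assms(1)] M.submoduleE[OF assms(2)]
        submodule_zero[OF assms(1)] submodule_zero[OF assms(2)] in auto)
qed

lemma submodule_zero_set: "module R M \<Longrightarrow> submodule {\<zero>\<^bsub>M\<^esub>} R M"
proof -
  assume "module R M"
  then interpret M: module R M .
  show ?thesis by (rule M.submoduleI) auto
qed

lemma submodule_kernel:
  assumes "linear_map R M N f" "module R M" "module R N"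
  shows "submodule {x \<in> carrier M. f x = \<zero>\<^bsub>N\<^esub>} R M"
  using submodule_vimage[OF assms submodule_zero_set[OF assms(3)]] by simp

lemma submodule_image:
  assumes "linear_map R M N f" "module R M" "module R N" "submodule H R M"
  shows "submodule (f ` H) R N"
proof -
  interpret M: module R M by fact
  interpret N: module R N by fact
  have sub: "H \<subseteq> carrier M" by (rule submodule_subset) fact
  note l = linear_mapD[OF assms(1)]
  show ?thesis
  proof (rule N.submoduleI)
    show "f ` H \<subseteq> carrier N" using sub l(1) by auto
    show "\<zero>\<^bsub>N\<^esub> \<in> f ` H"
      using linear_zero[OF assms(1-3)] submodule_zero[OF assms(4)] by (metis imageI)
    show "\<ominus>\<^bsub>N\<^esub> a \<in> f ` H" if "a \<in> f ` H" for a
      using that linear_a_inv[OF assms(1-3)] M.submoduleE(3)[OF assms(4)] sub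
      by (smt (verit, best) imageE image_eqI subsetD)
    show "a \<oplus>\<^bsub>N\<^esub> b \<in> f ` H" if "a \<in> f ` H" "b \<in> f ` H" for a b
      using that l(2) M.submoduleE(5)[OF assms(4)] sub
      by (smt (verit, best) imageE image_eqI subsetD)
    show "a \<odot>\<^bsub>N\<^esub> b \<in> f ` H" if "a \<in> carrier R" "b \<in> f ` H" for a b
      using that l(3) M.submoduleE(4)[OF assms(4)] sub
      by (smt (verit, best) imageE image_eqI subsetD)
  qed
qed

lemma linear_finsum:
  assumes "linear_map R M N f" "module R M" "module R N" "g \<in> I \<rightarrow> carrier M"
  shows "f (finsum M g I) = finsum N (\<lambda>i. f (g i)) I"
proof -
  interpret M: module R M by fact
  interpret N: module R N by fact
  note l = linear_mapD[OF assms(1)]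
  show ?thesis using assms(4)
  proof (induction I rule: infinite_finite_induct)
    case (insert i I)
    then have "g i \<in> carrier M" "g \<in> I \<rightarrow> carrier M" by auto
    moreover then have "(\<lambda>i. f (g i)) \<in> I \<rightarrow> carrier N" using l(1) by auto
    ultimately show ?case using insert l by simp
  qed (simp_all add: linear_zero[OF assms(1-3)])
qed

lemma linear_submodule_codomain:
  assumes "linear_map R M N f" "\<And>x. x \<in> carrier M \<Longrightarrow> f x \<in> H"
  shows "linear_map R M (N\<lparr>carrier := H\<rparr>) f"
  using assms by (auto simp: linear_map_def)

lemma linear_submodule_domain:
  assumes "linear_map R M N f" "H \<subseteq> carrier M"
  shows "linear_map R (M\<lparr>carrier := H\<rparr>) N f"
  using assms by (auto simp: linear_map_def subset_eq)

subsection \<open>Spans\<close>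

lemma module_span_submodule:
  assumes "module R M" "X \<subseteq> carrier M"
  shows "submodule (module_span R M X) R M"
proof -
  interpret M: module R M by fact
  have c: "carrier M \<in> {N. submodule N R M \<and> X \<subseteq> N}"
    using M.carrier_is_submodule assms by auto
  show ?thesis
    unfolding module_span_def
  proof (rule M.submoduleI)
    show "\<Inter>{N. submodule N R M \<and> X \<subseteq> N} \<subseteq> carrier M" using c by blast
  qed (auto intro: submodule_zero submodule_add M.submoduleE(3,4))
qed

lemma module_span_incl: "X \<subseteq> module_span R M X"
  by (auto simp: module_span_def)

lemma module_span_least: "submodule N R M \<Longrightarrow> X \<subseteq> N \<Longrightarrow> module_span R M X \<subseteq> N"
  by (auto simp: module_span_def)

lemma module_span_linear:
  assumes "linear_map R M N f" "module R M" "module R N" "submodule H R N"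
    "X \<subseteq> carrier M" "\<And>x. x \<in> X \<Longrightarrow> f x \<in> H" "u \<in> module_span R M X"
  shows "f u \<in> H"
  using module_span_least[OF submodule_vimage[OF assms(1-4)], of X] assms(5-7) by auto

subsection \<open>Free modules\<close>

lemma free_module_simps:
  "\<zero>\<^bsub>free_module R X\<^esub> = (\<lambda>_. \<zero>\<^bsub>R\<^esub>)"
  "f \<oplus>\<^bsub>free_module R X\<^esub> g = (\<lambda>x. f x \<oplus>\<^bsub>R\<^esub> g x)"
  "a \<odot>\<^bsub>free_module R X\<^esub> f = (\<lambda>x. a \<otimes>\<^bsub>R\<^esub> f x)"
  by (simp_all add: free_module_def)

lemma free_moduleI:
  assumes "\<And>x. f x \<in> carrier R" "\<And>x. f x \<noteq> \<zero>\<^bsub>R\<^esub> \<Longrightarrow> x \<in> X" "finite {x. f x \<noteq> \<zero>\<^bsub>R\<^esub>}"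
  shows "f \<in> carrier (free_module R X)"
  using assms by (auto simp: free_module_def)

lemma free_moduleD:
  assumes "f \<in> carrier (free_module R X)"
  shows "f x \<in> carrier R" "f x \<noteq> \<zero>\<^bsub>R\<^esub> \<Longrightarrow> x \<in> X" "finite {x. f x \<noteq> \<zero>\<^bsub>R\<^esub>}"
  using assms by (auto simp: free_module_def)

context cring
begin

lemma free_module_add_closed:
  assumes f: "f \<in> carrier (free_module R X)" and g: "g \<in> carrier (free_module R X)"
  shows "(\<lambda>x. f x \<oplus> g x) \<in> carrier (free_module R X)"
proof (rule free_moduleI)
  note d = free_moduleD[OF f] free_moduleD[OF g]
  show "f x \<oplus> g x \<in> carrier R" for x using d by auto
  have sub: "{x. f x \<oplus> g x \<noteq> \<zero>} \<subseteq> {x. f x \<noteq> \<zero>} \<union> {x. g x \<noteq> \<zero>}" by auto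
  then show "f x \<oplus> g x \<noteq> \<zero> \<Longrightarrow> x \<in> X" for x using d(2,5) by blast
  show "finite {x. f x \<oplus> g x \<noteq> \<zero>}" by (rule finite_subset[OF sub]) (use d in auto)
qed

lemma free_module_map_closed:
  assumes f: "f \<in> carrier (free_module R X)"
    and "\<And>a. a \<in> carrier R \<Longrightarrow> h a \<in> carrier R" "h \<zero> = \<zero>"
  shows "(\<lambda>x. h (f x)) \<in> carrier (free_module R X)"
proof (rule free_moduleI)
  note d = free_moduleD[OF f]
  show "h (f x) \<in> carrier R" for x using d assms by auto
  have sub: "{x. h (f x) \<noteq> \<zero>} \<subseteq> {x. f x \<noteq> \<zero>}" using assms(3) by auto
  then show "h (f x) \<noteq> \<zero> \<Longrightarrow> x \<in> X" for x using d(2) by blast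
  show "finite {x. h (f x) \<noteq> \<zero>}" by (rule finite_subset[OF sub]) (use d in auto)
qed

lemma free_module_module: "module R (free_module R X)"
proof (intro moduleI abelian_groupI)
  show "cring R" by (rule is_cring)
  show "\<exists>y \<in> carrier (free_module R X). y \<oplus>\<^bsub>free_module R X\<^esub> f = \<zero>\<^bsub>free_module R X\<^esub>"
    if f: "f \<in> carrier (free_module R X)" for f
    by (rule bexI[of _ "\<lambda>x. \<ominus> f x"])
      (use free_module_map_closed[OF f, of "\<lambda>a. \<ominus> a"] free_moduleD[OF f] in
        \<open>auto simp: free_module_simps l_neg\<close>)
qed (auto simp: free_module_simps free_module_add_closed free_module_map_closed fun_eq_iff
    free_moduleD(1) l_distr r_distr a_ac m_assoc intro: free_moduleI)

lemma free_module_a_inv: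
  assumes f: "f \<in> carrier (free_module R X)"
  shows "\<ominus>\<^bsub>free_module R X\<^esub> f = (\<lambda>x. \<ominus> f x)"
proof -
  interpret F: module R "free_module R X" by (rule free_module_module)
  show ?thesis
    by (rule F.M.minus_equality)
      (use free_module_map_closed[OF f, of "\<lambda>a. \<ominus> a"] free_moduleD[OF f] f in
        \<open>auto simp: free_module_simps l_neg\<close>)
qed

lemma free_gen_closed: "x \<in> X \<Longrightarrow> free_gen R x \<in> carrier (free_module R X)"
  by (rule free_moduleI) (auto simp: free_gen_def split: if_splits)

text \<open>
  By induction on the support: one coefficient is split off at a time.
\<close>

lemma free_module_induct:
  assumes H: "submodule H R (free_module R X)" and gen: "\<And>x. x \<in> X \<Longrightarrow> free_gen R x \<in> H"
    and u: "u \<in> carrier (free_module R X)"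
  shows "u \<in> H"
proof -
  interpret F: module R "free_module R X" by (rule free_module_module)
  have "finite Y \<Longrightarrow> u \<in> carrier (free_module R X) \<Longrightarrow> {x. u x \<noteq> \<zero>} \<subseteq> Y \<Longrightarrow> u \<in> H" for Y u
  proof (induction Y arbitrary: u rule: finite_induct)
    case empty
    then have "u = \<zero>\<^bsub>free_module R X\<^esub>" by (auto simp: free_module_simps)
    then show ?case using submodule_zero[OF H] by simp
  next
    case (insert z Y)
    note d = free_moduleD[OF insert.prems(1)]
    show ?case
    proof (cases "u z = \<zero>")
      case True
      then show ?thesis using insert by blast
    next
      case False
      then have zX: "z \<in> X" using d by auto
      let ?v = "u(z := \<zero>)"
      have v: "?v \<in> carrier (free_module R X)"
        by (rule free_moduleI) (use d in \<open>auto split: if_splits intro: finite_subset[OF _ d(3)]\<close>)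
      have "u = (u z \<odot>\<^bsub>free_module R X\<^esub> free_gen R z) \<oplus>\<^bsub>free_module R X\<^esub> ?v"
        using d by (auto simp: free_module_simps free_gen_def)
      moreover have "?v \<in> H" by (rule insert.IH[OF v]) (use insert.prems in auto)
      moreover have "u z \<odot>\<^bsub>free_module R X\<^esub> free_gen R z \<in> H"
        by (rule F.submoduleE(4)[OF H]) (use d gen zX in auto)
      ultimately show ?thesis using submodule_add[OF H] by metis
    qed
  qed
  then show ?thesis using u free_moduleD(3)[OF u] by blast
qed

end

text \<open>
  The linear extension of \<open>g\<close> from the basis \<open>X\<close> of a free module, in the form in which
  combinations of basis elements are written in \<^const>\<open>graded_free\<close> and \<^const>\<open>tensor_map\<close>.
\<close>

definition lin_comb ::
  "('a, 'y) ring_scheme \<Rightarrow> ('a, 'm, 'z) module_scheme \<Rightarrow> ('x \<Rightarrow> 'm) \<Rightarrow> ('x \<Rightarrow> 'a) \<Rightarrow> 'm"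
where
  "lin_comb R M g u = finsum M (\<lambda>z. u z \<odot>\<^bsub>M\<^esub> g z) {z. u z \<noteq> \<zero>\<^bsub>R\<^esub>}"

context module
begin

text \<open>
  Two combinations can only be added over a common finite index set, hence the freedom in \<open>Y\<close>.
\<close>

lemma lin_comb_superset:
  assumes "u \<in> carrier (free_module R X)" "g \<in> X \<rightarrow> carrier M" "finite Y" "{z. u z \<noteq> \<zero>} \<subseteq> Y" "Y \<subseteq> X"
  shows "lin_comb R M g u = finsum M (\<lambda>z. u z \<odot>\<^bsub>M\<^esub> g z) Y"
  unfolding lin_comb_def
proof (rule M.add.finprod_mono_neutral_cong_left)
  note d = free_moduleD[OF assms(1)]
  show "u i \<odot>\<^bsub>M\<^esub> g i = \<zero>\<^bsub>M\<^esub>" if "i \<in> Y - {z. u z \<noteq> \<zero>}" for i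
  proof -
    have "g i \<in> carrier M" using that assms by auto
    then show ?thesis using that by auto
  qed
  show "(\<lambda>z. u z \<odot>\<^bsub>M\<^esub> g z) \<in> Y \<rightarrow> carrier M" using d(1) assms(2,5) by (auto simp: Pi_iff)
qed (use assms in auto)

lemma lin_comb_closed:
  assumes "u \<in> carrier (free_module R X)" "g \<in> X \<rightarrow> carrier M"
  shows "lin_comb R M g u \<in> carrier M"
  unfolding lin_comb_def
  by (rule M.finsum_closed) (use free_moduleD[OF assms(1)] assms(2) in auto)

lemma lin_comb_linear:
  assumes g: "g \<in> X \<rightarrow> carrier M"
  shows "linear_map R (free_module R X) M (lin_comb R M g)"
proof (rule linear_mapI)
  interpret F: module R "free_module R X" by (rule R.free_module_module)
  show "lin_comb R M g x \<in> carrier M" if "x \<in> carrier (free_module R X)" for x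
    by (rule lin_comb_closed[OF that g])
  show "lin_comb R M g (x \<oplus>\<^bsub>free_module R X\<^esub> y) = lin_comb R M g x \<oplus>\<^bsub>M\<^esub> lin_comb R M g y"
    if x: "x \<in> carrier (free_module R X)" and y: "y \<in> carrier (free_module R X)" for x y
  proof -
    note dx = free_moduleD[OF x] note dy = free_moduleD[OF y]
    let ?Y = "{z. x z \<noteq> \<zero>} \<union> {z. y z \<noteq> \<zero>}"
    have Y: "finite ?Y" "?Y \<subseteq> X" using dx dy by auto
    have g': "z \<in> ?Y \<Longrightarrow> g z \<in> carrier M" for z using g Y(2) by auto
    have xy: "x \<oplus>\<^bsub>free_module R X\<^esub> y \<in> carrier (free_module R X)" using x y by simp
    have "lin_comb R M g (x \<oplus>\<^bsub>free_module R X\<^esub> y)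
      = finsum M (\<lambda>z. (x \<oplus>\<^bsub>free_module R X\<^esub> y) z \<odot>\<^bsub>M\<^esub> g z) ?Y"
      by (rule lin_comb_superset[OF xy g Y(1) _ Y(2)]) (auto simp: free_module_simps)
    also have "\<dots> = finsum M (\<lambda>z. x z \<odot>\<^bsub>M\<^esub> g z \<oplus>\<^bsub>M\<^esub> y z \<odot>\<^bsub>M\<^esub> g z) ?Y"
      using dx(1) dy(1) g' by (intro M.finsum_cong') (auto simp: free_module_simps smult_l_distr)
    also have "\<dots> = finsum M (\<lambda>z. x z \<odot>\<^bsub>M\<^esub> g z) ?Y \<oplus>\<^bsub>M\<^esub> finsum M (\<lambda>z. y z \<odot>\<^bsub>M\<^esub> g z) ?Y"
      using dx(1) dy(1) g' by (intro M.finsum_addf) auto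
    finally show ?thesis
      using lin_comb_superset[OF x g Y(1) _ Y(2)] lin_comb_superset[OF y g Y(1) _ Y(2)] by auto
  qed
  show "lin_comb R M g (a \<odot>\<^bsub>free_module R X\<^esub> x) = a \<odot>\<^bsub>M\<^esub> lin_comb R M g x"
    if a: "a \<in> carrier R" and x: "x \<in> carrier (free_module R X)" for a x
  proof -
    note dx = free_moduleD[OF x]
    let ?Y = "{z. x z \<noteq> \<zero>}"
    have Y: "finite ?Y" "?Y \<subseteq> X" using dx by auto
    have g': "z \<in> ?Y \<Longrightarrow> g z \<in> carrier M" for z using g Y(2) by auto
    have ax: "a \<odot>\<^bsub>free_module R X\<^esub> x \<in> carrier (free_module R X)" using a x by simp
    have "lin_comb R M g (a \<odot>\<^bsub>free_module R X\<^esub> x)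
      = finsum M (\<lambda>z. (a \<odot>\<^bsub>free_module R X\<^esub> x) z \<odot>\<^bsub>M\<^esub> g z) ?Y"
      by (rule lin_comb_superset[OF ax g Y(1) _ Y(2)]) (use a in \<open>auto simp: free_module_simps\<close>)
    also have "\<dots> = finsum M (\<lambda>z. a \<odot>\<^bsub>M\<^esub> (x z \<odot>\<^bsub>M\<^esub> g z)) ?Y"
      using dx(1) g' a by (intro M.finsum_cong') (auto simp: free_module_simps smult_assoc1)
    also have "\<dots> = a \<odot>\<^bsub>M\<^esub> lin_comb R M g x"
      unfolding lin_comb_def using Y(1) a dx(1) g' by (intro finsum_smult_ldistr[symmetric]) auto
    finally show ?thesis .
  qed
qed

lemma lin_comb_free_gen:
  assumes "x \<in> X" "g \<in> X \<rightarrow> carrier M"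
  shows "lin_comb R M g (free_gen R x) = g x"
proof -
  have gx: "g x \<in> carrier M" using assms by auto
  have "lin_comb R M g (free_gen R x) = finsum M (\<lambda>z. free_gen R x z \<odot>\<^bsub>M\<^esub> g z) {x}"
    by (rule lin_comb_superset[OF R.free_gen_closed[OF assms(1)] assms(2)])
      (use assms(1) in \<open>auto simp: free_gen_def\<close>)
  also have "\<dots> = g x" using gx by (simp add: free_gen_def)
  finally show ?thesis .
qed

lemma free_module_linear_eq:
  assumes "linear_map R (free_module R X) M f" "linear_map R (free_module R X) M f'"
    and "\<And>x. x \<in> X \<Longrightarrow> f (free_gen R x) = f' (free_gen R x)" "u \<in> carrier (free_module R X)"
  shows "f u = f' u"
proof -
  have F: "module R (free_module R X)" by (rule R.free_module_module)
  have M: "module R M" by (rule module_axioms)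
  note l = linear_mapD(1)[OF assms(1)] linear_mapD(1)[OF assms(2)]
  have H: "submodule {u \<in> carrier (free_module R X). f u \<ominus>\<^bsub>M\<^esub> f' u = \<zero>\<^bsub>M\<^esub>} R (free_module R X)"
    by (rule submodule_kernel[OF linear_diff[OF assms(1,2) M] F M])
  have "free_gen R x \<in> {u \<in> carrier (free_module R X). f u \<ominus>\<^bsub>M\<^esub> f' u = \<zero>\<^bsub>M\<^esub>}" if "x \<in> X" for x
  proof -
    have c: "free_gen R x \<in> carrier (free_module R X)" by (rule R.free_gen_closed[OF that])
    show ?thesis using l(2)[OF c] assms(3)[OF that] c by (simp add: M.minus_eq_zero_iff)
  qed
  from R.free_module_induct[OF H this assms(4)] show ?thesis
    using l(1)[OF assms(4)] l(2)[OF assms(4)] by (simp add: M.minus_eq_zero_iff)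
qed

lemma lin_comb_in_submodule:
  assumes "submodule H R M" "\<And>x. x \<in> X \<Longrightarrow> g x \<in> H" "u \<in> carrier (free_module R X)"
  shows "lin_comb R M g u \<in> H"
  unfolding lin_comb_def
  by (rule submodule_finsum[OF assms(1) module_axioms])
    (use assms free_moduleD[OF assms(3)] submoduleE(4)[OF assms(1)] in auto)

end

section \<open>Quotient modules\<close>

text \<open>
  Transports the module axioms to a quotient without looking at the set-theoretic operations on
  cosets.
\<close>

lemma module_surj:
  assumes M: "module R M" and l: "linear_map R M Q f"
    and surj: "f ` carrier M = carrier Q" and zero: "f \<zero>\<^bsub>M\<^esub> = \<zero>\<^bsub>Q\<^esub>"
  shows "module R Q"
proof -
  interpret M: module R M by fact
  note l = linear_mapD[OF l]
  have ex: "\<exists>x \<in> carrier M. y = f x" if "y \<in> carrier Q" for y using that surj by blast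
  show ?thesis
  proof (intro moduleI abelian_groupI)
    show "cring R" by (rule M.R.is_cring)
    show "\<zero>\<^bsub>Q\<^esub> \<in> carrier Q" using l(1) zero by (metis M.M.zero_closed)
    fix x assume "x \<in> carrier Q"
    then obtain x' where x: "x' \<in> carrier M" "x = f x'" using ex by blast
    show "\<zero>\<^bsub>Q\<^esub> \<oplus>\<^bsub>Q\<^esub> x = x" unfolding zero[symmetric] x(2) using x(1) l(2)[symmetric] by simp
    show "\<exists>y \<in> carrier Q. y \<oplus>\<^bsub>Q\<^esub> x = \<zero>\<^bsub>Q\<^esub>"
      using l(1) l(2)[of "\<ominus>\<^bsub>M\<^esub> x'" x'] x zero by (auto intro!: bexI[of _ "f (\<ominus>\<^bsub>M\<^esub> x')"] simp: M.M.l_neg)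
    show "\<one>\<^bsub>R\<^esub> \<odot>\<^bsub>Q\<^esub> x = x" using l(3)[of "\<one>\<^bsub>R\<^esub>" x'] x by simp
    fix y assume "y \<in> carrier Q"
    then obtain y' where y: "y' \<in> carrier M" "y = f y'" using ex by blast
    show "x \<oplus>\<^bsub>Q\<^esub> y \<in> carrier Q" using l(1,2) x y by (metis M.M.a_closed)
    show "x \<oplus>\<^bsub>Q\<^esub> y = y \<oplus>\<^bsub>Q\<^esub> x"
      using l(2)[OF x(1) y(1)] l(2)[OF y(1) x(1)] x y by (simp add: M.M.a_comm)
    show "x \<oplus>\<^bsub>Q\<^esub> y \<oplus>\<^bsub>Q\<^esub> z = x \<oplus>\<^bsub>Q\<^esub> (y \<oplus>\<^bsub>Q\<^esub> z)" if z: "z \<in> carrier Q" for z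
    proof -
      obtain z' where "z' \<in> carrier M" "z = f z'" using ex z by blast
      then show ?thesis using x y by (simp add: l(2)[symmetric] M.M.a_assoc)
    qed
  next
    fix a x assume a: "a \<in> carrier R" and "x \<in> carrier Q"
    then obtain x' where x: "x' \<in> carrier M" "x = f x'" using ex by blast
    show "a \<odot>\<^bsub>Q\<^esub> x \<in> carrier Q" using l(1,3) a x by (metis M.smult_closed)
    show "a \<odot>\<^bsub>Q\<^esub> (x \<oplus>\<^bsub>Q\<^esub> y) = a \<odot>\<^bsub>Q\<^esub> x \<oplus>\<^bsub>Q\<^esub> a \<odot>\<^bsub>Q\<^esub> y" if y: "y \<in> carrier Q" for y
    proof -
      obtain y' where "y' \<in> carrier M" "y = f y'" using ex y by blast
      then show ?thesis using x a by (simp add: l(2,3)[symmetric] M.smult_r_distr)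
    qed
    fix b assume b: "b \<in> carrier R"
    show "(a \<oplus>\<^bsub>R\<^esub> b) \<odot>\<^bsub>Q\<^esub> x = a \<odot>\<^bsub>Q\<^esub> x \<oplus>\<^bsub>Q\<^esub> b \<odot>\<^bsub>Q\<^esub> x"
      using a b x by (simp add: l(2,3)[symmetric] M.smult_l_distr)
    show "a \<otimes>\<^bsub>R\<^esub> b \<odot>\<^bsub>Q\<^esub> x = a \<odot>\<^bsub>Q\<^esub> (b \<odot>\<^bsub>Q\<^esub> x)"
      using a b x by (simp add: l(2,3)[symmetric] M.smult_assoc1)
  qed
qed

context module
begin

lemma submodule_abelian_subgroup: "submodule N R M \<Longrightarrow> abelian_subgroup N M"
  by (rule abelian_subgroupI3) (auto intro: additive_subgroup.intro M.abelian_group_axioms dest: submodule.axioms(1))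

lemma coset_eq_iff:
  assumes N: "submodule N R M" and x: "x \<in> carrier M" and y: "y \<in> carrier M"
  shows "N +>\<^bsub>M\<^esub> x = N +>\<^bsub>M\<^esub> y \<longleftrightarrow> x \<ominus>\<^bsub>M\<^esub> y \<in> N"
proof -
  interpret N: abelian_subgroup N M by (rule submodule_abelian_subgroup[OF N])
  have "N +>\<^bsub>M\<^esub> x = N +>\<^bsub>M\<^esub> y \<longleftrightarrow> x \<in> N +>\<^bsub>M\<^esub> y"
    using N.a_repr_independence' N.a_rcos_self x y by blast
  also have "\<dots> \<longleftrightarrow> x \<ominus>\<^bsub>M\<^esub> y \<in> N"
    using N.a_rcos_module[OF y x] by (simp add: a_minus_def)
  finally show ?thesis .
qed

lemma coset_eq_self_iff:
  assumes N: "submodule N R M" and x: "x \<in> carrier M"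
  shows "N +>\<^bsub>M\<^esub> x = N \<longleftrightarrow> x \<in> N"
proof -
  have "N +>\<^bsub>M\<^esub> \<zero>\<^bsub>M\<^esub> = N"
    using submodule_subset[OF N] by (simp add: M.a_coset_add_zero)
  then show ?thesis using coset_eq_iff[OF N x M.zero_closed] x M.minus_equality[of "\<zero>\<^bsub>M\<^esub>" "\<zero>\<^bsub>M\<^esub>"]
    by (simp add: a_minus_def)
qed

lemma quotient_module_linear:
  assumes N: "submodule N R M"
  shows "linear_map R M (quotient_module M N) (\<lambda>x. N +>\<^bsub>M\<^esub> x)"
proof (rule linear_mapI)
  interpret N: abelian_subgroup N M by (rule submodule_abelian_subgroup[OF N])
  show "N +>\<^bsub>M\<^esub> x \<in> carrier (quotient_module M N)" if "x \<in> carrier M" for x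
    using that by (auto simp: quotient_module_def A_RCOSETS_def')
  show "N +>\<^bsub>M\<^esub> (x \<oplus>\<^bsub>M\<^esub> y) = (N +>\<^bsub>M\<^esub> x) \<oplus>\<^bsub>quotient_module M N\<^esub> (N +>\<^bsub>M\<^esub> y)"
    if "x \<in> carrier M" "y \<in> carrier M" for x y
    using N.a_rcos_sum[OF that] by (simp add: quotient_module_def)
  show "N +>\<^bsub>M\<^esub> (a \<odot>\<^bsub>M\<^esub> x) = a \<odot>\<^bsub>quotient_module M N\<^esub> (N +>\<^bsub>M\<^esub> x)"
    if a: "a \<in> carrier R" and x: "x \<in> carrier M" for a x
  proof -
    have "N +>\<^bsub>M\<^esub> (a \<odot>\<^bsub>M\<^esub> y) = N +>\<^bsub>M\<^esub> (a \<odot>\<^bsub>M\<^esub> x)" if y: "y \<in> N +>\<^bsub>M\<^esub> x" for y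
    proof -
      have yc: "y \<in> carrier M" using y x N.a_elemrcos_carrier by blast
      have "N +>\<^bsub>M\<^esub> y = N +>\<^bsub>M\<^esub> x" using N.a_repr_independence'[OF y x] by simp
      then have "y \<ominus>\<^bsub>M\<^esub> x \<in> N" using coset_eq_iff[OF N yc x] by simp
      then have "a \<odot>\<^bsub>M\<^esub> (y \<ominus>\<^bsub>M\<^esub> x) \<in> N" using submoduleE(4)[OF N a] by blast
      also have "a \<odot>\<^bsub>M\<^esub> (y \<ominus>\<^bsub>M\<^esub> x) = a \<odot>\<^bsub>M\<^esub> y \<ominus>\<^bsub>M\<^esub> a \<odot>\<^bsub>M\<^esub> x"
        using a x yc by (simp add: a_minus_def smult_r_distr smult_r_minus)
      finally show ?thesis using coset_eq_iff[OF N] a x yc by simp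
    qed
    then have "(\<Union>y \<in> N +>\<^bsub>M\<^esub> x. N +>\<^bsub>M\<^esub> (a \<odot>\<^bsub>M\<^esub> y)) = (\<Union>y \<in> N +>\<^bsub>M\<^esub> x. N +>\<^bsub>M\<^esub> (a \<odot>\<^bsub>M\<^esub> x))"
      by (rule SUP_cong[OF refl])
    also have "\<dots> = N +>\<^bsub>M\<^esub> (a \<odot>\<^bsub>M\<^esub> x)" using N.a_rcos_self[OF x] by (subst UN_constant) auto
    finally show ?thesis by (simp add: quotient_module_def)
  qed
qed

lemma quotient_module_carrier: "carrier (quotient_module M N) = (\<lambda>x. N +>\<^bsub>M\<^esub> x) ` carrier M"
  by (auto simp: quotient_module_def A_RCOSETS_def')

lemma quotient_module_zero: "\<zero>\<^bsub>quotient_module M N\<^esub> = N"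
  by (simp add: quotient_module_def)

lemma quotient_module_module:
  assumes N: "submodule N R M"
  shows "module R (quotient_module M N)"
  by (rule module_surj[OF module_axioms quotient_module_linear[OF N]])
    (use coset_eq_self_iff[OF N] submodule_zero[OF N] in
      \<open>simp_all add: quotient_module_zero quotient_module_carrier\<close>)

end

section \<open>Tensor products with a cyclic module\<close>

text \<open>
  The free module of which \<^const>\<open>tensor\<close> is a quotient.
\<close>

definition tensor_free ::
  "('a, 'y) ring_scheme \<Rightarrow> ('a, 'm) module \<Rightarrow> ('a, 'n) module \<Rightarrow> ('a, 'm \<times> 'n \<Rightarrow> 'a) module"
where
  "tensor_free R M N = free_module R (carrier M \<times> carrier N)"

locale two_modules = M: module R M + N: module R N
  for R :: "('a, 'y) ring_scheme" and M :: "('a, 'm) module" and N :: "('a, 'n) module"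
begin

abbreviation "F \<equiv> tensor_free R M N"
abbreviation "g \<equiv> free_gen R :: 'm \<times> 'n \<Rightarrow> _"

lemma F_module: "module R F"
  unfolding tensor_free_def by (rule M.R.free_module_module)

sublocale F: module R F by (rule F_module)

lemma g_closed: "x \<in> carrier M \<Longrightarrow> y \<in> carrier N \<Longrightarrow> g (x, y) \<in> carrier F"
  unfolding tensor_free_def by (rule M.R.free_gen_closed) simp

definition "relators =
     ({g (x \<oplus>\<^bsub>M\<^esub> x', y) \<ominus>\<^bsub>F\<^esub> (g (x, y) \<oplus>\<^bsub>F\<^esub> g (x', y)) | x x' y.
         x \<in> carrier M \<and> x' \<in> carrier M \<and> y \<in> carrier N} \<union>
      {g (x, y \<oplus>\<^bsub>N\<^esub> y') \<ominus>\<^bsub>F\<^esub> (g (x, y) \<oplus>\<^bsub>F\<^esub> g (x, y')) | x y y'.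
         x \<in> carrier M \<and> y \<in> carrier N \<and> y' \<in> carrier N} \<union>
      {g (a \<odot>\<^bsub>M\<^esub> x, y) \<ominus>\<^bsub>F\<^esub> (a \<odot>\<^bsub>F\<^esub> g (x, y)) | a x y.
         a \<in> carrier R \<and> x \<in> carrier M \<and> y \<in> carrier N} \<union>
      {g (x, a \<odot>\<^bsub>N\<^esub> y) \<ominus>\<^bsub>F\<^esub> (a \<odot>\<^bsub>F\<^esub> g (x, y)) | a x y.
         a \<in> carrier R \<and> x \<in> carrier M \<and> y \<in> carrier N})"

lemma tensor_rel_eq: "tensor_rel R M N = module_span R F relators"
  by (simp add: tensor_rel_def relators_def Let_def tensor_free_def)

lemma tensor_eq: "tensor R M N = quotient_module F (tensor_rel R M N)"
  by (simp add: tensor_def tensor_free_def)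

lemma pure_tensor_eq: "pure_tensor R M N x y = tensor_rel R M N +>\<^bsub>F\<^esub> g (x, y)"
  by (simp add: pure_tensor_def tensor_free_def)

lemma relators_subset: "relators \<subseteq> carrier F"
  by (auto simp: relators_def g_closed)

lemma tensor_rel_submodule: "submodule (tensor_rel R M N) R F"
  unfolding tensor_rel_eq by (rule module_span_submodule[OF F_module relators_subset])

lemma tensor_module: "module R (tensor R M N)"
  unfolding tensor_eq by (rule F.quotient_module_module[OF tensor_rel_submodule])

lemma tensor_class_linear: "linear_map R F (tensor R M N) (\<lambda>u. tensor_rel R M N +>\<^bsub>F\<^esub> u)"
  unfolding tensor_eq by (rule F.quotient_module_linear[OF tensor_rel_submodule])

lemma relator_tensor_rel: "u \<in> relators \<Longrightarrow> u \<in> tensor_rel R M N"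
  unfolding tensor_rel_eq by (rule subsetD[OF module_span_incl])

lemma tensor_relators:
  assumes "x \<in> carrier M" "y \<in> carrier N"
  shows "x' \<in> carrier M \<Longrightarrow> g (x \<oplus>\<^bsub>M\<^esub> x', y) \<ominus>\<^bsub>F\<^esub> (g (x, y) \<oplus>\<^bsub>F\<^esub> g (x', y)) \<in> tensor_rel R M N"
    and "y' \<in> carrier N \<Longrightarrow> g (x, y \<oplus>\<^bsub>N\<^esub> y') \<ominus>\<^bsub>F\<^esub> (g (x, y) \<oplus>\<^bsub>F\<^esub> g (x, y')) \<in> tensor_rel R M N"
    and "a \<in> carrier R \<Longrightarrow> g (a \<odot>\<^bsub>M\<^esub> x, y) \<ominus>\<^bsub>F\<^esub> (a \<odot>\<^bsub>F\<^esub> g (x, y)) \<in> tensor_rel R M N"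
    and "a \<in> carrier R \<Longrightarrow> g (x, a \<odot>\<^bsub>N\<^esub> y) \<ominus>\<^bsub>F\<^esub> (a \<odot>\<^bsub>F\<^esub> g (x, y)) \<in> tensor_rel R M N"
  by (rule relator_tensor_rel, use assms in \<open>unfold relators_def, blast\<close>)+

text \<open>
  How maps leave the tensor product: a linear map on the free module that is bilinear modulo \<open>H\<close>
  on pairs sends every relation into \<open>H\<close>.  Working modulo \<open>H\<close> covers both maps to a quotient and
  maps to another tensor product.
\<close>

lemma tensor_rel_linear:
  assumes f: "linear_map R F Q f" and Q: "module R Q" and H: "submodule H R Q"
    and "\<And>x x' y. \<lbrakk>x \<in> carrier M; x' \<in> carrier M; y \<in> carrier N\<rbrakk> \<Longrightarrow>
      f (g (x \<oplus>\<^bsub>M\<^esub> x', y)) \<ominus>\<^bsub>Q\<^esub> (f (g (x, y)) \<oplus>\<^bsub>Q\<^esub> f (g (x', y))) \<in> H"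
    and "\<And>x y y'. \<lbrakk>x \<in> carrier M; y \<in> carrier N; y' \<in> carrier N\<rbrakk> \<Longrightarrow>
      f (g (x, y \<oplus>\<^bsub>N\<^esub> y')) \<ominus>\<^bsub>Q\<^esub> (f (g (x, y)) \<oplus>\<^bsub>Q\<^esub> f (g (x, y'))) \<in> H"
    and "\<And>a x y. \<lbrakk>a \<in> carrier R; x \<in> carrier M; y \<in> carrier N\<rbrakk> \<Longrightarrow>
      f (g (a \<odot>\<^bsub>M\<^esub> x, y)) \<ominus>\<^bsub>Q\<^esub> (a \<odot>\<^bsub>Q\<^esub> f (g (x, y))) \<in> H"
    and "\<And>a x y. \<lbrakk>a \<in> carrier R; x \<in> carrier M; y \<in> carrier N\<rbrakk> \<Longrightarrow>
      f (g (x, a \<odot>\<^bsub>N\<^esub> y)) \<ominus>\<^bsub>Q\<^esub> (a \<odot>\<^bsub>Q\<^esub> f (g (x, y))) \<in> H"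
    and u: "u \<in> tensor_rel R M N"
  shows "f u \<in> H"
proof (rule module_span_linear[OF f F_module Q H relators_subset _ u[unfolded tensor_rel_eq]])
  note l = linear_mapD[OF f] linear_minus[OF f F_module Q]
  fix r assume "r \<in> relators"
  then show "f r \<in> H"
    unfolding relators_def
    by (elim UnE CollectE exE conjE) (simp_all only: l g_closed assms(4-7) M.M.a_closed N.M.a_closed
      M.smult_closed N.smult_closed F.M.a_closed F.smult_closed)
qed

lemma pure_tensor_add_left:
  assumes "x \<in> carrier M" "x' \<in> carrier M" "y \<in> carrier N"
  shows "pure_tensor R M N (x \<oplus>\<^bsub>M\<^esub> x') y = pure_tensor R M N x y \<oplus>\<^bsub>tensor R M N\<^esub> pure_tensor R M N x' y"
proof -
  have "pure_tensor R M N (x \<oplus>\<^bsub>M\<^esub> x') y = tensor_rel R M N +>\<^bsub>F\<^esub> (g (x, y) \<oplus>\<^bsub>F\<^esub> g (x', y))"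
    unfolding pure_tensor_eq using assms
    by (subst F.coset_eq_iff[OF tensor_rel_submodule]) (simp_all add: g_closed tensor_relators)
  then show ?thesis using linear_mapD(2)[OF tensor_class_linear] assms
    by (simp add: pure_tensor_eq g_closed)
qed

lemma pure_tensor_smult_left:
  assumes "a \<in> carrier R" "x \<in> carrier M" "y \<in> carrier N"
  shows "pure_tensor R M N (a \<odot>\<^bsub>M\<^esub> x) y = a \<odot>\<^bsub>tensor R M N\<^esub> pure_tensor R M N x y"
proof -
  have "pure_tensor R M N (a \<odot>\<^bsub>M\<^esub> x) y = tensor_rel R M N +>\<^bsub>F\<^esub> (a \<odot>\<^bsub>F\<^esub> g (x, y))"
    unfolding pure_tensor_eq using assms
    by (subst F.coset_eq_iff[OF tensor_rel_submodule]) (simp_all add: g_closed tensor_relators)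
  then show ?thesis using linear_mapD(3)[OF tensor_class_linear] assms
    by (simp add: pure_tensor_eq g_closed)
qed

lemma pure_tensor_smult_right:
  assumes "a \<in> carrier R" "x \<in> carrier M" "y \<in> carrier N"
  shows "pure_tensor R M N x (a \<odot>\<^bsub>N\<^esub> y) = a \<odot>\<^bsub>tensor R M N\<^esub> pure_tensor R M N x y"
proof -
  have "pure_tensor R M N x (a \<odot>\<^bsub>N\<^esub> y) = tensor_rel R M N +>\<^bsub>F\<^esub> (a \<odot>\<^bsub>F\<^esub> g (x, y))"
    unfolding pure_tensor_eq using assms
    by (subst F.coset_eq_iff[OF tensor_rel_submodule]) (simp_all add: g_closed tensor_relators)
  then show ?thesis using linear_mapD(3)[OF tensor_class_linear] assms
    by (simp add: pure_tensor_eq g_closed)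
qed

lemma pure_tensor_linear:
  "y \<in> carrier N \<Longrightarrow> linear_map R M (tensor R M N) (\<lambda>x. pure_tensor R M N x y)"
  by (rule linear_mapI)
    (simp_all add: pure_tensor_add_left pure_tensor_smult_left,
     simp add: pure_tensor_eq linear_mapD(1)[OF tensor_class_linear] g_closed)

end

definition ideal_smult ::
  "('a, 'y) ring_scheme \<Rightarrow> ('a, 'm, 'z) module_scheme \<Rightarrow> 'a set \<Rightarrow> 'm set"
where
  "ideal_smult R M J = module_span R M {a \<odot>\<^bsub>M\<^esub> x | a x. a \<in> J \<and> x \<in> carrier M}"

lemma ideal_smultI: "a \<in> J \<Longrightarrow> x \<in> carrier M \<Longrightarrow> a \<odot>\<^bsub>M\<^esub> x \<in> ideal_smult R M J"
  unfolding ideal_smult_def by (rule subsetD[OF module_span_incl]) auto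

lemma ideal_smult_submodule:
  assumes "module R M" "J \<subseteq> carrier R" shows "submodule (ideal_smult R M J) R M"
proof -
  interpret module R M by fact
  show ?thesis unfolding ideal_smult_def
    by (rule module_span_submodule) (use assms in auto)
qed

lemma ideal_smult_linear:
  assumes f: "linear_map R M N f" and "module R M" "module R N" "J \<subseteq> carrier R"
    and x: "x \<in> ideal_smult R M J"
  shows "f x \<in> ideal_smult R N J"
proof -
  interpret M: module R M by fact
  interpret N: module R N by fact
  show ?thesis
  proof (rule module_span_linear[OF f assms(2,3) ideal_smult_submodule[OF assms(3,4)]
        _ _ x[unfolded ideal_smult_def]])
    show "{a \<odot>\<^bsub>M\<^esub> x |a x. a \<in> J \<and> x \<in> carrier M} \<subseteq> carrier M" using assms(4) by auto
    show "f y \<in> ideal_smult R N J" if y: "y \<in> {a \<odot>\<^bsub>M\<^esub> x |a x. a \<in> J \<and> x \<in> carrier M}" for y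
    proof -
      obtain a x where "y = a \<odot>\<^bsub>M\<^esub> x" "a \<in> J" "x \<in> carrier M" using y by auto
      then show ?thesis using linear_mapD[OF f] ideal_smultI[of a J "f x" N R] assms(4) by auto
    qed
  qed
qed

text \<open>
  If \<open>N\<close> is generated by \<open>e\<close>, then \<open>x \<mapsto> x \<otimes> e\<close> identifies \<open>M \<otimes> N\<close> with \<open>M/JM\<close>, where \<open>J\<close> is the
  annihilator of \<open>e\<close>.  This replaces all tensor products by quotients of \<open>M\<close> itself.
\<close>

locale cyclic_tensor = two_modules R M N
  for R :: "('a, 'y) ring_scheme" and M :: "('a, 'm) module" and N :: "('a, 'n) module" +
  fixes e :: 'n
  assumes e_closed: "e \<in> carrier N" and cyclic: "\<And>y. y \<in> carrier N \<Longrightarrow> \<exists>a \<in> carrier R. y = a \<odot>\<^bsub>N\<^esub> e"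
begin

definition "\<theta> x = pure_tensor R M N x e"

definition "ann = {a \<in> carrier R. a \<odot>\<^bsub>N\<^esub> e = \<zero>\<^bsub>N\<^esub>}"

lemma theta_linear: "linear_map R M (tensor R M N) \<theta>"
  unfolding \<theta>_def using pure_tensor_linear[OF e_closed] by simp

text \<open>
  Every pure tensor is \<open>x \<otimes> ae = ax \<otimes> e\<close>.
\<close>

lemma theta_surj: "\<theta> ` carrier M = carrier (tensor R M N)"
proof
  show "\<theta> ` carrier M \<subseteq> carrier (tensor R M N)" using linear_mapD(1)[OF theta_linear] by auto
  have im: "submodule (\<theta> ` carrier M) R (tensor R M N)"
    by (rule submodule_image[OF theta_linear M.module_axioms tensor_module M.carrier_is_submodule])
  have gen: "g z \<in> {u \<in> carrier F. tensor_rel R M N +>\<^bsub>F\<^esub> u \<in> \<theta> ` carrier M}"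
    if zin: "z \<in> carrier M \<times> carrier N" for z
  proof -
    obtain x y where z: "z = (x, y)" "x \<in> carrier M" "y \<in> carrier N" using zin by auto
    obtain a where a: "a \<in> carrier R" "y = a \<odot>\<^bsub>N\<^esub> e" using cyclic z(3) by blast
    have "pure_tensor R M N x y = \<theta> (a \<odot>\<^bsub>M\<^esub> x)"
      using a z e_closed by (simp add: \<theta>_def pure_tensor_smult_left pure_tensor_smult_right)
    then show ?thesis using a z g_closed by (auto simp: pure_tensor_eq)
  qed
  have "u \<in> {u \<in> carrier F. tensor_rel R M N +>\<^bsub>F\<^esub> u \<in> \<theta> ` carrier M}" if "u \<in> carrier F" for u
    using M.R.free_module_induct[OF submodule_vimage[OF tensor_class_linear F_module tensor_module im,
          unfolded tensor_free_def] gen[unfolded tensor_free_def] that[unfolded tensor_free_def]]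
    by (simp add: tensor_free_def)
  then show "carrier (tensor R M N) \<subseteq> \<theta> ` carrier M"
    unfolding tensor_eq F.quotient_module_carrier by blast
qed

lemma ann_subset: "ann \<subseteq> carrier R" by (auto simp: ann_def)

text \<open>
  An inverse would send \<open>x \<otimes> y\<close> to \<open>r y \<cdot> x\<close> for some \<open>r y\<close> with \<open>y = r y \<cdot> e\<close>.  The choice of \<open>r\<close> is
  neither additive nor linear, but it is so modulo the annihilator, and this is enough to kill the
  relations modulo \<open>JM\<close>.
\<close>

lemma theta_zero_iff:
  assumes x: "x \<in> carrier M"
  shows "\<theta> x = \<zero>\<^bsub>tensor R M N\<^esub> \<longleftrightarrow> x \<in> ideal_smult R M ann"
proof
  interpret T: module R "tensor R M N" by (rule tensor_module)
  define r where "r y = (SOME a. a \<in> carrier R \<and> y = a \<odot>\<^bsub>N\<^esub> e)" for y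
  have r: "r y \<in> carrier R" "r y \<odot>\<^bsub>N\<^esub> e = y" if "y \<in> carrier N" for y
    using someI_ex[of "\<lambda>a. a \<in> carrier R \<and> y = a \<odot>\<^bsub>N\<^esub> e"] cyclic[OF that] unfolding r_def by force+
  define \<phi> where "\<phi> = (\<lambda>(x, y). r y \<odot>\<^bsub>M\<^esub> x)"
  have \<phi>: "\<phi> \<in> carrier M \<times> carrier N \<rightarrow> carrier M" using r by (auto simp: \<phi>_def)
  let ?\<Phi> = "lin_comb R M \<phi>"
  have lin: "linear_map R F M ?\<Phi>" unfolding tensor_free_def by (rule M.lin_comb_linear[OF \<phi>])
  have gen: "?\<Phi> (g (x, y)) = r y \<odot>\<^bsub>M\<^esub> x" if "x \<in> carrier M" "y \<in> carrier N" for x y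
    using M.lin_comb_free_gen[OF _ \<phi>, of "(x, y)"] that by (simp add: \<phi>_def)
  have J: "submodule (ideal_smult R M ann) R M"
    by (rule ideal_smult_submodule[OF M.module_axioms ann_subset])
  have z: "z = \<zero>\<^bsub>M\<^esub> \<Longrightarrow> z \<in> ideal_smult R M ann" for z using submodule_zero[OF J] by simp
  have rel: "?\<Phi> u \<in> ideal_smult R M ann" if u: "u \<in> tensor_rel R M N" for u
  proof (rule tensor_rel_linear[OF lin M.module_axioms J _ _ _ _ u], goal_cases)
    case (1 x x' y)
    then show ?case using r by (intro z) (simp add: gen M.smult_r_distr M.M.r_neg a_minus_def)
  next
    case (2 x y y')
    let ?c = "r (y \<oplus>\<^bsub>N\<^esub> y') \<ominus>\<^bsub>R\<^esub> (r y \<oplus>\<^bsub>R\<^esub> r y')"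
    have "?c \<in> ann"
      using 2 r e_closed by (simp add: ann_def a_minus_def N.smult_l_distr N.smult_l_minus N.M.r_neg)
    moreover have "?c \<odot>\<^bsub>M\<^esub> x = r (y \<oplus>\<^bsub>N\<^esub> y') \<odot>\<^bsub>M\<^esub> x \<ominus>\<^bsub>M\<^esub> (r y \<odot>\<^bsub>M\<^esub> x \<oplus>\<^bsub>M\<^esub> r y' \<odot>\<^bsub>M\<^esub> x)"
      using 2 r by (simp add: a_minus_def M.smult_l_distr M.smult_l_minus)
    ultimately show ?case using ideal_smultI[of ?c ann x M R] 2 by (simp add: gen)
  next
    case (3 a x y)
    then show ?case using r
      by (intro z) (simp add: gen M.smult_assoc1[symmetric] M.M.r_neg a_minus_def M.R.m_comm)
  next
    case (4 a x y)
    let ?c = "r (a \<odot>\<^bsub>N\<^esub> y) \<ominus>\<^bsub>R\<^esub> (a \<otimes>\<^bsub>R\<^esub> r y)"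
    have "?c \<in> ann"
      using 4 r e_closed
      by (simp add: ann_def a_minus_def N.smult_l_distr N.smult_l_minus N.M.r_neg N.smult_assoc1)
    moreover have "?c \<odot>\<^bsub>M\<^esub> x = r (a \<odot>\<^bsub>N\<^esub> y) \<odot>\<^bsub>M\<^esub> x \<ominus>\<^bsub>M\<^esub> (a \<odot>\<^bsub>M\<^esub> (r y \<odot>\<^bsub>M\<^esub> x))"
      using 4 r by (simp add: a_minus_def M.smult_l_distr M.smult_l_minus M.smult_assoc1)
    ultimately show ?case using ideal_smultI[of ?c ann x M R] 4 by (simp add: gen)
  qed
  show "x \<in> ideal_smult R M ann" if "\<theta> x = \<zero>\<^bsub>tensor R M N\<^esub>"
  proof -
    have "g (x, e) \<in> tensor_rel R M N"
      using that F.coset_eq_self_iff[OF tensor_rel_submodule g_closed[OF x e_closed]]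
      by (simp add: \<theta>_def pure_tensor_eq tensor_eq F.quotient_module_zero)
    then have 1: "r e \<odot>\<^bsub>M\<^esub> x \<in> ideal_smult R M ann" using rel gen[OF x e_closed] by metis
    let ?c = "\<one>\<^bsub>R\<^esub> \<ominus>\<^bsub>R\<^esub> r e"
    have "?c \<in> ann" using r e_closed
      by (simp add: ann_def a_minus_def N.smult_l_distr N.smult_l_minus N.M.r_neg)
    then have "?c \<odot>\<^bsub>M\<^esub> x \<in> ideal_smult R M ann" using x by (rule ideal_smultI)
    from submodule_add[OF J this 1] show ?thesis
      using x r[OF e_closed] by (simp add: a_minus_def M.smult_l_distr M.smult_l_minus M.M.a_assoc M.M.l_neg)
  qed
  show "\<theta> x = \<zero>\<^bsub>tensor R M N\<^esub>" if "x \<in> ideal_smult R M ann"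
  proof -
    have "\<theta> (a \<odot>\<^bsub>M\<^esub> x) = \<zero>\<^bsub>tensor R M N\<^esub>" if "a \<in> ann" "x \<in> carrier M" for a x
    proof -
      have [simp]: "a \<in> carrier R" "a \<odot>\<^bsub>N\<^esub> e = \<zero>\<^bsub>N\<^esub>" using that by (auto simp: ann_def)
      have c: "pure_tensor R M N x \<zero>\<^bsub>N\<^esub> \<in> carrier (tensor R M N)"
        using linear_mapD(1)[OF pure_tensor_linear] that(2) by blast
      have "\<theta> (a \<odot>\<^bsub>M\<^esub> x) = pure_tensor R M N x (a \<odot>\<^bsub>N\<^esub> e)"
        using that e_closed by (simp add: \<theta>_def pure_tensor_smult_left pure_tensor_smult_right
            del: \<open>a \<odot>\<^bsub>N\<^esub> e = \<zero>\<^bsub>N\<^esub>\<close>)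
      also have "\<dots> = pure_tensor R M N x (\<zero>\<^bsub>R\<^esub> \<odot>\<^bsub>N\<^esub> \<zero>\<^bsub>N\<^esub>)" by simp
      also have "\<dots> = \<zero>\<^bsub>R\<^esub> \<odot>\<^bsub>tensor R M N\<^esub> pure_tensor R M N x \<zero>\<^bsub>N\<^esub>"
        by (rule pure_tensor_smult_right) (use that in auto)
      also have "\<dots> = \<zero>\<^bsub>tensor R M N\<^esub>" using c by simp
      finally show ?thesis .
    qed
    then have "\<theta> x \<in> {\<zero>\<^bsub>tensor R M N\<^esub>}"
      by (intro module_span_linear[OF theta_linear M.module_axioms tensor_module
            submodule_zero_set[OF tensor_module] _ _ that[unfolded ideal_smult_def]])
        (use ann_subset in auto)
    then show ?thesis by simp
  qed
qed

end

text \<open>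
  \<^const>\<open>tensor_map\<close> is a union over all representatives of a class, so all of them have to give
  the same class; their differences are relations, which go to relations.
\<close>

lemma tensor_map_pure_tensor:
  fixes M :: "('a, 'm) module" and M' :: "('a, 'm1) module" and N :: "('a, 'n) module"
    and R :: "('a, 'y) ring_scheme"
  assumes M: "module R M" and M': "module R M'" and N: "module R N"
    and f: "linear_map R M M' f" and x: "x \<in> carrier M" and y: "y \<in> carrier N"
  shows "tensor_map R M M' N f (pure_tensor R M N x y) = pure_tensor R M' N (f x) y"
proof -
  interpret M: two_modules R M N by (intro two_modules.intro M N)
  interpret M': two_modules R M' N by (intro two_modules.intro M' N)
  note l = linear_mapD[OF f]
  define \<phi> :: "'m \<times> 'n \<Rightarrow> 'm1 \<times> 'n \<Rightarrow> 'a" where "\<phi> = (\<lambda>(x, y). free_gen R (f x, y))"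
  have \<phi>: "\<phi> \<in> carrier M \<times> carrier N \<rightarrow> carrier M'.F" using l M'.g_closed by (auto simp: \<phi>_def)
  let ?\<Phi> = "lin_comb R M'.F \<phi>"
  have lin: "linear_map R M.F M'.F ?\<Phi>"
    unfolding tensor_free_def[of R M N] by (rule M'.F.lin_comb_linear[OF \<phi>])
  have gen: "?\<Phi> (M.g (x, y)) = M'.g (f x, y)" if "x \<in> carrier M" "y \<in> carrier N" for x y
    using M'.F.lin_comb_free_gen[OF _ \<phi>, of "(x, y)"] that by (simp add: \<phi>_def)
  have rel: "?\<Phi> u \<in> tensor_rel R M' N" if u: "u \<in> tensor_rel R M N" for u
    by (rule M.tensor_rel_linear[OF lin M'.F_module M'.tensor_rel_submodule _ _ _ _ u])
      (simp_all add: gen l M'.tensor_relators)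
  have eq: "tensor_map R M M' N f X = (\<Union>u \<in> X. tensor_rel R M' N +>\<^bsub>M'.F\<^esub> ?\<Phi> u)" for X
    by (simp add: tensor_map_def lin_comb_def tensor_free_def Let_def \<phi>_def case_prod_unfold)
  have gc: "M.g (x, y) \<in> carrier M.F" by (rule M.g_closed[OF x y])
  interpret A: abelian_subgroup "tensor_rel R M N" M.F
    by (rule M.F.submodule_abelian_subgroup[OF M.tensor_rel_submodule])
  have "tensor_rel R M' N +>\<^bsub>M'.F\<^esub> ?\<Phi> u = pure_tensor R M' N (f x) y"
    if u: "u \<in> pure_tensor R M N x y" for u
  proof -
    have u': "u \<in> tensor_rel R M N +>\<^bsub>M.F\<^esub> M.g (x, y)" using u by (simp add: M.pure_tensor_eq)
    then have uc: "u \<in> carrier M.F" using A.a_elemrcos_carrier gc by blast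
    have "u \<ominus>\<^bsub>M.F\<^esub> M.g (x, y) \<in> tensor_rel R M N"
      using A.a_repr_independence'[OF u' gc] M.F.coset_eq_iff[OF M.tensor_rel_submodule uc gc] by simp
    from rel[OF this] have "?\<Phi> u \<ominus>\<^bsub>M'.F\<^esub> ?\<Phi> (M.g (x, y)) \<in> tensor_rel R M' N"
      using linear_minus[OF lin M.F_module M'.F_module uc gc] by simp
    then show ?thesis
      using M'.F.coset_eq_iff[OF M'.tensor_rel_submodule, of "?\<Phi> u" "?\<Phi> (M.g (x, y))"]
        linear_mapD(1)[OF lin] uc gc gen[OF x y] M'.g_closed[OF l(1)[OF x] y]
      by (simp add: M'.pure_tensor_eq)
  qed
  moreover have "M.g (x, y) \<in> pure_tensor R M N x y"
    using A.a_rcos_self[OF gc] by (simp add: M.pure_tensor_eq)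
  ultimately show ?thesis unfolding eq by blast
qed

section \<open>Lifting along exact sequences of free modules\<close>

definition module_basis ::
  "('a, 'y) ring_scheme \<Rightarrow> ('a, 'm, 'z) module_scheme \<Rightarrow> 'x set \<Rightarrow> ('x \<Rightarrow> 'm) \<Rightarrow> bool"
where
  "module_basis R M X g \<longleftrightarrow> g \<in> X \<rightarrow> carrier M \<and>
    (\<forall>x \<in> carrier M. \<exists>!c. c \<in> carrier (free_module R X) \<and> x = lin_comb R M g c)"

text \<open>
  Free modules are projective.  The map is built from the coordinates \<open>\<kappa>\<close>, which are linear by
  uniqueness, followed by the extension of chosen preimages of the images of the basis.
\<close>

lemma free_lift:
  assumes "module R P" "module R N" "module R N'" and basis: "module_basis R P X g"
    and \<phi>: "linear_map R P N \<phi>" and \<psi>: "linear_map R N' N \<psi>"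
    and img: "\<And>x. x \<in> carrier P \<Longrightarrow> \<phi> x \<in> \<psi> ` carrier N'"
  shows "\<exists>\<phi>'. linear_map R P N' \<phi>' \<and> (\<forall>x \<in> carrier P. \<psi> (\<phi>' x) = \<phi> x)"
proof -
  interpret P: module R P by fact
  interpret N: module R N by fact
  interpret N': module R N' by fact
  interpret F: module R "free_module R X" by (rule P.R.free_module_module)
  have g: "g \<in> X \<rightarrow> carrier P"
    using basis by (simp add: module_basis_def)
  have ex1: "\<exists>!c. c \<in> carrier (free_module R X) \<and> x = lin_comb R P g c" if "x \<in> carrier P" for x
    using basis that by (simp add: module_basis_def)
  define \<kappa> where "\<kappa> x = (THE c. c \<in> carrier (free_module R X) \<and> x = lin_comb R P g c)" for x
  have \<kappa>: "\<kappa> x \<in> carrier (free_module R X)" "lin_comb R P g (\<kappa> x) = x" if "x \<in> carrier P" for x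
    using theI'[OF ex1[OF that]] unfolding \<kappa>_def by auto
  have \<kappa>_eq: "\<kappa> (lin_comb R P g c) = c" if "c \<in> carrier (free_module R X)" for c
    unfolding \<kappa>_def by (rule the1_equality[OF ex1[OF P.lin_comb_closed[OF that g]]]) (simp add: that)
  note gl = P.lin_comb_linear[OF g]
  have \<kappa>l: "linear_map R P (free_module R X) \<kappa>"
  proof (rule linear_mapI)
    show "\<kappa> (x \<oplus>\<^bsub>P\<^esub> y) = \<kappa> x \<oplus>\<^bsub>free_module R X\<^esub> \<kappa> y" if "x \<in> carrier P" "y \<in> carrier P" for x y
      using \<kappa>_eq[of "\<kappa> x \<oplus>\<^bsub>free_module R X\<^esub> \<kappa> y"] linear_mapD(2)[OF gl] \<kappa> that by simp
    show "\<kappa> (a \<odot>\<^bsub>P\<^esub> x) = a \<odot>\<^bsub>free_module R X\<^esub> \<kappa> x" if "a \<in> carrier R" "x \<in> carrier P" for a x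
      using \<kappa>_eq[of "a \<odot>\<^bsub>free_module R X\<^esub> \<kappa> x"] linear_mapD(3)[OF gl] \<kappa> that by simp
  qed (rule \<kappa>)
  define v where "v z = (SOME y. y \<in> carrier N' \<and> \<psi> y = \<phi> (g z))" for z
  have v: "v z \<in> carrier N' \<and> \<psi> (v z) = \<phi> (g z)" if "z \<in> X" for z
  proof -
    have "g z \<in> carrier P" using g that by auto
    from img[OF this] obtain y where "y \<in> carrier N' \<and> \<psi> y = \<phi> (g z)" by auto
    then show ?thesis unfolding v_def by (rule someI)
  qed
  then have vX: "v \<in> X \<rightarrow> carrier N'" by auto
  note vl = N'.lin_comb_linear[OF vX]
  have lin: "linear_map R P N' (\<lambda>x. lin_comb R N' v (\<kappa> x))" by (rule linear_comp[OF \<kappa>l vl])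
  have "\<psi> (lin_comb R N' v c) = \<phi> (lin_comb R P g c)" if c: "c \<in> carrier (free_module R X)" for c
    by (rule N.free_module_linear_eq[OF linear_comp[OF vl \<psi>] linear_comp[OF gl \<phi>] _ c])
      (use v in \<open>simp add: P.lin_comb_free_gen[OF _ g] N'.lin_comb_free_gen[OF _ vX]\<close>)
  then have "\<psi> (lin_comb R N' v (\<kappa> x)) = \<phi> x" if "x \<in> carrier P" for x
    using \<kappa>[OF that] by metis
  with lin show ?thesis by blast
qed

locale free_complex =
  fixes R :: "('a, 'y) ring_scheme" and P :: "nat \<Rightarrow> ('a, 'p) module" and d :: "nat \<Rightarrow> 'p \<Rightarrow> 'p"
    and M :: "('a, 'm) module" and aug :: "'p \<Rightarrow> 'm" and X :: "nat \<Rightarrow> 'x set" and g :: "nat \<Rightarrow> 'x \<Rightarrow> 'p"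
  assumes P_module: "module R (P n)" and M_module: "module R M"
    and P_basis: "module_basis R (P n) (X n) (g n)"
    and d_linear: "linear_map R (P (Suc n)) (P n) (d n)"
    and aug_linear: "linear_map R (P 0) M aug"
    and exact_0: "d 0 ` carrier (P 1) = {x \<in> carrier (P 0). aug x = \<zero>\<^bsub>M\<^esub>}"
    and exact_Suc: "d (Suc n) ` carrier (P (Suc (Suc n))) = {x \<in> carrier (P (Suc n)). d n x = \<zero>\<^bsub>P n\<^esub>}"
begin

definition cycles :: "nat \<Rightarrow> 'p set" where
  "cycles n = d n ` carrier (P (Suc n))"

lemma cycles_0: "cycles 0 = {x \<in> carrier (P 0). aug x = \<zero>\<^bsub>M\<^esub>}"
  using exact_0 by (simp add: cycles_def)

lemma cycles_Suc: "cycles (Suc n) = {x \<in> carrier (P (Suc n)). d n x = \<zero>\<^bsub>P n\<^esub>}"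
  using exact_Suc by (simp add: cycles_def)

lemma cycles_submodule: "submodule (cycles n) R (P n)"
  unfolding cycles_def
  by (rule submodule_image[OF d_linear P_module P_module module.carrier_is_submodule[OF P_module]])

context
  fixes G :: "nat \<Rightarrow> 'p set"
  assumes G_sub: "submodule (G n) R (P n)"
    and G_aug: "aug ` carrier (P 0) \<subseteq> aug ` G 0"
    and G_d: "G n \<inter> cycles n \<subseteq> d n ` G (Suc n)"
begin

text \<open>
  A compression moves the complex into the submodules \<open>G\<close> up to homotopy.  The full homotopy
  identity is \<open>y = \<gamma>y + dhy + h'dy\<close> with \<open>h'\<close> one step lower; only its restriction to cycles is
  recorded, where the last term vanishes, because this is all that the next step uses.
\<close>

definition compression :: "nat \<Rightarrow> ('p \<Rightarrow> 'p) \<Rightarrow> ('p \<Rightarrow> 'p) \<Rightarrow> bool" where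
  "compression n \<gamma> h \<longleftrightarrow> linear_map R (P n) (P n) \<gamma> \<and> \<gamma> ` carrier (P n) \<subseteq> G n \<and>
    linear_map R (P n) (P (Suc n)) h \<and> (\<forall>y \<in> cycles n. y = \<gamma> y \<oplus>\<^bsub>P n\<^esub> d n (h y))"

lemma lift_into_G:
  assumes "linear_map R (P n) N \<phi>" "module R N" "linear_map R (P n) N \<psi>"
    "\<And>x. x \<in> carrier (P n) \<Longrightarrow> \<phi> x \<in> \<psi> ` G n"
  shows "\<exists>\<gamma>. linear_map R (P n) (P n) \<gamma> \<and> \<gamma> ` carrier (P n) \<subseteq> G n \<and> (\<forall>x \<in> carrier (P n). \<psi> (\<gamma> x) = \<phi> x)"
proof -
  have G: "G n \<subseteq> carrier (P n)" by (rule submodule_subset[OF G_sub])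
  have Gm: "module R (P n\<lparr>carrier := G n\<rparr>)" by (rule submodule.submodule_is_module[OF G_sub P_module])
  have "\<exists>\<phi>'. linear_map R (P n) (P n\<lparr>carrier := G n\<rparr>) \<phi>' \<and> (\<forall>x \<in> carrier (P n). \<psi> (\<phi>' x) = \<phi> x)"
    by (rule free_lift[OF P_module assms(2) Gm P_basis assms(1) linear_submodule_domain[OF assms(3) G]])
      (use assms(4) in simp)
  then obtain \<phi>' where \<phi>': "linear_map R (P n) (P n\<lparr>carrier := G n\<rparr>) \<phi>'"
    "\<forall>x \<in> carrier (P n). \<psi> (\<phi>' x) = \<phi> x" by blast
  have "linear_map R (P n) (P n) \<phi>' \<and> \<phi>' ` carrier (P n) \<subseteq> G n"
    using \<phi>'(1) G by (auto simp: linear_map_def)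
  with \<phi>'(2) show ?thesis by blast
qed

lemma lift_through_d:
  assumes "linear_map R (P n) (P n) \<phi>" "\<And>x. x \<in> carrier (P n) \<Longrightarrow> \<phi> x \<in> cycles n"
  shows "\<exists>h. linear_map R (P n) (P (Suc n)) h \<and> (\<forall>x \<in> carrier (P n). d n (h x) = \<phi> x)"
  by (rule free_lift[OF P_module P_module P_module P_basis assms(1) d_linear])
    (use assms(2) in \<open>simp add: cycles_def\<close>)

lemma compression_0: "\<exists>\<gamma> h. compression 0 \<gamma> h"
proof -
  interpret P: module R "P 0" by (rule P_module)
  interpret M: module R M by (rule M_module)
  have aug_in_G: "aug x \<in> aug ` G 0" if "x \<in> carrier (P 0)" for x
    using G_aug that by (rule subsetD[OF _ imageI])
  obtain \<gamma> where \<gamma>: "linear_map R (P 0) (P 0) \<gamma>" "\<gamma> ` carrier (P 0) \<subseteq> G 0"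
      "\<forall>x \<in> carrier (P 0). aug (\<gamma> x) = aug x"
    using lift_into_G[OF aug_linear M_module aug_linear aug_in_G] by blast
  have c: "x \<in> carrier (P 0) \<Longrightarrow> \<gamma> x \<in> carrier (P 0)" for x by (rule linear_mapD(1)[OF \<gamma>(1)])
  have "x \<ominus>\<^bsub>P 0\<^esub> \<gamma> x \<in> cycles 0" if x: "x \<in> carrier (P 0)" for x
    using linear_minus[OF aug_linear P_module M_module x c[OF x]] \<gamma>(3) x c[OF x] linear_mapD(1)[OF aug_linear x]
    by (simp add: cycles_0 M.M.minus_eq_zero_iff)
  from lift_through_d[OF linear_diff[OF linear_id \<gamma>(1) P_module] this]
  obtain h where h: "linear_map R (P 0) (P (Suc 0)) h" "\<forall>x \<in> carrier (P 0). d 0 (h x) = x \<ominus>\<^bsub>P 0\<^esub> \<gamma> x"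
    by blast
  have "y = \<gamma> y \<oplus>\<^bsub>P 0\<^esub> d 0 (h y)" if y: "y \<in> cycles 0" for y
  proof -
    have "y \<in> carrier (P 0)" using y by (simp add: cycles_0)
    then show ?thesis using h(2) c by (simp add: a_minus_def P.M.a_lcomm P.M.r_neg)
  qed
  with \<gamma> h show ?thesis unfolding compression_def by blast
qed

text \<open>
  As \<open>dx\<close> is a cycle, \<open>\<gamma>dx = dx - dhdx\<close>.  This is again a cycle, so it lies in \<open>G \<inter> ker d\<close> and can be
  lifted through \<open>d\<close> to \<open>G\<close>, which defines \<open>\<gamma>'\<close>.  Then \<open>x - \<gamma>'x - hdx\<close> is a cycle for every \<open>x\<close>, and lifting it
  through \<open>d\<close> defines \<open>h'\<close>.
\<close>

lemma compression_step:
  assumes "compression n \<gamma> h"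
  shows "\<exists>\<gamma>' h'. linear_map R (P (Suc n)) (P (Suc n)) \<gamma>' \<and> \<gamma>' ` carrier (P (Suc n)) \<subseteq> G (Suc n) \<and>
    linear_map R (P (Suc n)) (P (Suc (Suc n))) h' \<and>
    (\<forall>x \<in> carrier (P (Suc n)). x = \<gamma>' x \<oplus>\<^bsub>P (Suc n)\<^esub> d (Suc n) (h' x) \<oplus>\<^bsub>P (Suc n)\<^esub> h (d n x))"
proof -
  interpret P: module R "P n" by (rule P_module)
  interpret Q: module R "P (Suc n)" by (rule P_module)
  have \<gamma>: "linear_map R (P n) (P n) \<gamma>" "\<gamma> ` carrier (P n) \<subseteq> G n"
    and h: "linear_map R (P n) (P (Suc n)) h" and eq: "\<And>y. y \<in> cycles n \<Longrightarrow> y = \<gamma> y \<oplus>\<^bsub>P n\<^esub> d n (h y)"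
    using assms unfolding compression_def by blast+
  have dx: "d n x \<in> cycles n" "d n x \<in> carrier (P n)" if "x \<in> carrier (P (Suc n))" for x
    using that linear_mapD(1)[OF d_linear] by (auto simp: cycles_def)
  have hdx: "h (d n x) \<in> carrier (P (Suc n))" if "x \<in> carrier (P (Suc n))" for x
    using that linear_mapD(1)[OF h] dx by simp
  have \<gamma>_eq: "\<gamma> (d n x) = d n x \<ominus>\<^bsub>P n\<^esub> d n (h (d n x))" if x: "x \<in> carrier (P (Suc n))" for x
  proof -
    have "\<gamma> (d n x) \<in> carrier (P n)" "d n (h (d n x)) \<in> carrier (P n)"
      using linear_mapD(1)[OF \<gamma>(1) dx(2)[OF x]] linear_mapD(1)[OF d_linear hdx[OF x]] by auto
    then show ?thesis using eq[OF dx(1)[OF x]] by (metis P.M.add.inv_solve_right a_minus_def dx(2) x)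
  qed
  have "\<gamma> (d n x) \<in> d n ` G (Suc n)" if x: "x \<in> carrier (P (Suc n))" for x
  proof -
    have "\<gamma> (d n x) \<in> cycles n" unfolding \<gamma>_eq[OF x]
      by (rule submodule_minus[OF cycles_submodule P_module])
        (use dx[OF x] dx(1)[OF hdx[OF x]] in auto)
    then show ?thesis using G_d \<gamma>(2) dx(2)[OF x] by blast
  qed
  from lift_into_G[OF linear_comp[OF d_linear \<gamma>(1)] P_module d_linear this]
  obtain \<gamma>' where \<gamma>': "linear_map R (P (Suc n)) (P (Suc n)) \<gamma>'" "\<gamma>' ` carrier (P (Suc n)) \<subseteq> G (Suc n)"
      "\<forall>x \<in> carrier (P (Suc n)). d n (\<gamma>' x) = \<gamma> (d n x)" by blast
  have c: "x \<in> carrier (P (Suc n)) \<Longrightarrow> \<gamma>' x \<in> carrier (P (Suc n))" for x by (rule linear_mapD(1)[OF \<gamma>'(1)])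
  have "x \<ominus>\<^bsub>P (Suc n)\<^esub> \<gamma>' x \<ominus>\<^bsub>P (Suc n)\<^esub> h (d n x) \<in> cycles (Suc n)" if x: "x \<in> carrier (P (Suc n))" for x
  proof -
    have dhd: "d n (h (d n x)) \<in> carrier (P n)" using dx(2)[OF hdx[OF x]] .
    have "d n (x \<ominus>\<^bsub>P (Suc n)\<^esub> \<gamma>' x \<ominus>\<^bsub>P (Suc n)\<^esub> h (d n x))
        = d n x \<ominus>\<^bsub>P n\<^esub> \<gamma> (d n x) \<ominus>\<^bsub>P n\<^esub> d n (h (d n x))"
      using x c[OF x] hdx[OF x] \<gamma>'(3) by (simp add: linear_minus[OF d_linear P_module P_module])
    also have "\<dots> = \<zero>\<^bsub>P n\<^esub>"
      unfolding \<gamma>_eq[OF x] using dx(2)[OF x] dhd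
      by (simp add: a_minus_def P.M.minus_add P.M.a_assoc[symmetric] P.M.r_neg)
    finally show ?thesis using x c[OF x] hdx[OF x] by (simp add: cycles_Suc)
  qed
  from lift_through_d[OF linear_diff[OF linear_diff[OF linear_id \<gamma>'(1) P_module] linear_comp[OF d_linear h] P_module] this]
  obtain h' where h': "linear_map R (P (Suc n)) (P (Suc (Suc n))) h'"
      "\<forall>x \<in> carrier (P (Suc n)). d (Suc n) (h' x) = x \<ominus>\<^bsub>P (Suc n)\<^esub> \<gamma>' x \<ominus>\<^bsub>P (Suc n)\<^esub> h (d n x)"
    by blast
  have "x = \<gamma>' x \<oplus>\<^bsub>P (Suc n)\<^esub> d (Suc n) (h' x) \<oplus>\<^bsub>P (Suc n)\<^esub> h (d n x)" if x: "x \<in> carrier (P (Suc n))" for x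
  proof -
    have "\<gamma>' x \<oplus>\<^bsub>P (Suc n)\<^esub> (x \<ominus>\<^bsub>P (Suc n)\<^esub> \<gamma>' x \<ominus>\<^bsub>P (Suc n)\<^esub> h (d n x)) \<oplus>\<^bsub>P (Suc n)\<^esub> h (d n x)
      = x \<oplus>\<^bsub>P (Suc n)\<^esub> (\<gamma>' x \<ominus>\<^bsub>P (Suc n)\<^esub> \<gamma>' x) \<oplus>\<^bsub>P (Suc n)\<^esub> (h (d n x) \<ominus>\<^bsub>P (Suc n)\<^esub> h (d n x))"
      using x c[OF x] hdx[OF x] by (simp add: a_minus_def Q.M.a_ac)
    also have "\<dots> = x" using x c[OF x] hdx[OF x] by (simp add: a_minus_def Q.M.r_neg)
    finally show ?thesis using h'(2) x by simp
  qed
  then show ?thesis using \<gamma>' h' by blast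
qed

lemma compression_exists: "\<exists>\<gamma> h. compression n \<gamma> h"
proof (induction n)
  case (Suc n)
  then obtain \<gamma> h where c: "compression n \<gamma> h" by blast
  interpret Q: module R "P (Suc n)" by (rule P_module)
  obtain \<gamma>' h' where s: "linear_map R (P (Suc n)) (P (Suc n)) \<gamma>'" "\<gamma>' ` carrier (P (Suc n)) \<subseteq> G (Suc n)"
    "linear_map R (P (Suc n)) (P (Suc (Suc n))) h'"
    "\<forall>x \<in> carrier (P (Suc n)). x = \<gamma>' x \<oplus>\<^bsub>P (Suc n)\<^esub> d (Suc n) (h' x) \<oplus>\<^bsub>P (Suc n)\<^esub> h (d n x)"
    using compression_step[OF c] by blast
  have h0: "h \<zero>\<^bsub>P n\<^esub> = \<zero>\<^bsub>P (Suc n)\<^esub>"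
    using c by (intro linear_zero[OF _ P_module P_module]) (simp add: compression_def)
  have "y = \<gamma>' y \<oplus>\<^bsub>P (Suc n)\<^esub> d (Suc n) (h' y)" if y: "y \<in> cycles (Suc n)" for y
  proof -
    have y': "y \<in> carrier (P (Suc n))" "d n y = \<zero>\<^bsub>P n\<^esub>" using y by (auto simp: cycles_Suc)
    have "\<gamma>' y \<in> carrier (P (Suc n))" "d (Suc n) (h' y) \<in> carrier (P (Suc n))"
      using linear_mapD(1)[OF s(1)] linear_mapD(1)[OF d_linear] linear_mapD(1)[OF s(3)] y' by auto
    then show ?thesis using s(4) y' h0 by (metis Q.M.a_closed Q.M.r_zero)
  qed
  then show ?case using s unfolding compression_def by blast
qed (rule compression_0)

text \<open>
  The form in which the homotopy is used: if \<open>dx\<close> lies in \<open>JP\<^sub>n\<close> for an ideal \<open>J\<close>, then \<open>h(dx)\<close> lies in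
  \<open>JP\<^sub>n\<^sub>+\<^sub>1\<close> by linearity, and \<open>x\<close> is congruent to an element of \<open>G\<close> modulo boundaries and \<open>JP\<^sub>n\<^sub>+\<^sub>1\<close>.
\<close>

lemma compression_decomposition:
  "\<exists>h. linear_map R (P n) (P (Suc n)) h \<and> (\<forall>x \<in> carrier (P (Suc n)).
    \<exists>y \<in> G (Suc n). \<exists>z \<in> carrier (P (Suc (Suc n))). x = y \<oplus>\<^bsub>P (Suc n)\<^esub> d (Suc n) z \<oplus>\<^bsub>P (Suc n)\<^esub> h (d n x))"
proof -
  obtain \<gamma> h where c: "compression n \<gamma> h" using compression_exists by blast
  obtain \<gamma>' h' where s: "linear_map R (P (Suc n)) (P (Suc n)) \<gamma>'" "\<gamma>' ` carrier (P (Suc n)) \<subseteq> G (Suc n)"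
    "linear_map R (P (Suc n)) (P (Suc (Suc n))) h'"
    "\<forall>x \<in> carrier (P (Suc n)). x = \<gamma>' x \<oplus>\<^bsub>P (Suc n)\<^esub> d (Suc n) (h' x) \<oplus>\<^bsub>P (Suc n)\<^esub> h (d n x)"
    using compression_step[OF c] by blast
  show ?thesis
  proof (intro exI[of _ h] conjI ballI)
    show "linear_map R (P n) (P (Suc n)) h" using c by (simp add: compression_def)
    fix x assume x: "x \<in> carrier (P (Suc n))"
    show "\<exists>y \<in> G (Suc n). \<exists>z \<in> carrier (P (Suc (Suc n))). x = y \<oplus>\<^bsub>P (Suc n)\<^esub> d (Suc n) z \<oplus>\<^bsub>P (Suc n)\<^esub> h (d n x)"
      by (rule bexI[of _ "\<gamma>' x"], rule bexI[of _ "h' x"])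
        (use s x linear_mapD(1)[OF s(3) x] in auto)
  qed
qed

end

end

section \<open>Homogeneous components\<close>

lemma additive_finsum:
  assumes M: "abelian_group M" and N: "abelian_group N"
    and f: "\<And>x. x \<in> carrier M \<Longrightarrow> f x \<in> carrier N"
      "\<And>x y. x \<in> carrier M \<Longrightarrow> y \<in> carrier M \<Longrightarrow> f (x \<oplus>\<^bsub>M\<^esub> y) = f x \<oplus>\<^bsub>N\<^esub> f y"
    and g: "\<And>i. i \<in> I \<Longrightarrow> g i \<in> carrier M"
  shows "f (finsum M g I) = finsum N (\<lambda>i. f (g i)) I"
proof -
  interpret M: abelian_group M by fact
  interpret N: abelian_group N by fact
  have zero: "f \<zero>\<^bsub>M\<^esub> = \<zero>\<^bsub>N\<^esub>"
    using f(1)[of "\<zero>\<^bsub>M\<^esub>"] f(2)[of "\<zero>\<^bsub>M\<^esub>" "\<zero>\<^bsub>M\<^esub>"] by (simp add: N.add.l_cancel_one')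
  show ?thesis using g
  proof (induction I rule: infinite_finite_induct)
    case (insert i I)
    then have "g i \<in> carrier M" "g \<in> I \<rightarrow> carrier M" by auto
    moreover have "(\<lambda>i. f (g i)) \<in> I \<rightarrow> carrier N" using f(1) insert.prems by auto
    ultimately show ?case using insert f by simp
  qed (simp_all add: zero)
qed

definition hcomp :: "('m, 'z) ring_scheme \<Rightarrow> (int \<Rightarrow> 'm set) \<Rightarrow> 'm \<Rightarrow> int \<Rightarrow> 'm" where
  "hcomp M G x = (THE f. (\<forall>d. f d \<in> G d) \<and> finite {d. f d \<noteq> \<zero>\<^bsub>M\<^esub>} \<and>
      x = finsum M f {d. f d \<noteq> \<zero>\<^bsub>M\<^esub>})"

locale graded_group = abelian_group M for M (structure) and G +
  assumes gr: "grading M G"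
begin

lemma G_subgroup: "subgroup (G d) (add_monoid M)"
  using gr by (simp add: grading_def)

lemma G_subset: "x \<in> G d \<Longrightarrow> x \<in> carrier M"
  using subgroup.subset[OF G_subgroup] by auto

lemma G_zero: "\<zero> \<in> G d"
  using subgroup.one_closed[OF G_subgroup] by simp

lemma G_add: "x \<in> G d \<Longrightarrow> y \<in> G d \<Longrightarrow> x \<oplus> y \<in> G d"
  using subgroup.m_closed[OF G_subgroup, of x d y] by simp

lemma hcomp_ex1:
  "x \<in> carrier M \<Longrightarrow> \<exists>!f. (\<forall>d. f d \<in> G d) \<and> finite {d. f d \<noteq> \<zero>} \<and> x = finsum M f {d. f d \<noteq> \<zero>}"
  using gr by (simp add: grading_def)

lemma hcomp_props:
  assumes "x \<in> carrier M"
  shows "hcomp M G x d \<in> G d" "finite {d. hcomp M G x d \<noteq> \<zero>}"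
    "x = finsum M (hcomp M G x) {d. hcomp M G x d \<noteq> \<zero>}"
  using theI'[OF hcomp_ex1[OF assms]] unfolding hcomp_def by blast+

lemma hcomp_closed: "x \<in> carrier M \<Longrightarrow> hcomp M G x d \<in> carrier M"
  by (rule G_subset[OF hcomp_props(1)])

lemma finsum_support:
  assumes "finite D" "{d. f d \<noteq> \<zero>} \<subseteq> D" "\<And>d. f d \<in> carrier M"
  shows "finsum M f {d. f d \<noteq> \<zero>} = finsum M f D"
  by (rule add.finprod_mono_neutral_cong_left) (use assms in auto)

lemma hcomp_eqI:
  assumes "\<And>d. f d \<in> G d" "finite D" "{d. f d \<noteq> \<zero>} \<subseteq> D" "x = finsum M f D"
  shows "hcomp M G x = f"
proof -
  have "x \<in> carrier M" unfolding assms(4) using assms(1) G_subset by (intro finsum_closed) auto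
  from hcomp_ex1[OF this] show ?thesis unfolding hcomp_def
  proof (rule the1_equality)
    show "(\<forall>d. f d \<in> G d) \<and> finite {d. f d \<noteq> \<zero>} \<and> x = finsum M f {d. f d \<noteq> \<zero>}"
      using assms(1) finite_subset[OF assms(3,2)]
        assms(4)[folded finsum_support[OF assms(2,3) G_subset[OF assms(1)]]] by simp
  qed
qed

lemma hcomp_sum:
  assumes "x \<in> carrier M" "finite D" "{d. hcomp M G x d \<noteq> \<zero>} \<subseteq> D"
  shows "x = finsum M (hcomp M G x) D"
  using hcomp_props(3)[OF assms(1)] finsum_support[OF assms(2,3)] hcomp_closed[OF assms(1)] by simp

lemma hcomp_homogeneous: "x \<in> G j \<Longrightarrow> hcomp M G x = (\<lambda>d. if d = j then x else \<zero>)"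
  by (rule hcomp_eqI[where D = "{j}"]) (use G_zero G_subset in auto)

lemma hcomp_add:
  assumes x: "x \<in> carrier M" and y: "y \<in> carrier M"
  shows "hcomp M G (x \<oplus> y) d = hcomp M G x d \<oplus> hcomp M G y d"
proof -
  let ?D = "{d. hcomp M G x d \<noteq> \<zero>} \<union> {d. hcomp M G y d \<noteq> \<zero>}"
  have D: "finite ?D" using hcomp_props(2)[OF x] hcomp_props(2)[OF y] by simp
  have "finsum M (\<lambda>d. hcomp M G x d \<oplus> hcomp M G y d) ?D
    = finsum M (hcomp M G x) ?D \<oplus> finsum M (hcomp M G y) ?D"
    by (rule finsum_addf) (use hcomp_closed[OF x] hcomp_closed[OF y] in auto)
  also have "\<dots> = x \<oplus> y" using hcomp_sum[OF x D] hcomp_sum[OF y D] by auto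
  finally have "hcomp M G (x \<oplus> y) = (\<lambda>d. hcomp M G x d \<oplus> hcomp M G y d)"
    by (intro hcomp_eqI[OF _ D]) (use hcomp_props(1)[OF x] hcomp_props(1)[OF y] G_add in auto)
  then show ?thesis by simp
qed

lemma hcomp_zero: "hcomp M G \<zero> d = \<zero>"
  using hcomp_homogeneous[OF G_zero, of d] by simp

lemma hcomp_finsum:
  assumes "\<And>i. i \<in> I \<Longrightarrow> g i \<in> carrier M"
  shows "hcomp M G (finsum M g I) d = finsum M (\<lambda>i. hcomp M G (g i) d) I"
  by (rule additive_finsum[OF abelian_group_axioms abelian_group_axioms])
    (use assms hcomp_closed hcomp_add in auto)

end

text \<open>
  Besides homomorphisms of degree \<open>0\<close>, this covers multiplication by a homogeneous element and
  \<open>a \<mapsto> a \<cdot> w\<close> for homogeneous \<open>w\<close>.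
\<close>

lemma hcomp_shift:
  assumes "graded_group M G" "graded_group N H"
    and f: "\<And>x. x \<in> carrier M \<Longrightarrow> f x \<in> carrier N"
      "\<And>x y. x \<in> carrier M \<Longrightarrow> y \<in> carrier M \<Longrightarrow> f (x \<oplus>\<^bsub>M\<^esub> y) = f x \<oplus>\<^bsub>N\<^esub> f y"
      "\<And>x d. x \<in> G d \<Longrightarrow> f x \<in> H (d + s)"
    and x: "x \<in> carrier M"
  shows "hcomp N H (f x) d = f (hcomp M G x (d - s))"
proof -
  interpret M: graded_group M G by fact
  interpret N: graded_group N H by fact
  have zero: "f \<zero>\<^bsub>M\<^esub> = \<zero>\<^bsub>N\<^esub>"
    using f(1)[of "\<zero>\<^bsub>M\<^esub>"] f(2)[of "\<zero>\<^bsub>M\<^esub>" "\<zero>\<^bsub>M\<^esub>"] by (simp add: N.add.l_cancel_one')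
  let ?D = "{d. hcomp M G x d \<noteq> \<zero>\<^bsub>M\<^esub>}"
  have inj: "inj_on (\<lambda>d. d + s) ?D" by (simp add: inj_on_def)
  have c: "f (hcomp M G x d) \<in> carrier N" for d by (rule f(1)[OF M.hcomp_closed[OF x]])
  have "f x = f (finsum M (hcomp M G x) ?D)" using M.hcomp_props(3)[OF x] by simp
  also have "\<dots> = finsum N (\<lambda>d. f (hcomp M G x d)) ?D"
    by (rule additive_finsum[OF M.abelian_group_axioms N.abelian_group_axioms f(1,2)])
      (use M.hcomp_closed[OF x] in auto)
  also have "\<dots> = finsum N (\<lambda>d. f (hcomp M G x (d - s))) ((\<lambda>d. d + s) ` ?D)"
    by (subst N.finsum_reindex[OF _ inj]) (use c in auto)
  finally have fx: "f x = finsum N (\<lambda>d. f (hcomp M G x (d - s))) ((\<lambda>d. d + s) ` ?D)" .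
  have "hcomp N H (f x) = (\<lambda>d. f (hcomp M G x (d - s)))"
  proof (rule N.hcomp_eqI[OF _ _ _ fx])
    show "f (hcomp M G x (d - s)) \<in> H d" for d using f(3)[OF M.hcomp_props(1)[OF x], of "d - s"] by simp
    show "finite ((\<lambda>d. d + s) ` ?D)" using M.hcomp_props(2)[OF x] by simp
    show "{d. f (hcomp M G x (d - s)) \<noteq> \<zero>\<^bsub>N\<^esub>} \<subseteq> (\<lambda>d. d + s) ` ?D"
    proof
      fix d assume "d \<in> {d. f (hcomp M G x (d - s)) \<noteq> \<zero>\<^bsub>N\<^esub>}"
      then have "d - s \<in> ?D" using zero by auto
      then have "d - s + s \<in> (\<lambda>d. d + s) ` ?D" by (rule imageI)
      then show "d \<in> (\<lambda>d. d + s) ` ?D" by simp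
    qed
  qed
  then show ?thesis by simp
qed

text \<open>
  For kernels of graded maps, which have to be covered in turn when a resolution is built.
\<close>

lemma grading_submodule:
  assumes "module R M" and H: "submodule H R M" and gr: "grading M G"
    and comp: "\<And>x d. x \<in> H \<Longrightarrow> hcomp M G x d \<in> H"
  shows "grading (M\<lparr>carrier := H\<rparr>) (\<lambda>d. G d \<inter> H)"
proof -
  interpret module R M by fact
  interpret M: graded_group M G by unfold_locales (rule gr)
  have HM: "module R (M\<lparr>carrier := H\<rparr>)" by (rule submodule.submodule_is_module[OF H module_axioms])
  interpret H: module R "M\<lparr>carrier := H\<rparr>" by (rule HM)
  have sub: "H \<subseteq> carrier M" by (rule submodule_subset[OF H])
  have incl: "linear_map R (M\<lparr>carrier := H\<rparr>) M (\<lambda>x. x)"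
    by (rule linear_submodule_domain[OF linear_id sub])
  have sum: "finsum (M\<lparr>carrier := H\<rparr>) f I = finsum M f I" if "f \<in> I \<rightarrow> H" for f :: "int \<Rightarrow> _" and I
    using linear_finsum[OF incl HM module_axioms, of f I] that by simp
  have "subgroup (G d \<inter> H) (add_monoid (M\<lparr>carrier := H\<rparr>))" for d
  proof -
    have "subgroup (G d \<inter> H) (add_monoid M)"
      by (rule M.add.subgroups_Inter_pair[OF M.G_subgroup submodule.axioms(1)[OF H]])
    then have "subgroup (G d \<inter> H) ((add_monoid M)\<lparr>carrier := H\<rparr>)"
      by (intro M.add.subgroup_incl submodule.axioms(1)[OF H]) auto
    then show ?thesis by simp
  qed
  moreover have "\<exists>!f. (\<forall>d. f d \<in> G d \<inter> H) \<and> finite {d. f d \<noteq> \<zero>\<^bsub>M\<lparr>carrier := H\<rparr>\<^esub>} \<and>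
      x = finsum (M\<lparr>carrier := H\<rparr>) f {d. f d \<noteq> \<zero>\<^bsub>M\<lparr>carrier := H\<rparr>\<^esub>}" if x: "x \<in> H" for x
  proof (rule ex1I[of _ "hcomp M G x"])
    have xM: "x \<in> carrier M" using x sub by blast
    show "(\<forall>d. hcomp M G x d \<in> G d \<inter> H) \<and> finite {d. hcomp M G x d \<noteq> \<zero>\<^bsub>M\<lparr>carrier := H\<rparr>\<^esub>} \<and>
      x = finsum (M\<lparr>carrier := H\<rparr>) (hcomp M G x) {d. hcomp M G x d \<noteq> \<zero>\<^bsub>M\<lparr>carrier := H\<rparr>\<^esub>}"
      using M.hcomp_props[OF xM] comp[OF x] by (simp add: sum)
    fix f assume f: "(\<forall>d. f d \<in> G d \<inter> H) \<and> finite {d. f d \<noteq> \<zero>\<^bsub>M\<lparr>carrier := H\<rparr>\<^esub>} \<and>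
      x = finsum (M\<lparr>carrier := H\<rparr>) f {d. f d \<noteq> \<zero>\<^bsub>M\<lparr>carrier := H\<rparr>\<^esub>}"
    then have "x = finsum M f {d. f d \<noteq> \<zero>\<^bsub>M\<^esub>}" by (simp add: sum)
    then show "f = hcomp M G x"
      using f by (intro M.hcomp_eqI[symmetric, where D = "{d. f d \<noteq> \<zero>\<^bsub>M\<^esub>}"]) auto
  qed
  ultimately show ?thesis unfolding grading_def by simp
qed

section \<open>Morphisms of OI and FI\<close>

lemma objs_finite: "S \<in> objs C \<Longrightarrow> finite (fst S)"
  by (cases C) auto

lemma objs_rel: "S \<in> objs C \<Longrightarrow> snd S \<subseteq> fst S \<times> fst S"
  by (cases C) (auto simp: order_on_defs)

lemma interval_obj_objs: "interval_obj C n \<in> objs C"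
  by (cases C) (auto simp: order_on_defs refl_on_def trans_def antisym_def total_on_def)

lemma fst_interval_obj: "fst (interval_obj C n) = {1..n}"
  by (cases C) auto

lemma id_mor_closed: "S \<in> objs C \<Longrightarrow> id_mor S \<in> mor S S"
  using objs_rel[of S C] by (auto simp: mor_def inj_on_def)

lemma comp_mor_closed:
  assumes "S \<in> objs C" "\<epsilon> \<in> mor S T" "\<eta> \<in> mor T U"
  shows "comp_mor S \<eta> \<epsilon> \<in> mor S U"
proof -
  have "inj_on (compose (fst S) \<eta> \<epsilon>) (fst S)"
    using assms(2,3) by (auto simp: mor_def inj_on_def compose_def PiE_iff)
  moreover have "(compose (fst S) \<eta> \<epsilon> x, compose (fst S) \<eta> \<epsilon> y) \<in> snd U" if "(x, y) \<in> snd S" for x y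
  proof -
    have "x \<in> fst S" "y \<in> fst S" using objs_rel[OF assms(1)] that by auto
    then show ?thesis using assms(2,3) that by (auto simp: mor_def compose_def)
  qed
  moreover have "compose (fst S) \<eta> \<epsilon> \<in> fst S \<rightarrow>\<^sub>E fst U"
    using assms(2,3) by (auto simp: mor_def compose_def PiE_iff)
  ultimately show ?thesis by (auto simp: mor_def)
qed

lemma comp_mor_assoc:
  assumes "\<epsilon> \<in> mor S T"
  shows "comp_mor S (comp_mor T \<theta> \<eta>) \<epsilon> = comp_mor S \<theta> (comp_mor S \<eta> \<epsilon>)"
  using assms by (intro compose_assoc[symmetric]) (auto simp: mor_def)

lemma comp_mor_id_left: "\<epsilon> \<in> mor S T \<Longrightarrow> comp_mor S (id_mor T) \<epsilon> = \<epsilon>"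
  by (auto simp: mor_def compose_def PiE_iff extensional_def fun_eq_iff)

lemma comp_mor_id_right: "\<epsilon> \<in> mor S T \<Longrightarrow> comp_mor S \<epsilon> (id_mor S) = \<epsilon>"
  by (auto simp: mor_def compose_def PiE_iff extensional_def fun_eq_iff)

section \<open>Free modules over a set-valued functor\<close>

text \<open>
  Transition maps are only semilinear over the maps of \<open>A\<close>.  Since \<open>act\<close> is the same on both sides,
  the equaliser is still a submodule, so generators decide.
\<close>

lemma (in cring) free_module_semilinear_eq:
  assumes N: "abelian_group N"
    and f: "\<And>u. u \<in> carrier (free_module R X) \<Longrightarrow> f u \<in> carrier N"
      "\<And>u u'. \<lbrakk>u \<in> carrier (free_module R X); u' \<in> carrier (free_module R X)\<rbrakk> \<Longrightarrow>
        f (u \<oplus>\<^bsub>free_module R X\<^esub> u') = f u \<oplus>\<^bsub>N\<^esub> f u'"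
      "\<And>a u. \<lbrakk>a \<in> carrier R; u \<in> carrier (free_module R X)\<rbrakk> \<Longrightarrow> f (a \<odot>\<^bsub>free_module R X\<^esub> u) = act a (f u)"
    and f': "\<And>u. u \<in> carrier (free_module R X) \<Longrightarrow> f' u \<in> carrier N"
      "\<And>u u'. \<lbrakk>u \<in> carrier (free_module R X); u' \<in> carrier (free_module R X)\<rbrakk> \<Longrightarrow>
        f' (u \<oplus>\<^bsub>free_module R X\<^esub> u') = f' u \<oplus>\<^bsub>N\<^esub> f' u'"
      "\<And>a u. \<lbrakk>a \<in> carrier R; u \<in> carrier (free_module R X)\<rbrakk> \<Longrightarrow> f' (a \<odot>\<^bsub>free_module R X\<^esub> u) = act a (f' u)"
    and gen: "\<And>x. x \<in> X \<Longrightarrow> f (free_gen R x) = f' (free_gen R x)"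
    and u: "u \<in> carrier (free_module R X)"
  shows "f u = f' u"
proof -
  interpret N: abelian_group N by fact
  interpret F: module R "free_module R X" by (rule free_module_module)
  have z: "f \<zero>\<^bsub>free_module R X\<^esub> = \<zero>\<^bsub>N\<^esub>" "f' \<zero>\<^bsub>free_module R X\<^esub> = \<zero>\<^bsub>N\<^esub>"
    using f(1)[of "\<zero>\<^bsub>free_module R X\<^esub>"] f(2)[of "\<zero>\<^bsub>free_module R X\<^esub>" "\<zero>\<^bsub>free_module R X\<^esub>"]
      f'(1)[of "\<zero>\<^bsub>free_module R X\<^esub>"] f'(2)[of "\<zero>\<^bsub>free_module R X\<^esub>" "\<zero>\<^bsub>free_module R X\<^esub>"]
    by (simp_all add: N.add.l_cancel_one')
  have "submodule {u \<in> carrier (free_module R X). f u = f' u} R (free_module R X)"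
  proof (rule F.submoduleI)
    fix u assume u: "u \<in> {u \<in> carrier (free_module R X). f u = f' u}"
    then show "\<ominus>\<^bsub>free_module R X\<^esub> u \<in> {u \<in> carrier (free_module R X). f u = f' u}"
      using f(3)[of "\<ominus> \<one>" u] f'(3)[of "\<ominus> \<one>" u] by (simp add: F.smult_minus_one)
  qed (use f f' z in auto)
  moreover have "free_gen R x \<in> {u \<in> carrier (free_module R X). f u = f' u}" if "x \<in> X" for x
    using gen[OF that] free_gen_closed[OF that] by simp
  ultimately have "u \<in> {u \<in> carrier (free_module R X). f u = f' u}"
    using u by (rule free_module_induct)
  then show ?thesis by simp
qed

lemma (in cat_algebra) Obj_cring: "S \<in> objs C \<Longrightarrow> cring (Obj A S)"
  by (rule algebra.M_cring[OF algebra_Obj])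

lemma (in cat_algebra) Map_hom:
  assumes "S \<in> objs C" "T \<in> objs C" "\<eta> \<in> mor S T"
  shows "a \<in> carrier (Obj A S) \<Longrightarrow> Map A S T \<eta> a \<in> carrier (Obj A T)"
    and "\<lbrakk>a \<in> carrier (Obj A S); b \<in> carrier (Obj A S)\<rbrakk> \<Longrightarrow>
      Map A S T \<eta> (a \<oplus>\<^bsub>Obj A S\<^esub> b) = Map A S T \<eta> a \<oplus>\<^bsub>Obj A T\<^esub> Map A S T \<eta> b"
    and "\<lbrakk>a \<in> carrier (Obj A S); b \<in> carrier (Obj A S)\<rbrakk> \<Longrightarrow>
      Map A S T \<eta> (a \<otimes>\<^bsub>Obj A S\<^esub> b) = Map A S T \<eta> a \<otimes>\<^bsub>Obj A T\<^esub> Map A S T \<eta> b"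
    and "Map A S T \<eta> \<one>\<^bsub>Obj A S\<^esub> = \<one>\<^bsub>Obj A T\<^esub>"
    and "Map A S T \<eta> \<zero>\<^bsub>Obj A S\<^esub> = \<zero>\<^bsub>Obj A T\<^esub>"
proof -
  note h = ring_hom_Map[OF assms]
  show "Map A S T \<eta> \<zero>\<^bsub>Obj A S\<^esub> = \<zero>\<^bsub>Obj A T\<^esub>"
    by (rule ring_hom_zero[OF h]) (use Obj_cring[OF assms(1)] Obj_cring[OF assms(2)] cring.axioms(1) in auto)
qed (use ring_hom_closed[OF ring_hom_Map[OF assms]] ring_hom_add[OF ring_hom_Map[OF assms]]
  ring_hom_mult[OF ring_hom_Map[OF assms]] ring_hom_one[OF ring_hom_Map[OF assms]] in auto)

text \<open>
  The case \<open>\<delta> = id\<close> of the compatibility condition: transition maps are semilinear.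
\<close>

lemma cat_module_smult:
  assumes "cat_algebra K C A" "cat_module C A N" "S \<in> objs C" "T \<in> objs C" "\<eta> \<in> mor S T"
    "a \<in> carrier (Obj A S)" "q \<in> carrier (Obj N S)"
  shows "Map N S T \<eta> (a \<odot>\<^bsub>Obj N S\<^esub> q) = Map A S T \<eta> a \<odot>\<^bsub>Obj N T\<^esub> Map N S T \<eta> q"
proof -
  interpret A: cat_algebra K C A by fact
  interpret N: cat_module C A N by fact
  show ?thesis
    using N.Map_smult[OF assms(3,3,4) id_mor_closed[OF assms(3)] assms(5-7)] assms
    by (simp add: A.Map_id comp_mor_id_right)
qed

text \<open>
  The module \<open>T \<mapsto> \<Oplus>\<^bsub>X T\<^esub> A\<^sub>T\<close> over a functor \<open>X\<close> to sets.  A transition map applies \<open>A(\<eta>)\<close> to all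
  coefficients and moves the basis by \<open>push \<eta>\<close>; writing it as a linear combination of basis elements
  gives additivity and semilinearity for free.
\<close>

locale free_functor = cat_algebra K C A
  for K :: "'k ring" and C and A :: "('k, 'a, 'z) functr_scheme" +
  fixes X :: "obj \<Rightarrow> 'x set" and push :: "(nat \<Rightarrow> nat) \<Rightarrow> 'x \<Rightarrow> 'x"
  assumes push_closed: "\<lbrakk>S \<in> objs C; T \<in> objs C; \<eta> \<in> mor S T; z \<in> X S\<rbrakk> \<Longrightarrow> push \<eta> z \<in> X T"
    and push_id: "\<lbrakk>S \<in> objs C; z \<in> X S\<rbrakk> \<Longrightarrow> push (id_mor S) z = z"
    and push_comp: "\<lbrakk>S \<in> objs C; T \<in> objs C; U \<in> objs C; \<eta> \<in> mor S T; \<theta> \<in> mor T U; z \<in> X S\<rbrakk> \<Longrightarrow>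
      push (comp_mor S \<theta> \<eta>) z = push \<theta> (push \<eta> z)"
begin

definition FObj :: "obj \<Rightarrow> ('a, 'x \<Rightarrow> 'a) module" where
  "FObj S = free_module (Obj A S) (X S)"

definition FMap :: "obj \<Rightarrow> obj \<Rightarrow> (nat \<Rightarrow> nat) \<Rightarrow> ('x \<Rightarrow> 'a) \<Rightarrow> 'x \<Rightarrow> 'a" where
  "FMap S T \<eta> f = lin_comb (Obj A T) (FObj T) (\<lambda>z. free_gen (Obj A T) (push \<eta> z)) (\<lambda>z. Map A S T \<eta> (f z))"

abbreviation e :: "obj \<Rightarrow> 'x \<Rightarrow> 'x \<Rightarrow> 'a" where
  "e S \<equiv> free_gen (Obj A S)"

lemma FObj_module: "S \<in> objs C \<Longrightarrow> module (Obj A S) (FObj S)"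
  unfolding FObj_def by (rule cring.free_module_module[OF Obj_cring])

lemma e_closed: "S \<in> objs C \<Longrightarrow> z \<in> X S \<Longrightarrow> e S z \<in> carrier (FObj S)"
  unfolding FObj_def by (rule cring.free_gen_closed[OF Obj_cring])

context
  fixes S T \<eta> assumes S: "S \<in> objs C" and T: "T \<in> objs C" and \<eta>: "\<eta> \<in> mor S T"
begin

lemma base_change_closed:
  assumes "f \<in> carrier (FObj S)"
  shows "(\<lambda>z. Map A S T \<eta> (f z)) \<in> carrier (free_module (Obj A T) (X S))"
proof (rule free_moduleI)
  note d = free_moduleD[OF assms[unfolded FObj_def]]
  note m = Map_hom[OF S T \<eta>]
  have *: "{z. Map A S T \<eta> (f z) \<noteq> \<zero>\<^bsub>Obj A T\<^esub>} \<subseteq> {z. f z \<noteq> \<zero>\<^bsub>Obj A S\<^esub>}" using m(5) by auto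
  show "finite {z. Map A S T \<eta> (f z) \<noteq> \<zero>\<^bsub>Obj A T\<^esub>}" by (rule finite_subset[OF * d(3)])
  show "x \<in> X S" if "Map A S T \<eta> (f x) \<noteq> \<zero>\<^bsub>Obj A T\<^esub>" for x using that * d(2) by auto
  show "Map A S T \<eta> (f x) \<in> carrier (Obj A T)" for x by (rule m(1)[OF d(1)])
qed

lemma push_gens: "(\<lambda>z. e T (push \<eta> z)) \<in> X S \<rightarrow> carrier (FObj T)"
  using e_closed[OF T] push_closed[OF S T \<eta>] by auto

lemma FMap_closed: "f \<in> carrier (FObj S) \<Longrightarrow> FMap S T \<eta> f \<in> carrier (FObj T)"
  unfolding FMap_def
  by (rule module.lin_comb_closed[OF FObj_module[OF T] base_change_closed push_gens])

lemma FMap_add: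
  assumes "f \<in> carrier (FObj S)" "f' \<in> carrier (FObj S)"
  shows "FMap S T \<eta> (f \<oplus>\<^bsub>FObj S\<^esub> f') = FMap S T \<eta> f \<oplus>\<^bsub>FObj T\<^esub> FMap S T \<eta> f'"
proof -
  have "(\<lambda>z. Map A S T \<eta> ((f \<oplus>\<^bsub>FObj S\<^esub> f') z))
    = (\<lambda>z. Map A S T \<eta> (f z)) \<oplus>\<^bsub>free_module (Obj A T) (X S)\<^esub> (\<lambda>z. Map A S T \<eta> (f' z))"
    using Map_hom(2)[OF S T \<eta>] free_moduleD(1)[OF assms(1)[unfolded FObj_def]]
      free_moduleD(1)[OF assms(2)[unfolded FObj_def]]
    by (simp add: free_module_simps FObj_def)
  then show ?thesis unfolding FMap_def
    using linear_mapD(2)[OF module.lin_comb_linear[OF FObj_module[OF T] push_gens]]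
      base_change_closed[OF assms(1)] base_change_closed[OF assms(2)] by simp
qed

lemma FMap_smult:
  assumes "a \<in> carrier (Obj A S)" "f \<in> carrier (FObj S)"
  shows "FMap S T \<eta> (a \<odot>\<^bsub>FObj S\<^esub> f) = Map A S T \<eta> a \<odot>\<^bsub>FObj T\<^esub> FMap S T \<eta> f"
proof -
  have "(\<lambda>z. Map A S T \<eta> ((a \<odot>\<^bsub>FObj S\<^esub> f) z))
    = Map A S T \<eta> a \<odot>\<^bsub>free_module (Obj A T) (X S)\<^esub> (\<lambda>z. Map A S T \<eta> (f z))"
    using Map_hom(3)[OF S T \<eta>] free_moduleD(1)[OF assms(2)[unfolded FObj_def]] assms(1)
    by (simp add: free_module_simps FObj_def)
  then show ?thesis unfolding FMap_def
    using linear_mapD(3)[OF module.lin_comb_linear[OF FObj_module[OF T] push_gens]]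
      base_change_closed[OF assms(2)] Map_hom(1)[OF S T \<eta> assms(1)] by simp
qed

lemma FMap_e: "z \<in> X S \<Longrightarrow> FMap S T \<eta> (e S z) = e T (push \<eta> z)"
proof -
  assume z: "z \<in> X S"
  have "(\<lambda>y. Map A S T \<eta> (e S z y)) = e T z"
    using Map_hom(4,5)[OF S T \<eta>] by (auto simp: free_gen_def)
  then show ?thesis unfolding FMap_def
    using module.lin_comb_free_gen[OF FObj_module[OF T] z push_gens] by simp
qed

end

lemma free_cat_module:
  assumes F: "Obj F = FObj" "Map F = FMap"
  shows "cat_module C A F"
proof (intro cat_module.intro set_functor.intro cat_module_axioms.intro, unfold F)
  fix S T \<epsilon> x assume "S \<in> objs C" "T \<in> objs C" "\<epsilon> \<in> mor S T" "x \<in> carrier (FObj S)"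
  then show "FMap S T \<epsilon> x \<in> carrier (FObj T)" by (rule FMap_closed)
next
  fix S x assume S: "S \<in> objs C" and x: "x \<in> carrier (FObj S)"
  interpret cring "Obj A S" by (rule Obj_cring[OF S])
  interpret F: module "Obj A S" "FObj S" by (rule FObj_module[OF S])
  note m = id_mor_closed[OF S]
  show "FMap S S (id_mor S) x = x"
    by (rule free_module_semilinear_eq[where X = "X S" and N = "FObj S" and act = "smult (FObj S)"
          and f = "FMap S S (id_mor S)" and f' = "\<lambda>x. x"])
      (simp_all add: FObj_def[symmetric] F.M.abelian_group_axioms FMap_closed FMap_add FMap_smult
        FMap_e push_id Map_id S m x)
next
  fix S T U \<epsilon> \<eta> x assume a: "S \<in> objs C" "T \<in> objs C" "U \<in> objs C" "\<epsilon> \<in> mor S T" "\<eta> \<in> mor T U"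
    and x: "x \<in> carrier (FObj S)"
  interpret cring "Obj A S" by (rule Obj_cring[OF a(1)])
  interpret F: module "Obj A U" "FObj U" by (rule FObj_module[OF a(3)])
  note m = comp_mor_closed[OF a(1,4,5)]
  show "FMap S U (comp_mor S \<eta> \<epsilon>) x = FMap T U \<eta> (FMap S T \<epsilon> x)"
    by (rule free_module_semilinear_eq[where X = "X S" and N = "FObj U"
          and act = "\<lambda>a. smult (FObj U) (Map A S U (comp_mor S \<eta> \<epsilon>) a)"
          and f = "FMap S U (comp_mor S \<eta> \<epsilon>)" and f' = "\<lambda>x. FMap T U \<eta> (FMap S T \<epsilon> x)"])
      (simp_all add: FObj_def[symmetric] F.M.abelian_group_axioms FMap_closed FMap_add FMap_smult
        FMap_e push_comp[OF a] Map_comp[OF a] a m x Map_hom push_closed[OF a(1,2,4)])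
next
  fix S assume "S \<in> objs C" then show "module (Obj A S) (FObj S)" by (rule FObj_module)
next
  fix S T \<epsilon> x y assume "S \<in> objs C" "T \<in> objs C" "\<epsilon> \<in> mor S T" "x \<in> carrier (FObj S)" "y \<in> carrier (FObj S)"
  then show "FMap S T \<epsilon> (x \<oplus>\<^bsub>FObj S\<^esub> y) = FMap S T \<epsilon> x \<oplus>\<^bsub>FObj T\<^esub> FMap S T \<epsilon> y" by (rule FMap_add)
next
  fix R S T \<delta> \<epsilon> a q
  assume a: "R \<in> objs C" "S \<in> objs C" "T \<in> objs C" "\<delta> \<in> mor R S" "\<epsilon> \<in> mor S T"
    "a \<in> carrier (Obj A R)" "q \<in> carrier (FObj S)"
  then show "FMap S T \<epsilon> (Map A R S \<delta> a \<odot>\<^bsub>FObj S\<^esub> q)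
    = Map A R T (comp_mor R \<epsilon> \<delta>) a \<odot>\<^bsub>FObj T\<^esub> FMap S T \<epsilon> q"
    by (simp add: FMap_smult Map_hom(1) Map_comp)
qed

lemma free_submodule_full:
  assumes F: "Obj F = FObj" "Map F = FMap" and N: "cat_submodule C A F N" and S: "S \<in> objs C"
    and gen: "\<And>z. z \<in> X S \<Longrightarrow> e S z \<in> N S"
  shows "N S = carrier (FObj S)"
proof
  have sub: "submodule (N S) (Obj A S) (free_module (Obj A S) (X S))"
    using N S F(1) by (simp add: cat_submodule_def FObj_def)
  show "N S \<subseteq> carrier (FObj S)" using submodule_subset[OF sub] by (simp add: FObj_def)
  show "carrier (FObj S) \<subseteq> N S"
    using cring.free_module_induct[OF Obj_cring[OF S] sub gen] by (auto simp: FObj_def)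
qed

context
  fixes N :: "('a, 'n, 'y) functr_scheme" and v :: "obj \<Rightarrow> 'x \<Rightarrow> 'n"
  assumes N: "cat_module C A N"
    and v: "\<And>S z. \<lbrakk>S \<in> objs C; z \<in> X S\<rbrakk> \<Longrightarrow> v S z \<in> carrier (Obj N S)"
    and v_natural: "\<And>S T \<eta> z. \<lbrakk>S \<in> objs C; T \<in> objs C; \<eta> \<in> mor S T; z \<in> X S\<rbrakk> \<Longrightarrow>
      Map N S T \<eta> (v S z) = v T (push \<eta> z)"
begin

interpretation N: cat_module C A N by (rule N)

lemma extension_linear:
  "S \<in> objs C \<Longrightarrow> linear_map (Obj A S) (FObj S) (Obj N S) (lin_comb (Obj A S) (Obj N S) (v S))"
  unfolding FObj_def by (rule module.lin_comb_linear[OF N.module_Obj]) (auto simp: v)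

lemma extension_e: "S \<in> objs C \<Longrightarrow> z \<in> X S \<Longrightarrow> lin_comb (Obj A S) (Obj N S) (v S) (e S z) = v S z"
  by (rule module.lin_comb_free_gen[OF N.module_Obj]) (auto simp: v)

text \<open>
  Both sides are semilinear in \<open>f\<close> and agree on the basis.
\<close>

lemma extension_natural:
  assumes a: "S \<in> objs C" "T \<in> objs C" "\<eta> \<in> mor S T" and f: "f \<in> carrier (FObj S)"
  shows "lin_comb (Obj A T) (Obj N T) (v T) (FMap S T \<eta> f) = Map N S T \<eta> (lin_comb (Obj A S) (Obj N S) (v S) f)"
proof -
  interpret cring "Obj A S" by (rule Obj_cring[OF a(1)])
  interpret NT: module "Obj A T" "Obj N T" by (rule N.module_Obj[OF a(2)])
  note l = linear_mapD[OF extension_linear[OF a(1)]] linear_mapD[OF extension_linear[OF a(2)]]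
  show ?thesis
    by (rule free_module_semilinear_eq[where X = "X S" and N = "Obj N T"
          and act = "\<lambda>a. smult (Obj N T) (Map A S T \<eta> a)"
          and f = "\<lambda>f. lin_comb (Obj A T) (Obj N T) (v T) (FMap S T \<eta> f)"
          and f' = "\<lambda>f. Map N S T \<eta> (lin_comb (Obj A S) (Obj N S) (v S) f)"])
      (simp_all add: FObj_def[symmetric] NT.M.abelian_group_axioms FMap_closed FMap_add FMap_smult
        FMap_e a f Map_hom push_closed[OF a] l extension_e v_natural N.Map_closed N.Map_add
        cat_module_smult[OF cat_algebra_axioms N])
qed

end

end

subsection \<open>Free modules on generators in prescribed objects\<close>

text \<open>
  The free module with one generator in the component at \<open>D i\<close> for every \<open>i \<in> I\<close>; its basis at \<open>T\<close>
  consists of the pairs \<open>(i, \<epsilon>)\<close> with \<open>\<epsilon> : D i \<rightarrow> T\<close>.  These pairs are replaced by codes in a type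
  \<open>'x\<close>, so that the elements of the module have the type \<^typ>\<open>'x \<Rightarrow> 'a\<close> with \<open>'x\<close> at will.
\<close>

locale coded_generators = cat_algebra K C A
  for K :: "'k ring" and C and A :: "('k, 'a, 'z) functr_scheme" +
  fixes I :: "'i set" and D :: "'i \<Rightarrow> obj" and code :: "'i \<times> (nat \<Rightarrow> nat) \<Rightarrow> 'x"
  assumes D_objs: "i \<in> I \<Longrightarrow> D i \<in> objs C"
    and code_inj: "inj_on code {(i, \<epsilon>). i \<in> I \<and> (\<exists>T \<in> objs C. \<epsilon> \<in> mor (D i) T)}"
begin

definition X :: "obj \<Rightarrow> 'x set" where
  "X T = code ` {(i, \<epsilon>). i \<in> I \<and> \<epsilon> \<in> mor (D i) T}"

definition dec :: "'x \<Rightarrow> 'i \<times> (nat \<Rightarrow> nat)" where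
  "dec = inv_into {(i, \<epsilon>). i \<in> I \<and> (\<exists>T \<in> objs C. \<epsilon> \<in> mor (D i) T)} code"

definition push :: "(nat \<Rightarrow> nat) \<Rightarrow> 'x \<Rightarrow> 'x" where
  "push \<eta> z = (case dec z of (i, \<epsilon>) \<Rightarrow> code (i, comp_mor (D i) \<eta> \<epsilon>))"

lemma dec_code: "\<lbrakk>i \<in> I; T \<in> objs C; \<epsilon> \<in> mor (D i) T\<rbrakk> \<Longrightarrow> dec (code (i, \<epsilon>)) = (i, \<epsilon>)"
  unfolding dec_def by (rule inv_into_f_f[OF code_inj]) auto

lemma X_E:
  assumes "z \<in> X T" obtains i \<epsilon> where "i \<in> I" "\<epsilon> \<in> mor (D i) T" "z = code (i, \<epsilon>)"
  using assms by (auto simp: X_def)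

lemma X_I: "i \<in> I \<Longrightarrow> \<epsilon> \<in> mor (D i) T \<Longrightarrow> code (i, \<epsilon>) \<in> X T"
  by (auto simp: X_def)

lemma push_code: "\<lbrakk>i \<in> I; T \<in> objs C; \<epsilon> \<in> mor (D i) T\<rbrakk> \<Longrightarrow> push \<eta> (code (i, \<epsilon>)) = code (i, comp_mor (D i) \<eta> \<epsilon>)"
  by (simp add: push_def dec_code)

sublocale free_functor K C A X push
proof
  fix S T \<eta> z assume a: "S \<in> objs C" "T \<in> objs C" "\<eta> \<in> mor S T" and z: "z \<in> X S"
  from z show "push \<eta> z \<in> X T"
    by (rule X_E) (simp add: push_code[OF _ a(1)] X_I comp_mor_closed[OF D_objs _ a(3)])
next
  fix S z assume a: "S \<in> objs C" and z: "z \<in> X S"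
  from z show "push (id_mor S) z = z" by (rule X_E) (simp add: push_code[OF _ a] comp_mor_id_left)
next
  fix S T U \<eta> \<theta> z
  assume a: "S \<in> objs C" "T \<in> objs C" "U \<in> objs C" "\<eta> \<in> mor S T" "\<theta> \<in> mor T U" and z: "z \<in> X S"
  from z obtain i \<epsilon> where i: "i \<in> I" "\<epsilon> \<in> mor (D i) S" "z = code (i, \<epsilon>)" by (rule X_E)
  have c: "comp_mor (D i) \<eta> \<epsilon> \<in> mor (D i) T" by (rule comp_mor_closed[OF D_objs[OF i(1)] i(2) a(4)])
  show "push (comp_mor S \<theta> \<eta>) z = push \<theta> (push \<eta> z)"
    unfolding i(3) push_code[OF i(1) a(1) i(2)] push_code[OF i(1) a(2) c] comp_mor_assoc[OF i(2)] ..
qed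

definition gen :: "'i \<Rightarrow> 'x \<Rightarrow> 'a" where
  "gen i = e (D i) (code (i, id_mor (D i)))"

lemma gen_closed: "i \<in> I \<Longrightarrow> gen i \<in> carrier (FObj (D i))"
  unfolding gen_def by (intro e_closed D_objs X_I id_mor_closed[OF D_objs])

lemma FMap_gen:
  assumes "i \<in> I" "T \<in> objs C" "\<epsilon> \<in> mor (D i) T"
  shows "FMap (D i) T \<epsilon> (gen i) = e T (code (i, \<epsilon>))"
proof -
  note m = id_mor_closed[OF D_objs[OF assms(1)]]
  show ?thesis unfolding gen_def
    by (simp add: FMap_e[OF D_objs[OF assms(1)] assms(2,3) X_I[OF assms(1) m]]
        push_code[OF assms(1) D_objs[OF assms(1)] m] comp_mor_id_right[OF assms(3)])
qed

lemma finitely_generated_free: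
  assumes F: "Obj F = FObj" "Map F = FMap" and "finite I" and D: "\<And>i. i \<in> I \<Longrightarrow> D i = interval_obj C (n i)"
  shows "finitely_generated C A F"
  unfolding finitely_generated_def
proof (intro exI[of _ "(\<lambda>i. (n i, gen i)) ` I"] conjI allI impI ballI)
  show "(\<lambda>i. (n i, gen i)) ` I \<subseteq> Sigma UNIV (\<lambda>n. carrier (Obj F (interval_obj C n)))"
    using gen_closed D by (auto simp: F)
  show "finite ((\<lambda>i. (n i, gen i)) ` I)" using assms by simp
  fix N S
  assume N: "cat_submodule C A F N \<and> (\<forall>(n, q) \<in> (\<lambda>i. (n i, gen i)) ` I. q \<in> N (interval_obj C n))"
    and S: "S \<in> objs C"
  have "e S z \<in> N S" if z: "z \<in> X S" for z
  proof -
    obtain i \<epsilon> where i: "i \<in> I" "\<epsilon> \<in> mor (D i) S" "z = code (i, \<epsilon>)" using z by (rule X_E)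
    have "gen i \<in> N (D i)" using N i(1) D by auto
    moreover have "Map F (D i) S \<epsilon> ` N (D i) \<subseteq> N S"
      using N D_objs[OF i(1)] S i(2) unfolding cat_submodule_def by blast
    ultimately have "Map F (D i) S \<epsilon> (gen i) \<in> N S" by blast
    then show ?thesis using FMap_gen[OF i(1) S i(2)] by (simp add: F i(3))
  qed
  then show "N S = carrier (Obj F S)" using free_submodule_full[OF F _ S] N F(1) by simp
qed

text \<open>
  The images of the basis elements under the map \<open>ext\<close> that sends the generator \<open>i\<close> to \<open>v i\<close>.
\<close>

definition val :: "('a, 'n, 'y) functr_scheme \<Rightarrow> ('i \<Rightarrow> 'n) \<Rightarrow> obj \<Rightarrow> 'x \<Rightarrow> 'n" where
  "val N v T z = (case dec z of (i, \<epsilon>) \<Rightarrow> Map N (D i) T \<epsilon> (v i))"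

definition ext :: "('a, 'n, 'y) functr_scheme \<Rightarrow> ('i \<Rightarrow> 'n) \<Rightarrow> obj \<Rightarrow> ('x \<Rightarrow> 'a) \<Rightarrow> 'n" where
  "ext N v S = lin_comb (Obj A S) (Obj N S) (val N v S)"

context
  fixes N :: "('a, 'n, 'y) functr_scheme" and v :: "'i \<Rightarrow> 'n"
  assumes N: "cat_module C A N" and v: "\<And>i. i \<in> I \<Longrightarrow> v i \<in> carrier (Obj N (D i))"
begin

interpretation N: cat_module C A N by (rule N)

lemma val_code:
  "\<lbrakk>i \<in> I; T \<in> objs C; \<epsilon> \<in> mor (D i) T\<rbrakk> \<Longrightarrow> val N v T (code (i, \<epsilon>)) = Map N (D i) T \<epsilon> (v i)"
  by (simp add: val_def dec_code)

lemma val_closed: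
  assumes "S \<in> objs C" "z \<in> X S" shows "val N v S z \<in> carrier (Obj N S)"
  using assms(2) by (rule X_E) (simp add: val_code assms(1) N.Map_closed[OF D_objs] v)

lemma val_natural:
  assumes a: "S \<in> objs C" "T \<in> objs C" "\<eta> \<in> mor S T" and z: "z \<in> X S"
  shows "Map N S T \<eta> (val N v S z) = val N v T (push \<eta> z)"
proof -
  obtain i \<epsilon> where i: "i \<in> I" "\<epsilon> \<in> mor (D i) S" "z = code (i, \<epsilon>)" using z by (rule X_E)
  have c: "comp_mor (D i) \<eta> \<epsilon> \<in> mor (D i) T" by (rule comp_mor_closed[OF D_objs[OF i(1)] i(2) a(3)])
  show ?thesis
    unfolding i(3) push_code[OF i(1) a(1) i(2)] val_code[OF i(1) a(1) i(2)] val_code[OF i(1) a(2) c]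
    by (rule N.Map_comp[OF D_objs[OF i(1)] a(1,2) i(2) a(3) v[OF i(1)], symmetric])
qed


lemma ext_linear: "S \<in> objs C \<Longrightarrow> linear_map (Obj A S) (FObj S) (Obj N S) (ext N v S)"
  unfolding ext_def by (rule extension_linear[OF N val_closed val_natural])

lemma ext_natural:
  "\<lbrakk>S \<in> objs C; T \<in> objs C; \<eta> \<in> mor S T; f \<in> carrier (FObj S)\<rbrakk> \<Longrightarrow>
    ext N v T (FMap S T \<eta> f) = Map N S T \<eta> (ext N v S f)"
  unfolding ext_def by (rule extension_natural[OF N val_closed val_natural])

lemma ext_e:
  assumes "i \<in> I" "T \<in> objs C" "\<epsilon> \<in> mor (D i) T"
  shows "ext N v T (e T (code (i, \<epsilon>))) = Map N (D i) T \<epsilon> (v i)"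
  unfolding ext_def
  by (simp add: extension_e[OF N val_closed val_natural assms(2)] X_I[OF assms(1,3)] val_code[OF assms])

end

end

section \<open>Submodules and homomorphisms of modules over OI and FI\<close>

definition cat_hom ::
  "index_cat \<Rightarrow> ('k, 'a, 'z) functr_scheme \<Rightarrow> ('a, 'm, 'y) functr_scheme \<Rightarrow> ('a, 'n, 'w) functr_scheme
    \<Rightarrow> (obj \<Rightarrow> 'm \<Rightarrow> 'n) \<Rightarrow> bool"
where
  "cat_hom C A M N f \<longleftrightarrow>
    (\<forall>S \<in> objs C. linear_map (Obj A S) (Obj M S) (Obj N S) (f S)) \<and>
    (\<forall>S \<in> objs C. \<forall>T \<in> objs C. \<forall>\<epsilon> \<in> mor S T. \<forall>x \<in> carrier (Obj M S).
      f T (Map M S T \<epsilon> x) = Map N S T \<epsilon> (f S x))"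

lemma cat_hom_linear: "cat_hom C A M N f \<Longrightarrow> S \<in> objs C \<Longrightarrow> linear_map (Obj A S) (Obj M S) (Obj N S) (f S)"
  by (simp add: cat_hom_def)

lemma cat_hom_natural:
  "\<lbrakk>cat_hom C A M N f; S \<in> objs C; T \<in> objs C; \<epsilon> \<in> mor S T; x \<in> carrier (Obj M S)\<rbrakk> \<Longrightarrow>
    f T (Map M S T \<epsilon> x) = Map N S T \<epsilon> (f S x)"
  by (simp add: cat_hom_def)

lemma cat_submoduleD:
  assumes "cat_submodule C A M N"
  shows "S \<in> objs C \<Longrightarrow> submodule (N S) (Obj A S) (Obj M S)"
    and "\<lbrakk>S \<in> objs C; T \<in> objs C; \<epsilon> \<in> mor S T; x \<in> N S\<rbrakk> \<Longrightarrow> Map M S T \<epsilon> x \<in> N T"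
  using assms by (simp_all add: cat_submodule_def image_subset_iff)

lemma cat_submodule_carrier:
  "cat_submodule C A M N \<Longrightarrow> S \<in> objs C \<Longrightarrow> x \<in> N S \<Longrightarrow> x \<in> carrier (Obj M S)"
  using submodule_subset[OF cat_submoduleD(1), of C A M N S] by blast

lemma cat_submoduleI:
  assumes "\<And>S. S \<in> objs C \<Longrightarrow> submodule (N S) (Obj A S) (Obj M S)"
    and "\<And>S T \<epsilon> x. \<lbrakk>S \<in> objs C; T \<in> objs C; \<epsilon> \<in> mor S T; x \<in> N S\<rbrakk> \<Longrightarrow> Map M S T \<epsilon> x \<in> N T"
  shows "cat_submodule C A M N"
  unfolding cat_submodule_def using assms by (simp add: image_subset_iff)

lemma cat_submodule_full:
  assumes "cat_module C A M" shows "cat_submodule C A M (\<lambda>S. carrier (Obj M S))"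
proof -
  interpret cat_module C A M by fact
  show ?thesis by (rule cat_submoduleI) (simp_all add: module.carrier_is_submodule module_Obj Map_closed)
qed

lemma cat_submodule_Int:
  assumes "cat_module C A M" "cat_submodule C A M N" "cat_submodule C A M N'"
  shows "cat_submodule C A M (\<lambda>S. N S \<inter> N' S)"
proof -
  interpret cat_module C A M by fact
  show ?thesis
    by (rule cat_submoduleI)
      (simp_all add: submodule_Int cat_submoduleD[OF assms(2)] cat_submoduleD[OF assms(3)] module_Obj)
qed

lemma cat_submodule_vimage:
  assumes M: "cat_module C A M" and N: "cat_module C A N" and f: "cat_hom C A M N f"
    and H: "cat_submodule C A N H"
  shows "cat_submodule C A M (\<lambda>S. {x \<in> carrier (Obj M S). f S x \<in> H S})"
proof -
  interpret M: cat_module C A M by fact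
  interpret N: cat_module C A N by fact
  show ?thesis
  proof (rule cat_submoduleI)
    show "submodule {x \<in> carrier (Obj M S). f S x \<in> H S} (Obj A S) (Obj M S)" if S: "S \<in> objs C" for S
      by (rule submodule_vimage[OF cat_hom_linear[OF f S] M.module_Obj[OF S] N.module_Obj[OF S]
            cat_submoduleD(1)[OF H S]])
    show "Map M S T \<epsilon> x \<in> {x \<in> carrier (Obj M T). f T x \<in> H T}"
      if "S \<in> objs C" "T \<in> objs C" "\<epsilon> \<in> mor S T" "x \<in> {x \<in> carrier (Obj M S). f S x \<in> H S}" for S T \<epsilon> x
      using that cat_submoduleD(2)[OF H that(1-3)] by (simp add: M.Map_closed cat_hom_natural[OF f])
  qed
qed

lemma cat_submodule_image:
  assumes M: "cat_module C A M" and N: "cat_module C A N" and f: "cat_hom C A M N f"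
    and H: "cat_submodule C A M H"
  shows "cat_submodule C A N (\<lambda>S. f S ` H S)"
proof -
  interpret M: cat_module C A M by fact
  interpret N: cat_module C A N by fact
  show ?thesis
  proof (rule cat_submoduleI)
    show "submodule (f S ` H S) (Obj A S) (Obj N S)" if S: "S \<in> objs C" for S
      by (rule submodule_image[OF cat_hom_linear[OF f S] M.module_Obj[OF S] N.module_Obj[OF S]
            cat_submoduleD(1)[OF H S]])
    fix S T \<epsilon> y assume a: "S \<in> objs C" "T \<in> objs C" "\<epsilon> \<in> mor S T" and "y \<in> f S ` H S"
    then obtain x where x: "x \<in> H S" "y = f S x" by auto
    have "Map N S T \<epsilon> y = f T (Map M S T \<epsilon> x)"
      using cat_hom_natural[OF f a cat_submodule_carrier[OF H a(1) x(1)]] x(2) by simp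
    then show "Map N S T \<epsilon> y \<in> f T ` H T" using cat_submoduleD(2)[OF H a x(1)] by simp
  qed
qed

lemma submodule_restrict:
  assumes "module R M" "submodule H R M" "submodule H' R M" "H' \<subseteq> H"
  shows "submodule H' R (M\<lparr>carrier := H\<rparr>)"
proof -
  interpret H: module R "M\<lparr>carrier := H\<rparr>" by (rule submodule.submodule_is_module[OF assms(2,1)])
  show ?thesis
    by (rule H.module_incl_imp_submodule)
      (use assms(4) submodule.submodule_is_module[OF assms(3,1)] in simp_all)
qed

text \<open>
  The possible generators in the sense of \<^const>\<open>finitely_generated\<close>.
\<close>

definition gens :: "index_cat \<Rightarrow> ('a, 'm, 'z) functr_scheme \<Rightarrow> (nat \<times> 'm) set" where
  "gens C M = Sigma UNIV (\<lambda>n. carrier (Obj M (interval_obj C n)))"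

lemma finitely_generatedE:
  assumes "finitely_generated C A M"
  obtains G where "finite G" "G \<subseteq> gens C M"
    "\<forall>N. cat_submodule C A M N \<longrightarrow> (\<forall>n q. (n, q) \<in> G \<longrightarrow> q \<in> N (interval_obj C n)) \<longrightarrow>
      (\<forall>S \<in> objs C. N S = carrier (Obj M S))"
proof -
  obtain G where G: "G \<subseteq> gens C M \<and> finite G \<and>
      (\<forall>N. cat_submodule C A M N \<and> (\<forall>(n, q) \<in> G. q \<in> N (interval_obj C n))
        \<longrightarrow> (\<forall>S \<in> objs C. N S = carrier (Obj M S)))"
    using assms unfolding finitely_generated_def gens_def by (rule exE)
  show ?thesis
  proof (rule that[of G], goal_cases)
    case 3
    have "\<forall>(n, q) \<in> G. q \<in> N (interval_obj C n)"
      if "\<forall>n q. (n, q) \<in> G \<longrightarrow> q \<in> N (interval_obj C n)" for N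
      using that by (simp add: case_prod_unfold)
    then show ?case using G by simp
  qed (use G in simp_all)
qed

definition translates ::
  "index_cat \<Rightarrow> ('a, 'm, 'z) functr_scheme \<Rightarrow> (nat \<times> 'm) set \<Rightarrow> obj \<Rightarrow> 'm set"
where
  "translates C M G S = {Map M (interval_obj C n) S \<epsilon> q | n q \<epsilon>. (n, q) \<in> G \<and> \<epsilon> \<in> mor (interval_obj C n) S}"

definition cat_span ::
  "index_cat \<Rightarrow> ('k, 'a, 'y) functr_scheme \<Rightarrow> ('a, 'm, 'z) functr_scheme \<Rightarrow> (nat \<times> 'm) set \<Rightarrow> obj \<Rightarrow> 'm set"
where
  "cat_span C A M G S = module_span (Obj A S) (Obj M S) (translates C M G S)"

context cat_module
begin

lemma translates_closed: "G \<subseteq> gens C M \<Longrightarrow> S \<in> objs C \<Longrightarrow> translates C M G S \<subseteq> carrier (Obj M S)"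
  by (auto simp: translates_def gens_def intro!: Map_closed[OF interval_obj_objs])

lemma translates_Map:
  assumes "G \<subseteq> gens C M" "S \<in> objs C" "T \<in> objs C" "\<eta> \<in> mor S T" "x \<in> translates C M G S"
  shows "Map M S T \<eta> x \<in> translates C M G T"
proof -
  obtain n q \<epsilon> where x: "(n, q) \<in> G" "\<epsilon> \<in> mor (interval_obj C n) S" "x = Map M (interval_obj C n) S \<epsilon> q"
    using assms(5) by (auto simp: translates_def)
  have q: "q \<in> carrier (Obj M (interval_obj C n))" using x(1) assms(1) by (auto simp: gens_def)
  have "Map M S T \<eta> x = Map M (interval_obj C n) T (comp_mor (interval_obj C n) \<eta> \<epsilon>) q"
    unfolding x(3) by (rule Map_comp[OF interval_obj_objs assms(2,3) x(2) assms(4) q, symmetric])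
  then show ?thesis
    using x(1) comp_mor_closed[OF interval_obj_objs x(2) assms(4)] by (auto simp: translates_def)
qed

lemma cat_span_least:
  assumes N: "cat_submodule C A M N" and G: "\<And>n q. (n, q) \<in> G \<Longrightarrow> q \<in> N (interval_obj C n)" and S: "S \<in> objs C"
  shows "cat_span C A M G S \<subseteq> N S"
  unfolding cat_span_def
  by (rule module_span_least[OF cat_submoduleD(1)[OF N S]])
    (use G cat_submoduleD(2)[OF N interval_obj_objs S] in \<open>auto simp: translates_def\<close>)

lemma cat_span_incl:
  assumes "G \<subseteq> gens C M" "(n, q) \<in> G"
  shows "q \<in> cat_span C A M G (interval_obj C n)"
  unfolding cat_span_def
proof (rule subsetD[OF module_span_incl])
  have "q = Map M (interval_obj C n) (interval_obj C n) (id_mor (interval_obj C n)) q"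
    using assms by (intro Map_id[symmetric] interval_obj_objs) (auto simp: gens_def)
  then show "q \<in> translates C M G (interval_obj C n)"
    using assms(2) id_mor_closed[OF interval_obj_objs] unfolding translates_def by blast
qed

lemma Map_zero:
  assumes A: "cat_algebra K C A" and a: "S \<in> objs C" "T \<in> objs C" "\<eta> \<in> mor S T"
  shows "Map M S T \<eta> \<zero>\<^bsub>Obj M S\<^esub> = \<zero>\<^bsub>Obj M T\<^esub>"
proof -
  interpret A: cat_algebra K C A by (rule A)
  interpret MS: module "Obj A S" "Obj M S" by (rule module_Obj[OF a(1)])
  interpret MT: module "Obj A T" "Obj M T" by (rule module_Obj[OF a(2)])
  have "Map M S T \<eta> (\<zero>\<^bsub>Obj A S\<^esub> \<odot>\<^bsub>Obj M S\<^esub> \<zero>\<^bsub>Obj M S\<^esub>) = \<zero>\<^bsub>Obj M T\<^esub>"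
    by (subst cat_module_smult[OF A cat_module_axioms a]) (simp_all add: A.Map_hom(5)[OF a] Map_closed[OF a])
  then show ?thesis by simp
qed

text \<open>
  Not an instance of preimages under linear maps, as \<open>Map M S T \<eta>\<close> is only semilinear.
\<close>

lemma Map_vimage_submodule:
  assumes A: "cat_algebra K C A" and a: "S \<in> objs C" "T \<in> objs C" "\<eta> \<in> mor S T"
    and H: "submodule H (Obj A T) (Obj M T)"
  shows "submodule {y \<in> carrier (Obj M S). Map M S T \<eta> y \<in> H} (Obj A S) (Obj M S)" (is "submodule ?H _ _")
proof -
  interpret A: cat_algebra K C A by (rule A)
  interpret MS: module "Obj A S" "Obj M S" by (rule module_Obj[OF a(1)])
  interpret MT: module "Obj A T" "Obj M T" by (rule module_Obj[OF a(2)])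
  note subT = MT.submoduleE[OF H]
  have sm: "Map M S T \<eta> (b \<odot>\<^bsub>Obj M S\<^esub> y) \<in> H" if "b \<in> carrier (Obj A S)" "y \<in> ?H" for b y
    using cat_module_smult[OF A cat_module_axioms a that(1), of y] that A.Map_hom(1)[OF a that(1)] subT(4) by simp
  show ?thesis
  proof (rule MS.submoduleI)
    show "\<zero>\<^bsub>Obj M S\<^esub> \<in> ?H" using Map_zero[OF A a] submodule_zero[OF H] by simp
    show "\<ominus>\<^bsub>Obj M S\<^esub> y \<in> ?H" if "y \<in> ?H" for y
      using sm[OF _ that, of "\<ominus>\<^bsub>Obj A S\<^esub> \<one>\<^bsub>Obj A S\<^esub>"] that by (simp add: MS.smult_minus_one)
  qed (use sm subT Map_add[OF a] in auto)
qed

lemma cat_span_submodule: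
  assumes A: "cat_algebra K C A" and G: "G \<subseteq> gens C M"
  shows "cat_submodule C A M (cat_span C A M G)"
proof (rule cat_submoduleI)
  show sub: "submodule (cat_span C A M G S) (Obj A S) (Obj M S)" if "S \<in> objs C" for S
    unfolding cat_span_def by (rule module_span_submodule[OF module_Obj translates_closed[OF G]]) (fact that)+
  fix S T \<eta> x assume a: "S \<in> objs C" "T \<in> objs C" "\<eta> \<in> mor S T" and x: "x \<in> cat_span C A M G S"
  let ?H = "{y \<in> carrier (Obj M S). Map M S T \<eta> y \<in> cat_span C A M G T}"
  have "submodule ?H (Obj A S) (Obj M S)" by (rule Map_vimage_submodule[OF A a sub[OF a(2)]])
  moreover have "translates C M G S \<subseteq> ?H"
    using translates_closed[OF G a(1)] translates_Map[OF G a] module_span_incl[of "translates C M G T" "Obj A T" "Obj M T"]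
    by (auto simp: cat_span_def)
  ultimately show "Map M S T \<eta> x \<in> cat_span C A M G T"
    using module_span_least x unfolding cat_span_def by blast
qed

end

section \<open>Transfer of noetherianity\<close>

lemma countable_morphisms: "S \<in> objs C \<Longrightarrow> countable {\<epsilon>. \<exists>T \<in> objs C. \<epsilon> \<in> mor S T}"
proof -
  assume S: "S \<in> objs C"
  let ?l = "\<lambda>\<epsilon>. map \<epsilon> (sorted_list_of_set (fst S)) :: nat list"
  have "inj_on ?l {\<epsilon>. \<exists>T \<in> objs C. \<epsilon> \<in> mor S T}"
  proof (rule inj_onI)
    fix \<epsilon> \<eta> assume a: "\<epsilon> \<in> {\<epsilon>. \<exists>T \<in> objs C. \<epsilon> \<in> mor S T}" "\<eta> \<in> {\<epsilon>. \<exists>T \<in> objs C. \<epsilon> \<in> mor S T}"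
      and eq: "?l \<epsilon> = ?l \<eta>"
    then have "\<epsilon> \<in> extensional (fst S)" "\<eta> \<in> extensional (fst S)" by (auto simp: mor_def PiE_iff)
    then show "\<epsilon> = \<eta>" using eq objs_finite[OF S] by (intro extensionalityI[of _ "fst S"]) auto
  qed
  then show ?thesis using countableI_type countable_image_inj_on by blast
qed

text \<open>
  The free module on \<open>G\<close> with elements of type \<^typ>\<open>nat \<Rightarrow> 'a\<close> is finitely generated, hence
  noetherian, and maps onto the span of \<open>G\<close>.  The preimage of \<open>N\<close> is finitely generated, and the
  images of its generators generate \<open>N\<close>.
\<close>

lemma (in cat_algebra) submodule_of_finitely_generated:
  fixes P :: "('a, 'p, 'y) functr_scheme"
  assumes noeth: "\<And>N :: ('a, nat \<Rightarrow> 'a) functr.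
      cat_module C A N \<Longrightarrow> finitely_generated C A N \<Longrightarrow> noetherian_module C A N"
    and P: "cat_module C A P" and G: "finite G" "G \<subseteq> gens C P"
    and N: "cat_submodule C A P N" "\<And>S. S \<in> objs C \<Longrightarrow> N S \<subseteq> cat_span C A P G S"
  obtains G' where "finite G'" "\<And>n q. (n, q) \<in> G' \<Longrightarrow> q \<in> N (interval_obj C n)"
    "\<And>S. S \<in> objs C \<Longrightarrow> N S \<subseteq> cat_span C A P G' S"
proof -
  interpret P: cat_module C A P by (rule P)
  define V where "V = {(i, \<epsilon>). i \<in> G \<and> (\<exists>T \<in> objs C. \<epsilon> \<in> mor (interval_obj C (fst i)) T)}"
  have "countable (\<Union>i \<in> G. Pair i ` {\<epsilon>. \<exists>T \<in> objs C. \<epsilon> \<in> mor (interval_obj C (fst i)) T})"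
    by (rule countable_UN[OF countable_finite[OF G(1)] countable_image[OF countable_morphisms[OF interval_obj_objs]]])
  also have "(\<Union>i \<in> G. Pair i ` {\<epsilon>. \<exists>T \<in> objs C. \<epsilon> \<in> mor (interval_obj C (fst i)) T}) = V"
    by (auto simp: V_def)
  finally have inj: "inj_on (to_nat_on V) V" by (rule inj_on_to_nat_on)
  interpret F: coded_generators K C A G "\<lambda>i. interval_obj C (fst i)" "to_nat_on V"
    by unfold_locales (use interval_obj_objs inj in \<open>auto simp: V_def\<close>)
  define F :: "('a, nat \<Rightarrow> 'a) functr" where "F = \<lparr>Obj = F.FObj, Map = F.FMap\<rparr>"
  have F: "Obj F = F.FObj" "Map F = F.FMap" by (simp_all add: F_def)
  have Fmod: "cat_module C A F" by (rule F.free_cat_module[OF F])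
  have "noetherian_module C A F"
    by (rule noeth[OF Fmod F.finitely_generated_free[OF F G(1), where n = fst]]) simp
  have v: "snd i \<in> carrier (Obj P (interval_obj C (fst i)))" if "i \<in> G" for i
    using that G(2) by (auto simp: gens_def)
  define f where "f = F.ext P snd"
  have f: "cat_hom C A F P f"
    unfolding cat_hom_def f_def F
    using F.ext_linear[OF P v] F.ext_natural[OF P v] by simp
  define N' where "N' S = {x \<in> carrier (Obj F S). f S x \<in> N S}" for S
  have N': "cat_submodule C A F N'"
    unfolding N'_def by (rule cat_submodule_vimage[OF Fmod P f N(1)])
  have "finitely_generated C A (restrict_functor F N')"
    using \<open>noetherian_module C A F\<close> N' by (simp add: noetherian_module_def)
  then obtain G0 where G0: "finite G0" "G0 \<subseteq> gens C (restrict_functor F N')"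
    and gen: "\<forall>H. cat_submodule C A (restrict_functor F N') H \<longrightarrow>
      (\<forall>n q. (n, q) \<in> G0 \<longrightarrow> q \<in> H (interval_obj C n)) \<longrightarrow>
      (\<forall>S \<in> objs C. H S = carrier (Obj (restrict_functor F N') S))"
    by (rule finitely_generatedE)
  have G0N: "q \<in> N' (interval_obj C n)" if "(n, q) \<in> G0" for n q
    using that G0(2) by (auto simp: gens_def restrict_functor_def)
  define G' where "G' = (\<lambda>(n, q). (n, f (interval_obj C n) q)) ` G0"
  have G'N: "q \<in> N (interval_obj C n)" if "(n, q) \<in> G'" for n q
    using that G0N by (auto simp: G'_def N'_def)
  then have G'P: "G' \<subseteq> gens C P"
    using cat_submodule_carrier[OF N(1) interval_obj_objs] by (auto simp: gens_def)
  have span: "cat_submodule C A P (cat_span C A P G')"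
    by (rule P.cat_span_submodule[OF cat_algebra_axioms G'P])
  define H where "H S = N' S \<inter> {x \<in> carrier (Obj F S). f S x \<in> cat_span C A P G' S}" for S
  have HF: "cat_submodule C A F H"
    unfolding H_def by (rule cat_submodule_Int[OF Fmod N' cat_submodule_vimage[OF Fmod P f span]])
  have "cat_submodule C A (restrict_functor F N') H"
  proof (rule cat_submoduleI)
    show "submodule (H S) (Obj A S) (Obj (restrict_functor F N') S)" if S: "S \<in> objs C" for S
      using submodule_restrict[OF cat_module.module_Obj[OF Fmod S] cat_submoduleD(1)[OF N' S]
          cat_submoduleD(1)[OF HF S]]
      by (simp add: restrict_functor_def H_def)
  qed (simp add: restrict_functor_def cat_submoduleD(2)[OF HF])
  moreover have "q \<in> H (interval_obj C n)" if nq: "(n, q) \<in> G0" for n q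
  proof -
    from nq have "(n, f (interval_obj C n) q) \<in> G'" by (auto simp: G'_def intro!: rev_image_eqI)
    then have "f (interval_obj C n) q \<in> cat_span C A P G' (interval_obj C n)"
      by (rule P.cat_span_incl[OF G'P])
    moreover have "q \<in> N' (interval_obj C n)" by (rule G0N[OF nq])
    ultimately show "q \<in> H (interval_obj C n)"
      using cat_submodule_carrier[OF N' interval_obj_objs] by (simp add: H_def)
  qed
  ultimately have HN: "H S = N' S" if "S \<in> objs C" for S
    using gen that by (simp add: restrict_functor_def)
  have "N S \<subseteq> cat_span C A P G' S" if S: "S \<in> objs C" for S
  proof
    fix x assume x: "x \<in> N S"
    have "cat_span C A P G S \<subseteq> f S ` carrier (Obj F S)"
    proof (rule P.cat_span_least[OF cat_submodule_image[OF Fmod P f cat_submodule_full[OF Fmod]] _ S])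
      fix n q assume nq: "(n, q) \<in> G"
      let ?J = "interval_obj C n"
      have "f ?J (F.gen (n, q)) = Map P ?J ?J (id_mor ?J) q"
        using F.ext_e[OF P v nq, of ?J "id_mor ?J"] interval_obj_objs id_mor_closed[OF interval_obj_objs, of C n]
        by (simp add: f_def F.gen_def)
      also have "\<dots> = q" using v[OF nq] by (simp add: P.Map_id[OF interval_obj_objs])
      finally show "q \<in> f ?J ` carrier (Obj F ?J)" using F.gen_closed[OF nq] by (auto simp: F intro!: rev_image_eqI)
    qed
    then obtain y where y: "y \<in> carrier (Obj F S)" "x = f S y" using x N(2)[OF S] by blast
    then have "y \<in> H S" using x HN[OF S] by (simp add: N'_def)
    then show "x \<in> cat_span C A P G' S" using y(2) by (simp add: H_def)
  qed
  moreover have "finite G'" using G0(1) by (simp add: G'_def)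
  ultimately show ?thesis using that[of G'] G'N by blast
qed

section \<open>Finitely generated submodules of a resolution\<close>

text \<open>
  The span of \<open>Gs n\<close> meets the image of \<open>d\<close> in a finitely generated submodule; \<open>Gs (n + 1)\<close> consists
  of preimages of its generators, and \<open>Gs 0\<close> of preimages of the generators of \<open>M\<close>.
\<close>

lemma (in cat_algebra) exact_sequence_generators:
  fixes P :: "nat \<Rightarrow> ('a, 'p, 'y) functr_scheme" and M :: "('a, 'm, 'w) functr_scheme"
  assumes noeth: "\<And>N :: ('a, nat \<Rightarrow> 'a) functr.
      cat_module C A N \<Longrightarrow> finitely_generated C A N \<Longrightarrow> noetherian_module C A N"
    and P: "\<And>n. cat_module C A (P n)" and M: "cat_module C A M"
    and d: "\<And>n. cat_hom C A (P (Suc n)) (P n) (d n)" and aug: "cat_hom C A (P 0) M aug"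
    and onto: "\<And>S. S \<in> objs C \<Longrightarrow> aug S ` carrier (Obj (P 0) S) = carrier (Obj M S)"
    and fg: "finitely_generated C A M"
  shows "\<exists>Gs. (\<forall>n. finite (Gs n) \<and> Gs n \<subseteq> gens C (P n)) \<and>
    (\<forall>S \<in> objs C. aug S ` cat_span C A (P 0) (Gs 0) S = carrier (Obj M S)) \<and>
    (\<forall>n. \<forall>S \<in> objs C. cat_span C A (P n) (Gs n) S \<inter> d n S ` carrier (Obj (P (Suc n)) S)
      \<subseteq> d n S ` cat_span C A (P (Suc n)) (Gs (Suc n)) S)"
proof -
  have lift: "\<exists>L. finite L \<and> L \<subseteq> gens C Q \<and>
      (\<forall>S \<in> objs C. cat_span C A N G S \<subseteq> f S ` cat_span C A Q L S)"
    if Q: "cat_module C A Q" and N: "cat_module C A N" and f: "cat_hom C A Q N f" and fin: "finite G"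
      and G: "\<And>n q. (n, q) \<in> G \<Longrightarrow> q \<in> f (interval_obj C n) ` carrier (Obj Q (interval_obj C n))"
    for Q :: "('a, 'p, 'y) functr_scheme" and N :: "('a, 'n, 'v) functr_scheme" and f G
  proof -
    define l where "l n q = (SOME y. y \<in> carrier (Obj Q (interval_obj C n)) \<and> f (interval_obj C n) y = q)" for n q
    have l: "l n q \<in> carrier (Obj Q (interval_obj C n)) \<and> f (interval_obj C n) (l n q) = q" if "(n, q) \<in> G" for n q
    proof -
      obtain y where "y \<in> carrier (Obj Q (interval_obj C n)) \<and> f (interval_obj C n) y = q"
        using G[OF \<open>(n, q) \<in> G\<close>] by auto
      then show ?thesis unfolding l_def by (rule someI)
    qed
    define L where "L = (\<lambda>(n, q). (n, l n q)) ` G"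
    have L: "L \<subseteq> gens C Q" using l by (auto simp: L_def gens_def)
    have "cat_span C A N G S \<subseteq> f S ` cat_span C A Q L S" if S: "S \<in> objs C" for S
    proof (rule cat_module.cat_span_least[OF N cat_submodule_image[OF Q N f
            cat_module.cat_span_submodule[OF Q cat_algebra_axioms L]] _ S])
      fix n q assume nq: "(n, q) \<in> G"
      then have "(n, l n q) \<in> L" by (auto simp: L_def intro!: rev_image_eqI)
      then have "l n q \<in> cat_span C A Q L (interval_obj C n)" by (rule cat_module.cat_span_incl[OF Q L])
      then show "q \<in> f (interval_obj C n) ` cat_span C A Q L (interval_obj C n)"
        using l[OF nq] by (auto intro!: rev_image_eqI)
    qed
    with fin L show ?thesis by (intro exI[of _ L]) (simp add: L_def)
  qed
  obtain G0 where G0: "finite G0" "G0 \<subseteq> gens C M"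
    and full: "\<forall>N. cat_submodule C A M N \<longrightarrow> (\<forall>n q. (n, q) \<in> G0 \<longrightarrow> q \<in> N (interval_obj C n)) \<longrightarrow>
      (\<forall>S \<in> objs C. N S = carrier (Obj M S))"
    using fg by (rule finitely_generatedE)
  have base: "\<exists>L. finite L \<and> L \<subseteq> gens C (P 0) \<and> (\<forall>S \<in> objs C. cat_span C A M G0 S \<subseteq> aug S ` cat_span C A (P 0) L S)"
    by (rule lift[OF P M aug G0(1)]) (use G0(2) onto[OF interval_obj_objs] in \<open>auto simp: gens_def\<close>)
  have span0: "cat_span C A M G0 S = carrier (Obj M S)" if "S \<in> objs C" for S
    using full cat_module.cat_span_submodule[OF M cat_algebra_axioms G0(2)]
      cat_module.cat_span_incl[OF M G0(2)] that by simp
  have step: "\<exists>L. (finite L \<and> L \<subseteq> gens C (P (Suc n))) \<and>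
      (\<forall>S \<in> objs C. cat_span C A (P n) G S \<inter> d n S ` carrier (Obj (P (Suc n)) S)
        \<subseteq> d n S ` cat_span C A (P (Suc n)) L S)"
    if G: "finite G \<and> G \<subseteq> gens C (P n)" for n G
  proof -
    let ?N = "\<lambda>S. cat_span C A (P n) G S \<inter> d n S ` carrier (Obj (P (Suc n)) S)"
    have N: "cat_submodule C A (P n) ?N"
      by (rule cat_submodule_Int[OF P cat_module.cat_span_submodule[OF P cat_algebra_axioms]
            cat_submodule_image[OF P P d cat_submodule_full[OF P]]]) (use G in simp)
    obtain G' where G': "finite G'" "\<And>m q. (m, q) \<in> G' \<Longrightarrow> q \<in> ?N (interval_obj C m)"
      "\<And>S. S \<in> objs C \<Longrightarrow> ?N S \<subseteq> cat_span C A (P n) G' S"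
      by (rule submodule_of_finitely_generated[OF noeth P _ _ N]) (use G in auto)
    have "\<exists>L. finite L \<and> L \<subseteq> gens C (P (Suc n)) \<and>
        (\<forall>S \<in> objs C. cat_span C A (P n) G' S \<subseteq> d n S ` cat_span C A (P (Suc n)) L S)"
      by (rule lift[OF P P d G'(1)]) (use G'(2) in blast)
    then obtain L where L: "finite L" "L \<subseteq> gens C (P (Suc n))"
      "\<And>S. S \<in> objs C \<Longrightarrow> cat_span C A (P n) G' S \<subseteq> d n S ` cat_span C A (P (Suc n)) L S" by auto
    show ?thesis
      by (rule exI[of _ L], intro conjI ballI L(1,2) subset_trans[OF G'(3) L(3)])
  qed
  define Q where "Q n L L' \<longleftrightarrow> (\<forall>S \<in> objs C. cat_span C A (P n) L S \<inter> d n S ` carrier (Obj (P (Suc n)) S)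
        \<subseteq> d n S ` cat_span C A (P (Suc n)) L' S)" for n L L'
  obtain L0 where L0: "finite L0" "L0 \<subseteq> gens C (P 0)"
    "\<And>S. S \<in> objs C \<Longrightarrow> cat_span C A M G0 S \<subseteq> aug S ` cat_span C A (P 0) L0 S" using base by auto
  have "\<exists>Gs. \<forall>n. ((finite (Gs n) \<and> Gs n \<subseteq> gens C (P n)) \<and> (n = 0 \<longrightarrow> Gs n = L0)) \<and> Q n (Gs n) (Gs (Suc n))"
    by (rule dependent_nat_choice) (use L0 step in \<open>auto simp: Q_def\<close>)
  then obtain Gs where
    *: "\<forall>n. ((finite (Gs n) \<and> Gs n \<subseteq> gens C (P n)) \<and> (n = 0 \<longrightarrow> Gs n = L0)) \<and> Q n (Gs n) (Gs (Suc n))"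
    by (rule exE)
  have Gs: "finite (Gs n)" "Gs n \<subseteq> gens C (P n)" "Gs 0 = L0" "Q n (Gs n) (Gs (Suc n))" for n
    using * by simp_all
  have "aug S ` cat_span C A (P 0) (Gs 0) S = carrier (Obj M S)" if S: "S \<in> objs C" for S
  proof
    have "cat_span C A (P 0) (Gs 0) S \<subseteq> carrier (Obj (P 0) S)"
      by (rule submodule_subset[OF cat_submoduleD(1)[OF cat_module.cat_span_submodule[OF P cat_algebra_axioms Gs(2)] S]])
    then show "aug S ` cat_span C A (P 0) (Gs 0) S \<subseteq> carrier (Obj M S)" using onto[OF S] by blast
    show "carrier (Obj M S) \<subseteq> aug S ` cat_span C A (P 0) (Gs 0) S" using L0(3)[OF S] span0[OF S] Gs(3) by simp
  qed
  then show ?thesis using Gs(1,2,4) by (intro exI[of _ Gs]) (simp add: Q_def)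
qed

section \<open>Graded free modules\<close>

lemma (in graded_group) G_finsum: "(\<And>i. i \<in> I \<Longrightarrow> f i \<in> G d) \<Longrightarrow> finsum M f I \<in> G d"
proof (induction I rule: infinite_finite_induct)
  case (insert i I)
  then have "f i \<in> carrier M" "f \<in> I \<rightarrow> carrier M" using G_subset by auto
  then show ?case using insert by (simp add: G_add)
qed (simp_all add: G_zero)

lemma (in graded_group) G_inv: "x \<in> G d \<Longrightarrow> \<ominus> x \<in> G d"
  using subgroup.m_inv_closed[OF G_subgroup, of x d] by (simp add: a_inv_def)

lemma ex1_equation_cong:
  assumes "\<exists>!c. c \<in> Z \<and> x = f c" "\<And>c. c \<in> Z \<Longrightarrow> g c = f c"
  shows "\<exists>!c. c \<in> Z \<and> x = g c"
  using assms by metis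

text \<open>
  In \<^const>\<open>graded_free\<close> a basis is indexed by triples \<open>(D, b, \<epsilon>)\<close>, here it is indexed by codes.
\<close>

lemma (in cring) free_module_reindex:
  assumes \<beta>: "bij_betw \<beta> Y X" and x: "x \<in> carrier (free_module R X)"
  shows "\<exists>!c. c \<in> carrier (free_module R Y) \<and> x = lin_comb R (free_module R X) (\<lambda>y. free_gen R (\<beta> y)) c"
proof -
  interpret FX: module R "free_module R X" by (rule free_module_module)
  interpret FY: module R "free_module R Y" by (rule free_module_module)
  define \<gamma> where "\<gamma> = inv_into Y \<beta>"
  have \<beta>X: "\<beta> y \<in> X" "\<gamma> (\<beta> y) = y" if "y \<in> Y" for y
    using \<beta> that by (auto simp: bij_betw_def \<gamma>_def)
  have \<gamma>Y: "\<gamma> z \<in> Y" "\<beta> (\<gamma> z) = z" if "z \<in> X" for z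
    using \<beta> that by (auto simp: bij_betw_def \<gamma>_def inv_into_into f_inv_into_f)
  let ?f = "lin_comb R (free_module R X) (\<lambda>y. free_gen R (\<beta> y))"
  let ?g = "lin_comb R (free_module R Y) (\<lambda>z. free_gen R (\<gamma> z))"
  have pf: "(\<lambda>y. free_gen R (\<beta> y)) \<in> Y \<rightarrow> carrier (free_module R X)" by (auto intro!: free_gen_closed \<beta>X)
  have pg: "(\<lambda>z. free_gen R (\<gamma> z)) \<in> X \<rightarrow> carrier (free_module R Y)" by (auto intro!: free_gen_closed \<gamma>Y)
  note lf = FX.lin_comb_linear[OF pf] note lg = FY.lin_comb_linear[OF pg]
  have fg: "?f (?g u) = u" if "u \<in> carrier (free_module R X)" for u
    by (rule FX.free_module_linear_eq[OF linear_comp[OF lg lf] linear_id _ that])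
      (simp add: FY.lin_comb_free_gen[OF _ pg] FX.lin_comb_free_gen[OF _ pf] \<gamma>Y)
  have gf: "?g (?f c) = c" if "c \<in> carrier (free_module R Y)" for c
    by (rule FY.free_module_linear_eq[OF linear_comp[OF lf lg] linear_id _ that])
      (simp add: FY.lin_comb_free_gen[OF _ pg] FX.lin_comb_free_gen[OF _ pf] \<beta>X)
  show ?thesis
  proof (rule ex1I[of _ "?g x"])
    show "?g x \<in> carrier (free_module R Y) \<and> x = ?f (?g x)"
      using fg[OF x] linear_mapD(1)[OF lg x] by simp
  qed (use gf in auto)
qed

lemma (in standard_graded_algebra) A_graded: "S \<in> objs C \<Longrightarrow> graded_group (Obj A S) (Gr A S)"
  by (intro graded_group.intro graded_group_axioms.intro Gr_grading)
    (simp_all add: ring.is_abelian_group cring.axioms(1) Obj_cring)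

lemma (in standard_graded_algebra) one_Gr_0:
  assumes "S \<in> objs C" shows "\<one>\<^bsub>Obj A S\<^esub> \<in> Gr A S 0"
proof -
  interpret al: algebra K "Obj A S" by (rule algebra_Obj[OF assms])
  have "\<one>\<^bsub>K\<^esub> \<odot>\<^bsub>Obj A S\<^esub> \<one>\<^bsub>Obj A S\<^esub> \<in> Gr A S 0"
    using Gr_0[OF assms] al.R.one_closed by (metis bij_betw_apply)
  then show ?thesis using al.smult_one[OF al.one_closed] by simp
qed

lemma (in standard_graded_algebra) one_not_zero:
  assumes "S \<in> objs C" "\<one>\<^bsub>K\<^esub> \<noteq> \<zero>\<^bsub>K\<^esub>" shows "\<one>\<^bsub>Obj A S\<^esub> \<noteq> \<zero>\<^bsub>Obj A S\<^esub>"
proof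
  interpret al: algebra K "Obj A S" by (rule algebra_Obj[OF assms(1)])
  assume "\<one>\<^bsub>Obj A S\<^esub> = \<zero>\<^bsub>Obj A S\<^esub>"
  then have "\<one>\<^bsub>K\<^esub> \<odot>\<^bsub>Obj A S\<^esub> \<one>\<^bsub>Obj A S\<^esub> = \<zero>\<^bsub>K\<^esub> \<odot>\<^bsub>Obj A S\<^esub> \<one>\<^bsub>Obj A S\<^esub>" by simp
  then show False
    using inj_onD[OF bij_betw_imp_inj_on[OF Gr_0[OF assms(1)]]] al.R.one_closed al.R.zero_closed assms(2)
    by metis
qed

locale graded_generators = standard_graded_algebra K C A + coded_generators K C A I D code
  for K :: "'k ring" and C and A :: "('k, 'a) gfunctr" and I :: "'i set" and D and code :: "'i \<times> (nat \<Rightarrow> nat) \<Rightarrow> 'x" +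
  fixes deg :: "'i \<Rightarrow> int"
  assumes nontrivial: "\<one>\<^bsub>K\<^esub> \<noteq> \<zero>\<^bsub>K\<^esub>"
begin

definition zdeg :: "'x \<Rightarrow> int" where
  "zdeg z = deg (fst (dec z))"

definition FGr :: "obj \<Rightarrow> int \<Rightarrow> ('x \<Rightarrow> 'a) set" where
  "FGr T d = {f \<in> carrier (FObj T). \<forall>z. f z \<in> Gr A T (d - zdeg z)}"

definition graded_free_module :: "('a, 'x \<Rightarrow> 'a) gfunctr" where
  "graded_free_module = \<lparr>Obj = FObj, Map = FMap, Gr = FGr\<rparr>"

lemma graded_free_module_simps:
  "Obj graded_free_module = FObj" "Map graded_free_module = FMap" "Gr graded_free_module = FGr"
  by (simp_all add: graded_free_module_def)

lemma zdeg_push: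
  assumes "S \<in> objs C" "T \<in> objs C" "\<eta> \<in> mor S T" "z \<in> X S" shows "zdeg (push \<eta> z) = zdeg z"
proof -
  obtain i \<epsilon> where i: "i \<in> I" "\<epsilon> \<in> mor (D i) S" "z = code (i, \<epsilon>)" using assms(4) by (rule X_E)
  have "comp_mor (D i) \<eta> \<epsilon> \<in> mor (D i) T" by (rule comp_mor_closed[OF D_objs[OF i(1)] i(2) assms(3)])
  then show ?thesis
    unfolding i(3) push_code[OF i(1) assms(1) i(2)]
    using dec_code[OF i(1) assms(2)] dec_code[OF i(1) assms(1) i(2)] by (simp add: zdeg_def)
qed

lemma e_FGr:
  assumes "T \<in> objs C" "z \<in> X T" shows "e T z \<in> FGr T (zdeg z)"
  using one_Gr_0[OF assms(1)] graded_group.G_zero[OF A_graded[OF assms(1)]] e_closed[OF assms]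
  by (auto simp: FGr_def free_gen_def)

text \<open>
  The coefficient at \<open>z\<close> of the component of degree \<open>d\<close> has degree \<open>d - zdeg z\<close>.  Both existence and
  uniqueness are read off coefficientwise, after reindexing the sum over degrees by \<open>zdeg z\<close>.
\<close>

lemma FGr_grading:
  assumes T: "T \<in> objs C" shows "grading (FObj T) (FGr T)"
proof -
  interpret R: cring "Obj A T" by (rule Obj_cring[OF T])
  interpret R: graded_group "Obj A T" "Gr A T" by (rule A_graded[OF T])
  interpret F: module "Obj A T" "FObj T" by (rule FObj_module[OF T])
  have fin: "finsum (FObj T) c J z = finsum (Obj A T) (\<lambda>d. c d z) J" if "\<And>d. c d \<in> carrier (FObj T)"
    for c :: "int \<Rightarrow> _" and J z
    by (rule additive_finsum[OF F.M.abelian_group_axioms R.abelian_group_axioms, where f = "\<lambda>f. f z"])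
      (use that in \<open>auto simp: FObj_def free_module_simps dest: free_moduleD(1)\<close>)
  have "subgroup (FGr T d) (add_monoid (FObj T))" for d
  proof (rule F.M.add.subgroupI)
    show "FGr T d \<subseteq> carrier (FObj T)" by (auto simp: FGr_def)
    have "\<zero>\<^bsub>FObj T\<^esub> \<in> FGr T d" using R.G_zero F.M.zero_closed by (simp add: FGr_def FObj_def free_module_simps)
    then show "FGr T d \<noteq> {}" by auto
    show "\<ominus>\<^bsub>FObj T\<^esub> f \<in> FGr T d" if f: "f \<in> FGr T d" for f
    proof -
      have fc: "f \<in> carrier (FObj T)" using f by (simp add: FGr_def)
      then have "\<ominus>\<^bsub>FObj T\<^esub> f = (\<lambda>x. \<ominus>\<^bsub>Obj A T\<^esub> f x)"
        unfolding FObj_def by (rule R.free_module_a_inv)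
      then show ?thesis using f F.M.a_inv_closed[OF fc] R.G_inv by (simp add: FGr_def)
    qed
    show "f \<oplus>\<^bsub>FObj T\<^esub> f' \<in> FGr T d" if "f \<in> FGr T d" "f' \<in> FGr T d" for f f'
    proof -
      have "f \<oplus>\<^bsub>FObj T\<^esub> f' \<in> carrier (FObj T)" using that by (simp add: FGr_def)
      moreover have "f \<oplus>\<^bsub>FObj T\<^esub> f' = (\<lambda>x. f x \<oplus>\<^bsub>Obj A T\<^esub> f' x)" by (simp add: FObj_def free_module_simps)
      ultimately show ?thesis using that R.G_add by (simp add: FGr_def)
    qed
  qed
  moreover have "\<exists>!c. (\<forall>d. c d \<in> FGr T d) \<and> finite {d. c d \<noteq> \<zero>\<^bsub>FObj T\<^esub>} \<and>
      f = finsum (FObj T) c {d. c d \<noteq> \<zero>\<^bsub>FObj T\<^esub>}" if f: "f \<in> carrier (FObj T)" for f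
  proof -
    note fd = free_moduleD[OF f[unfolded FObj_def]]
    define h where "h z = hcomp (Obj A T) (Gr A T) (f z)" for z
    have h: "h z d \<in> Gr A T d" "h z d \<in> carrier (Obj A T)" "finite {d. h z d \<noteq> \<zero>\<^bsub>Obj A T\<^esub>}" for z d
      using R.hcomp_props(1,2)[OF fd(1)] R.hcomp_closed[OF fd(1)] by (simp_all add: h_def)
    have h0: "h z d = \<zero>\<^bsub>Obj A T\<^esub>" if "f z = \<zero>\<^bsub>Obj A T\<^esub>" for z d
      using R.hcomp_zero[of d] that by (simp add: h_def)
    define c where "c d z = h z (d - zdeg z)" for d z
    have cc: "c d \<in> carrier (FObj T)" for d
      unfolding FObj_def
    proof (rule free_moduleI)
      have "{z. c d z \<noteq> \<zero>\<^bsub>Obj A T\<^esub>} \<subseteq> {z. f z \<noteq> \<zero>\<^bsub>Obj A T\<^esub>}" using h0 by (auto simp: c_def)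
      then show "finite {z. c d z \<noteq> \<zero>\<^bsub>Obj A T\<^esub>}" using fd(3) by (rule finite_subset)
      show "c d z \<in> carrier (Obj A T)" for z using h by (simp add: c_def)
      show "z \<in> X T" if "c d z \<noteq> \<zero>\<^bsub>Obj A T\<^esub>" for z
        using that h0[of z "d - zdeg z"] fd(2)[of z] by (auto simp: c_def)
    qed
    have cG: "c d \<in> FGr T d" for d using cc h(1) by (simp add: FGr_def c_def)
    \<comment> \<open>All degrees in which some coefficient contributes; finite, so that sums over it are meaningful.\<close>
    define J where "J = (\<Union>z \<in> {z. f z \<noteq> \<zero>\<^bsub>Obj A T\<^esub>}. (\<lambda>d. d + zdeg z) ` {d. h z d \<noteq> \<zero>\<^bsub>Obj A T\<^esub>})"
    have J: "finite J" unfolding J_def using fd(3) h(3) by blast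
    have cJ: "d \<in> J" if "c d z \<noteq> \<zero>\<^bsub>Obj A T\<^esub>" for d z
    proof -
      have "f z \<noteq> \<zero>\<^bsub>Obj A T\<^esub>" using that h0 by (auto simp: c_def)
      moreover have "d - zdeg z + zdeg z \<in> (\<lambda>d. d + zdeg z) ` {d. h z d \<noteq> \<zero>\<^bsub>Obj A T\<^esub>}"
        by (rule imageI) (use that in \<open>simp add: c_def\<close>)
      ultimately show ?thesis by (auto simp: J_def)
    qed
    have cJ': "{d. c d \<noteq> \<zero>\<^bsub>FObj T\<^esub>} \<subseteq> J"
      using cJ by (auto simp: FObj_def free_module_simps fun_eq_iff)
    have shift: "finsum (Obj A T) (\<lambda>d. g (d - s)) J' = finsum (Obj A T) g ((\<lambda>d. d - s) ` J')"
      if "\<And>d. g d \<in> carrier (Obj A T)" for g :: "int \<Rightarrow> 'a" and s J'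
      by (rule R.finsum_reindex[symmetric]) (use that in \<open>auto simp: inj_on_def\<close>)
    have sumz: "f z = finsum (Obj A T) (\<lambda>d. c d z) J" for z
    proof -
      have "finsum (Obj A T) (\<lambda>d. c d z) J = finsum (Obj A T) (h z) ((\<lambda>d. d - zdeg z) ` J)"
        unfolding c_def by (rule shift) (rule h)
      also have "\<dots> = f z"
      proof (unfold h_def, rule R.hcomp_sum[OF fd(1), symmetric])
        show "finite ((\<lambda>d. d - zdeg z) ` J)" using J by simp
        show "{d. hcomp (Obj A T) (Gr A T) (f z) d \<noteq> \<zero>\<^bsub>Obj A T\<^esub>} \<subseteq> (\<lambda>d. d - zdeg z) ` J"
        proof
          fix d assume "d \<in> {d. hcomp (Obj A T) (Gr A T) (f z) d \<noteq> \<zero>\<^bsub>Obj A T\<^esub>}"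
          then have "c (d + zdeg z) z \<noteq> \<zero>\<^bsub>Obj A T\<^esub>" by (simp add: c_def h_def)
          then show "d \<in> (\<lambda>d. d - zdeg z) ` J" using cJ by (intro rev_image_eqI[of "d + zdeg z"]) auto
        qed
      qed
      finally show ?thesis ..
    qed
    have sum: "f = finsum (FObj T) c J" using sumz fin[OF cc] by (simp add: fun_eq_iff)
    have supp: "finsum (FObj T) b {d. b d \<noteq> \<zero>\<^bsub>FObj T\<^esub>} = finsum (FObj T) b J'"
      if "finite J'" "{d. b d \<noteq> \<zero>\<^bsub>FObj T\<^esub>} \<subseteq> J'" "\<And>d. b d \<in> carrier (FObj T)" for b :: "int \<Rightarrow> _" and J'
      by (rule F.M.add.finprod_mono_neutral_cong_left) (use that in auto)
    show ?thesis
    proof (rule ex1I[of _ c])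
      show "(\<forall>d. c d \<in> FGr T d) \<and> finite {d. c d \<noteq> \<zero>\<^bsub>FObj T\<^esub>} \<and>
          f = finsum (FObj T) c {d. c d \<noteq> \<zero>\<^bsub>FObj T\<^esub>}"
        using cG finite_subset[OF cJ' J] sum supp[OF J cJ' cc] by simp
      fix b assume b: "(\<forall>d. b d \<in> FGr T d) \<and> finite {d. b d \<noteq> \<zero>\<^bsub>FObj T\<^esub>} \<and>
          f = finsum (FObj T) b {d. b d \<noteq> \<zero>\<^bsub>FObj T\<^esub>}"
      let ?J = "{d. b d \<noteq> \<zero>\<^bsub>FObj T\<^esub>}"
      have bc: "b d \<in> carrier (FObj T)" and bG: "b d z \<in> Gr A T (d - zdeg z)" for d z
        using b by (auto simp: FGr_def)
      have bR: "b d z \<in> carrier (Obj A T)" for d z by (rule R.G_subset[OF bG])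
      have "h z = (\<lambda>d. b (d + zdeg z) z)" for z
        unfolding h_def
      proof (rule R.hcomp_eqI[where D = "(\<lambda>d. d - zdeg z) ` ?J"])
        show "b (d + zdeg z) z \<in> Gr A T d" for d using bG[of "d + zdeg z" z] by simp
        show "finite ((\<lambda>d. d - zdeg z) ` ?J)" using b by simp
        show "{d. b (d + zdeg z) z \<noteq> \<zero>\<^bsub>Obj A T\<^esub>} \<subseteq> (\<lambda>d. d - zdeg z) ` ?J"
        proof
          fix d assume "d \<in> {d. b (d + zdeg z) z \<noteq> \<zero>\<^bsub>Obj A T\<^esub>}"
          then have "d + zdeg z \<in> ?J" by (auto simp: FObj_def free_module_simps fun_eq_iff)
          then show "d \<in> (\<lambda>d. d - zdeg z) ` ?J" by (intro rev_image_eqI[of "d + zdeg z"]) auto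
        qed
        have "f z = finsum (FObj T) b ?J z" using b by simp
        also have "\<dots> = finsum (Obj A T) (\<lambda>d. b (d - zdeg z + zdeg z) z) ?J" using fin[OF bc] by simp
        also have "\<dots> = finsum (Obj A T) (\<lambda>d. b (d + zdeg z) z) ((\<lambda>d. d - zdeg z) ` ?J)"
          by (rule shift) (rule bR)
        finally show "f z = finsum (Obj A T) (\<lambda>d. b (d + zdeg z) z) ((\<lambda>d. d - zdeg z) ` ?J)" .
      qed
      then show "b = c" by (simp add: c_def fun_eq_iff)
    qed
  qed
  ultimately show ?thesis by (simp add: grading_def)
qed

lemma F_graded: "T \<in> objs C \<Longrightarrow> graded_group (FObj T) (FGr T)"
  using FGr_grading FObj_module by (intro graded_group.intro graded_group_axioms.intro) (auto simp: module_def)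

lemma FGr_smult:
  assumes T: "T \<in> objs C" and a: "a \<in> Gr A T d" and f: "f \<in> FGr T d'"
  shows "a \<odot>\<^bsub>FObj T\<^esub> f \<in> FGr T (d + d')"
proof -
  interpret F: module "Obj A T" "FObj T" by (rule FObj_module[OF T])
  have ac: "a \<in> carrier (Obj A T)" by (rule graded_group.G_subset[OF A_graded[OF T] a])
  have "a \<otimes>\<^bsub>Obj A T\<^esub> f z \<in> Gr A T (d + d' - zdeg z)" for z
    using Gr_mult[OF T a, of "f z" "d' - zdeg z"] f by (simp add: FGr_def algebra_simps)
  moreover have "a \<odot>\<^bsub>FObj T\<^esub> f \<in> carrier (FObj T)" using ac f by (simp add: FGr_def)
  ultimately show ?thesis by (simp add: FGr_def FObj_def free_module_simps)
qed

lemma FGr_Map: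
  assumes a: "S \<in> objs C" "T \<in> objs C" "\<eta> \<in> mor S T" and f: "f \<in> FGr S d"
  shows "FMap S T \<eta> f \<in> FGr T d"
  unfolding FMap_def lin_comb_def
proof (rule graded_group.G_finsum[OF F_graded[OF a(2)]])
  have fc: "f \<in> carrier (free_module (Obj A S) (X S))" using f by (simp add: FGr_def FObj_def)
  fix z assume "z \<in> {z. Map A S T \<eta> (f z) \<noteq> \<zero>\<^bsub>Obj A T\<^esub>}"
  then have "f z \<noteq> \<zero>\<^bsub>Obj A S\<^esub>" using Map_hom(5)[OF a] by auto
  then have z: "z \<in> X S" by (rule free_moduleD(2)[OF fc])
  have "Map A S T \<eta> (f z) \<in> Gr A T (d - zdeg z)" using Gr_Map[OF a] f by (auto simp: FGr_def)
  from FGr_smult[OF a(2) this e_FGr[OF a(2) push_closed[OF a z]]]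
  show "Map A S T \<eta> (f z) \<odot>\<^bsub>FObj T\<^esub> e T (push \<eta> z) \<in> FGr T d" by (simp add: zdeg_push[OF a z])
qed

lemma graded_free_graded_cat_module: "graded_cat_module C A graded_free_module"
proof (intro graded_cat_module.intro graded_cat_module_axioms.intro free_cat_module)
  show "Obj graded_free_module = FObj" "Map graded_free_module = FMap" by (simp_all add: graded_free_module_def)
qed (auto simp: graded_free_module_simps FGr_grading FGr_smult FGr_Map)

lemma gen_FGr:
  assumes i: "i \<in> I" shows "gen i \<in> FGr (D i) (deg i)"
proof -
  note m = id_mor_closed[OF D_objs[OF i]]
  show ?thesis
    using e_FGr[OF D_objs[OF i] X_I[OF i m]] dec_code[OF i D_objs[OF i] m] by (simp add: gen_def zdeg_def)
qed

text \<open>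
  The witness for \<^const>\<open>graded_free\<close> is the set of pairs \<open>(D i, gen i)\<close>, so different indices must not
  give the same pair; this needs \<open>1 \<noteq> 0\<close>.
\<close>

lemma gen_inj:
  assumes "i \<in> I" "j \<in> I" "D i = D j" "gen i = gen j" shows "i = j"
proof -
  have "code (i, id_mor (D i)) = code (j, id_mor (D j))"
    using assms(3,4) one_not_zero[OF D_objs[OF assms(2)] nontrivial]
    by (auto simp: gen_def free_gen_def fun_eq_iff split: if_splits)
  then have "dec (code (i, id_mor (D i))) = dec (code (j, id_mor (D j)))" by (rule arg_cong)
  then have "(i, id_mor (D i)) = (j, id_mor (D j))"
    unfolding dec_code[OF assms(1) D_objs[OF assms(1)] id_mor_closed[OF D_objs[OF assms(1)]]]
      dec_code[OF assms(2) D_objs[OF assms(2)] id_mor_closed[OF D_objs[OF assms(2)]]] .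
  then show ?thesis by (rule Pair_inject)
qed

lemma graded_free_graded_free: "graded_free C A graded_free_module"
  unfolding graded_free_def
proof (intro exI[of _ "(\<lambda>i. (D i, gen i)) ` I"] conjI ballI)
  let ?B = "(\<lambda>i. (D i, gen i)) ` I"
  show "case x of (D, b) \<Rightarrow> D \<in> objs C \<and> (\<exists>d. b \<in> Gr graded_free_module D d)" if xB: "x \<in> ?B" for x
  proof -
    obtain i where i: "i \<in> I" "x = (D i, gen i)" using xB by auto
    then show ?thesis using gen_FGr[OF i(1)] D_objs[OF i(1)] by (auto simp: graded_free_module_simps)
  qed
  fix T x assume T: "T \<in> objs C" and x: "x \<in> carrier (Obj graded_free_module T)"
  interpret R: cring "Obj A T" by (rule Obj_cring[OF T])
  interpret F: module "Obj A T" "FObj T" by (rule FObj_module[OF T])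
  let ?Y = "{(E, b, \<epsilon>). (E, b) \<in> ?B \<and> \<epsilon> \<in> mor E T}"
  define \<kappa> where "\<kappa> z = (case dec z of (i, \<epsilon>) \<Rightarrow> (D i, gen i, \<epsilon>))" for z
  have \<kappa>: "\<kappa> (code (i, \<epsilon>)) = (D i, gen i, \<epsilon>)" if "i \<in> I" "\<epsilon> \<in> mor (D i) T" for i \<epsilon>
    using dec_code[OF that(1) T that(2)] by (simp add: \<kappa>_def)
  have "bij_betw \<kappa> (X T) ?Y"
  proof (rule bij_betw_imageI)
    show "inj_on \<kappa> (X T)"
      by (rule inj_onI, elim X_E) (use gen_inj \<kappa> in auto)
    show "\<kappa> ` X T = ?Y"
    proof (intro equalityI subsetI)
      fix y assume "y \<in> \<kappa> ` X T"
      then obtain z where z: "z \<in> X T" "y = \<kappa> z" by blast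
      from z(1) obtain i \<epsilon> where i: "i \<in> I" "\<epsilon> \<in> mor (D i) T" "z = code (i, \<epsilon>)" by (rule X_E)
      then show "y \<in> ?Y" using \<kappa>[OF i(1,2)] z(2) by simp
    next
      fix y assume "y \<in> ?Y"
      then obtain i \<epsilon> where i: "i \<in> I" "\<epsilon> \<in> mor (D i) T" "y = (D i, gen i, \<epsilon>)" by auto
      then have "y = \<kappa> (code (i, \<epsilon>))" using \<kappa>[OF i(1,2)] by simp
      then show "y \<in> \<kappa> ` X T" using X_I[OF i(1,2)] by (rule image_eqI)
    qed
  qed
  then have bij: "bij_betw (inv_into (X T) \<kappa>) ?Y (X T)" by (rule bij_betw_inv_into)
  have Map: "Map graded_free_module E T \<epsilon> b = e T (inv_into (X T) \<kappa> (E, b, \<epsilon>))" if Y: "(E, b, \<epsilon>) \<in> ?Y" for E b \<epsilon>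
  proof -
    obtain i where i: "i \<in> I" "E = D i" "b = gen i" "\<epsilon> \<in> mor (D i) T" using Y by auto
    have "inv_into (X T) \<kappa> (\<kappa> (code (i, \<epsilon>))) = code (i, \<epsilon>)"
      using \<open>bij_betw \<kappa> (X T) ?Y\<close> X_I[OF i(1,4)] by (intro inv_into_f_f) (auto simp: bij_betw_def)
    then show ?thesis using FMap_gen[OF i(1) T i(4)] \<kappa>[OF i(1,4)] by (simp add: i graded_free_module_simps)
  qed
  have eq: "finsum (FObj T) (\<lambda>(E, b, \<epsilon>). c (E, b, \<epsilon>) \<odot>\<^bsub>FObj T\<^esub> Map graded_free_module E T \<epsilon> b)
      {z. c z \<noteq> \<zero>\<^bsub>Obj A T\<^esub>} = lin_comb (Obj A T) (FObj T) (\<lambda>y. e T (inv_into (X T) \<kappa> y)) c"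
    if c: "c \<in> carrier (free_module (Obj A T) ?Y)" for c
    unfolding lin_comb_def
  proof (rule F.M.finsum_cong')
    note cd = free_moduleD[OF c]
    show "(\<lambda>z. c z \<odot>\<^bsub>FObj T\<^esub> e T (inv_into (X T) \<kappa> z)) \<in> {z. c z \<noteq> \<zero>\<^bsub>Obj A T\<^esub>} \<rightarrow> carrier (FObj T)"
      using cd(1,2) bij_betw_apply[OF bij] e_closed[OF T] by auto
    fix z assume "z \<in> {z. c z \<noteq> \<zero>\<^bsub>Obj A T\<^esub>}"
    then have "z \<in> ?Y" using cd(2) by auto
    then show "(case z of (E, b, \<epsilon>) \<Rightarrow> c (E, b, \<epsilon>) \<odot>\<^bsub>FObj T\<^esub> Map graded_free_module E T \<epsilon> b) =
        c z \<odot>\<^bsub>FObj T\<^esub> e T (inv_into (X T) \<kappa> z)"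
      using Map[of "fst z" "fst (snd z)" "snd (snd z)"] by (cases z) simp
  qed simp
  have "\<exists>!c. c \<in> carrier (free_module (Obj A T) ?Y) \<and>
      x = lin_comb (Obj A T) (FObj T) (\<lambda>y. e T (inv_into (X T) \<kappa> y)) c"
    using R.free_module_reindex[OF bij] x by (simp add: FObj_def graded_free_module_simps)
  then show "\<exists>!c. c \<in> carrier (free_module (Obj A T) ?Y) \<and>
      x = finsum (Obj graded_free_module T)
        (\<lambda>(E, b, \<epsilon>). c (E, b, \<epsilon>) \<odot>\<^bsub>Obj graded_free_module T\<^esub> Map graded_free_module E T \<epsilon> b)
        {z. c z \<noteq> \<zero>\<^bsub>Obj A T\<^esub>}"
    unfolding graded_free_module_simps(1) using eq by (rule ex1_equation_cong)
qed

end

section \<open>Existence of free resolutions\<close>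

subsection \<open>Encodings by lists\<close>

text \<open>
  A prefix-free code: the first \<open>\<beta>\<close> ends the unary number \<open>n\<close>.
\<close>

definition tagged :: "'x \<Rightarrow> 'x \<Rightarrow> nat \<Rightarrow> 'x list \<Rightarrow> 'x list" where
  "tagged \<alpha> \<beta> n w = replicate n \<alpha> @ \<beta> # w"

lemma tagged_inj:
  assumes "\<alpha> \<noteq> \<beta>" "tagged \<alpha> \<beta> n w = tagged \<alpha> \<beta> m v" shows "n = m \<and> w = v"
  using assms(2)
proof (induction n arbitrary: m)
  case 0
  then show ?case using assms(1) by (cases m) (auto simp: tagged_def)
next
  case (Suc n)
  then show ?case using assms(1) by (cases m) (auto simp: tagged_def)
qed

text \<open>
  The lengths are recorded in front, since \<^const>\<open>concat\<close> alone forgets them.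
\<close>

lemma list_of_lists_encoding:
  assumes "\<alpha> \<noteq> (\<beta> :: 'x)"
  shows "inj (\<lambda>ws :: 'x list list. tagged \<alpha> \<beta> (to_nat (map length ws)) (concat ws))"
proof (rule injI)
  fix ws vs :: "'x list list"
  assume "tagged \<alpha> \<beta> (to_nat (map length ws)) (concat ws) = tagged \<alpha> \<beta> (to_nat (map length vs)) (concat vs)"
  from tagged_inj[OF assms this] have len: "map length ws = map length vs" and c: "concat ws = concat vs"
    by (auto dest: injD[OF inj_to_nat])
  from len c show "ws = vs"
  proof (induction ws arbitrary: vs)
    case (Cons w ws)
    then show ?case by (cases vs) auto
  qed simp
qed

text \<open>
  An element is determined by its finite graph, which is a list of lists over \<open>'a + 'm\<close>.  So the
  elements of one term of a resolution can serve as generators of the next term in the same type.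
\<close>

lemma free_module_encoding:
  fixes R :: "('a, 'y) ring_scheme" and \<alpha> \<beta> :: "'a + 'm"
  assumes "\<alpha> \<noteq> \<beta>"
  shows "\<exists>enc :: (('a + 'm) list \<Rightarrow> 'a) \<Rightarrow> ('a + 'm) list. inj_on enc (carrier (free_module R X))"
proof -
  define supp where "supp f = {l. f l \<noteq> \<zero>\<^bsub>R\<^esub>}" for f :: "('a + 'm) list \<Rightarrow> 'a"
  define ls where "ls f = (SOME ls. set ls = supp f)" for f
  have ls: "set (ls f) = supp f" if "f \<in> carrier (free_module R X)" for f
    unfolding ls_def using finite_list[OF free_moduleD(3)[OF that]] unfolding supp_def by (rule someI_ex)
  define tab where "tab f = map (\<lambda>l. Inl (f l) # l) (ls f)" for f
  have "inj_on tab (carrier (free_module R X))"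
  proof (rule inj_onI, rule ext)
    fix f f' l assume f: "f \<in> carrier (free_module R X)" and f': "f' \<in> carrier (free_module R X)"
      and "tab f = tab f'"
    then have "set (tab f) = set (tab f')" by simp
    then have eq: "(\<lambda>l. Inl (f l) # l) ` supp f = (\<lambda>l. Inl (f' l) # l) ` supp f'"
      using ls[OF f] ls[OF f'] by (simp add: tab_def)
    have *: "f l = f' l" if "(\<lambda>l. Inl (f l) # l) ` supp f \<subseteq> (\<lambda>l. Inl (f' l) # l) ` supp f'" "l \<in> supp f"
      for f f' :: "('a + 'm) list \<Rightarrow> 'a"
      using that by (auto simp: image_iff subset_iff)
    show "f l = f' l"
    proof (cases "l \<in> supp f \<or> l \<in> supp f'")
      case True
      then show ?thesis using *[of f f'] *[of f' f] eq by auto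
    next
      case False
      then show ?thesis by (simp add: supp_def)
    qed
  qed
  then have "inj_on ((\<lambda>ws. tagged \<alpha> \<beta> (to_nat (map length ws)) (concat ws)) \<circ> tab) (carrier (free_module R X))"
    by (rule comp_inj_on) (rule inj_on_subset[OF list_of_lists_encoding[OF assms] subset_UNIV])
  then show ?thesis by blast
qed

lemma countable_objs: "countable (objs C)"
proof (rule countable_subset)
  show "objs C \<subseteq> {S. finite S} \<times> {r. finite r}"
    by (cases C) (auto simp: order_on_defs intro: finite_subset)
  show "countable ({S :: nat set. finite S} \<times> {r :: nat rel. finite r})"
    by (intro countable_SIGMA countable_Collect_finite)
qed

subsection \<open>Free covers\<close>

lemma graded_hom_cat_hom: "graded_hom C A M N f \<Longrightarrow> cat_hom C A M N f"
  unfolding graded_hom_def cat_hom_def linear_map_def by simp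

lemma graded_hom_Gr: "\<lbrakk>graded_hom C A M N f; S \<in> objs C; x \<in> Gr M S d\<rbrakk> \<Longrightarrow> f S x \<in> Gr N S d"
  by (simp add: graded_hom_def image_subset_iff)

lemma (in graded_cat_module) M_graded: "S \<in> objs C \<Longrightarrow> graded_group (Obj M S) (Gr M S)"
  using module_Obj[of S] Gr_grading[of S]
  by (simp add: graded_group_def graded_group_axioms_def module_def)

text \<open>
  One generator for every homogeneous element.  There are only countably many objects and morphisms,
  so a number takes care of these, and \<open>enc\<close> of the element.
\<close>

lemma (in standard_graded_algebra) free_cover:
  fixes N :: "('a, 'n) gfunctr" and \<alpha> \<beta> :: 'x
  assumes nt: "\<one>\<^bsub>K\<^esub> \<noteq> \<zero>\<^bsub>K\<^esub>" and \<alpha>\<beta>: "\<alpha> \<noteq> \<beta>" and N: "graded_cat_module C A N"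
    and enc: "\<forall>S \<in> objs C. \<exists>enc :: 'n \<Rightarrow> 'x list. inj_on enc (carrier (Obj N S))"
  shows "\<exists>(F :: ('a, 'x list \<Rightarrow> 'a) gfunctr) f. graded_cat_module C A F \<and> graded_free C A F \<and>
    graded_hom C A F N f \<and> (\<forall>S \<in> objs C. f S ` carrier (Obj F S) = carrier (Obj N S)) \<and>
    (\<forall>S \<in> objs C. \<exists>Y. carrier (Obj F S) = carrier (free_module (Obj A S) Y))"
proof -
  interpret N: graded_cat_module C A N by (rule N)
  define I where "I = {(D, d, b). D \<in> objs C \<and> b \<in> Gr N D d}"
  define V where "V = {(D, d :: int, \<epsilon>). D \<in> objs C \<and> (\<exists>T \<in> objs C. \<epsilon> \<in> mor D T)}"
  have "countable (\<Union>D \<in> objs C. Pair D ` ((UNIV :: int set) \<times> {\<epsilon>. \<exists>T \<in> objs C. \<epsilon> \<in> mor D T}))"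
    using countable_morphisms by (intro countable_UN countable_objs countable_image countable_SIGMA) auto
  also have "(\<Union>D \<in> objs C. Pair D ` ((UNIV :: int set) \<times> {\<epsilon>. \<exists>T \<in> objs C. \<epsilon> \<in> mor D T})) = V"
    by (auto simp: V_def)
  finally have V: "inj_on (to_nat_on V) V" by (rule inj_on_to_nat_on)
  obtain enc where enc': "\<And>S. S \<in> objs C \<Longrightarrow> inj_on (enc S :: 'n \<Rightarrow> 'x list) (carrier (Obj N S))"
    using bchoice[of "objs C" "\<lambda>S e. inj_on (e :: 'n \<Rightarrow> 'x list) (carrier (Obj N S))"] enc by blast
  define code where "code = (\<lambda>((D, d, b), \<epsilon>). tagged \<alpha> \<beta> (to_nat_on V (D, d, \<epsilon>)) (enc D b))"
  have Nc: "b \<in> carrier (Obj N D)" if "D \<in> objs C" "b \<in> Gr N D d" for D b d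
    by (rule graded_group.G_subset[OF N.M_graded[OF that(1)] that(2)])
  have code: "inj_on code {(i, \<epsilon>). i \<in> I \<and> (\<exists>T \<in> objs C. \<epsilon> \<in> mor (fst i) T)}"
  proof (rule inj_onI)
    fix p q assume p: "p \<in> {(i, \<epsilon>). i \<in> I \<and> (\<exists>T \<in> objs C. \<epsilon> \<in> mor (fst i) T)}"
      and q: "q \<in> {(i, \<epsilon>). i \<in> I \<and> (\<exists>T \<in> objs C. \<epsilon> \<in> mor (fst i) T)}" and pq: "code p = code q"
    obtain D d b \<epsilon> where pe: "p = ((D, d, b), \<epsilon>)" by (metis surj_pair)
    obtain D' d' b' \<epsilon>' where qe: "q = ((D', d', b'), \<epsilon>')" by (metis surj_pair)
    obtain T T' where a: "(D, d, b) \<in> I" "T \<in> objs C" "\<epsilon> \<in> mor D T"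
      "(D', d', b') \<in> I" "T' \<in> objs C" "\<epsilon>' \<in> mor D' T'"
      using p q by (auto simp: pe qe)
    have eq: "code ((D, d, b), \<epsilon>) = code ((D', d', b'), \<epsilon>')" using pq by (simp add: pe qe)
    have "to_nat_on V (D, d, \<epsilon>) = to_nat_on V (D', d', \<epsilon>') \<and> enc D b = enc D' b'"
      using eq by (intro tagged_inj[OF \<alpha>\<beta>]) (simp add: code_def)
    moreover have "(D, d, \<epsilon>) \<in> V" "(D', d', \<epsilon>') \<in> V" using a by (auto simp: I_def V_def)
    ultimately have 1: "(D, d, \<epsilon>) = (D', d', \<epsilon>')" and 2: "enc D b = enc D' b'"
      by (auto dest: inj_onD[OF V, of "(D, d, \<epsilon>)" "(D', d', \<epsilon>')"])
    have D: "D \<in> objs C" "b \<in> Gr N D d" "b' \<in> Gr N D d" using a 1 by (auto simp: I_def)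
    have "b = b'" by (rule inj_onD[OF enc'[OF D(1)]]) (use 1 2 Nc[OF D(1)] D in auto)
    then show "p = q" using 1 by (simp add: pe qe)
  qed
  interpret G: graded_generators K C A I fst code "\<lambda>i. fst (snd i)"
    by unfold_locales (use code nt in \<open>auto simp: I_def\<close>)
  have Ncm: "cat_module C A N" by (rule N.cat_module_axioms)
  have v: "snd (snd i) \<in> carrier (Obj N (fst i))" if "i \<in> I" for i
    using that Nc by (auto simp: I_def)
  define f where "f = G.ext N (\<lambda>i. snd (snd i))"
  have lin: "linear_map (Obj A S) (G.FObj S) (Obj N S) (f S)" if "S \<in> objs C" for S
    unfolding f_def by (rule G.ext_linear[OF Ncm v that])
  note l = linear_mapD[OF lin]
  have fe: "f T (G.e T (code (i, \<epsilon>))) = Map N (fst i) T \<epsilon> (snd (snd i))"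
    if "i \<in> I" "T \<in> objs C" "\<epsilon> \<in> mor (fst i) T" for i T \<epsilon>
    unfolding f_def by (rule G.ext_e[OF Ncm v that])
  have gr: "f S u \<in> Gr N S d" if S: "S \<in> objs C" and u: "u \<in> G.FGr S d" for S u d
    unfolding f_def G.ext_def lin_comb_def
  proof (rule graded_group.G_finsum[OF N.M_graded[OF S]])
    fix z assume "z \<in> {z. u z \<noteq> \<zero>\<^bsub>Obj A S\<^esub>}"
    then have "z \<in> G.X S" using u by (auto simp: G.FGr_def G.FObj_def dest: free_moduleD(2))
    then obtain i \<epsilon> where i: "i \<in> I" "\<epsilon> \<in> mor (fst i) S" "z = code (i, \<epsilon>)" by (rule G.X_E)
    have D: "fst i \<in> objs C" "snd (snd i) \<in> Gr N (fst i) (fst (snd i))" using i(1) by (auto simp: I_def)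
    have "G.val N (\<lambda>i. snd (snd i)) S z = Map N (fst i) S \<epsilon> (snd (snd i))"
      unfolding i(3) by (rule G.val_code[OF Ncm v i(1) S i(2)])
    also have "\<dots> \<in> Gr N S (fst (snd i))" using N.Gr_Map[OF D(1) S i(2)] D(2) by blast
    finally have "G.val N (\<lambda>i. snd (snd i)) S z \<in> Gr N S (G.zdeg z)"
      using G.dec_code[OF i(1) S i(2)] by (simp add: G.zdeg_def i(3))
    moreover have "u z \<in> Gr A S (d - G.zdeg z)" using u by (simp add: G.FGr_def)
    ultimately show "u z \<odot>\<^bsub>Obj N S\<^esub> G.val N (\<lambda>i. snd (snd i)) S z \<in> Gr N S d"
      using N.Gr_smult[OF S, of "u z" "d - G.zdeg z" _ "G.zdeg z"] by simp
  qed
  have hom: "graded_hom C A G.graded_free_module N f"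
    unfolding graded_hom_def G.graded_free_module_simps
    using l gr G.ext_natural[OF Ncm v] unfolding f_def[symmetric] by (simp add: image_subset_iff)
  have surj: "f S ` carrier (G.FObj S) = carrier (Obj N S)" if S: "S \<in> objs C" for S
  proof
    interpret NS: graded_group "Obj N S" "Gr N S" by (rule N.M_graded[OF S])
    have im: "submodule (f S ` carrier (G.FObj S)) (Obj A S) (Obj N S)"
      by (rule submodule_image[OF lin[OF S] G.FObj_module[OF S] N.module_Obj[OF S]
            module.carrier_is_submodule[OF G.FObj_module[OF S]]])
    have hom_im: "b \<in> f S ` carrier (G.FObj S)" if b: "b \<in> Gr N S d" for b d
    proof -
      have i: "(S, d, b) \<in> I" using S b by (simp add: I_def)
      have "f S (G.e S (code ((S, d, b), id_mor S))) = b"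
        using fe[OF i S] id_mor_closed[OF S] N.Map_id[OF S Nc[OF S b]] by simp
      moreover have "G.e S (code ((S, d, b), id_mor S)) \<in> carrier (G.FObj S)"
        by (rule G.e_closed[OF S G.X_I[OF i]]) (simp add: id_mor_closed[OF S])
      ultimately show ?thesis by (metis imageI)
    qed
    show "carrier (Obj N S) \<subseteq> f S ` carrier (G.FObj S)"
    proof
      fix x assume x: "x \<in> carrier (Obj N S)"
      have "finsum (Obj N S) (hcomp (Obj N S) (Gr N S) x) {d. hcomp (Obj N S) (Gr N S) x d \<noteq> \<zero>\<^bsub>Obj N S\<^esub>}
          \<in> f S ` carrier (G.FObj S)"
        by (rule submodule_finsum[OF im N.module_Obj[OF S] hom_im[OF NS.hcomp_props(1)[OF x]]])
      then show "x \<in> f S ` carrier (G.FObj S)" using NS.hcomp_props(3)[OF x] by simp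
    qed
    show "f S ` carrier (G.FObj S) \<subseteq> carrier (Obj N S)" using l(1)[OF S] by (auto intro: l(1)[OF S])
  qed
  show ?thesis
  proof (intro exI[of _ G.graded_free_module] exI[of _ f] conjI ballI)
    show "graded_cat_module C A G.graded_free_module" by (rule G.graded_free_graded_cat_module)
    show "graded_free C A G.graded_free_module" by (rule G.graded_free_graded_free)
    show "graded_hom C A G.graded_free_module N f" by (rule hom)
    show "f S ` carrier (Obj G.graded_free_module S) = carrier (Obj N S)" if "S \<in> objs C" for S
      unfolding G.graded_free_module_simps by (rule surj[OF that])
    show "\<exists>Y. carrier (Obj G.graded_free_module S) = carrier (free_module (Obj A S) Y)" for S
      unfolding G.graded_free_module_simps G.FObj_def by (rule exI[of _ "G.X S"]) simp
  qed
qed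

subsection \<open>Kernels and resolutions\<close>

definition restrict_gfunctor :: "('a, 'm) gfunctr \<Rightarrow> (obj \<Rightarrow> 'm set) \<Rightarrow> ('a, 'm) gfunctr" where
  "restrict_gfunctor F H = \<lparr>Obj = \<lambda>S. (Obj F S)\<lparr>carrier := H S\<rparr>, Map = Map F, Gr = \<lambda>S d. Gr F S d \<inter> H S\<rparr>"

lemma restrict_gfunctor_simps:
  "Obj (restrict_gfunctor F H) S = (Obj F S)\<lparr>carrier := H S\<rparr>" "Map (restrict_gfunctor F H) = Map F"
  "Gr (restrict_gfunctor F H) S = (\<lambda>d. Gr F S d \<inter> H S)"
  by (simp_all add: restrict_gfunctor_def)

lemma (in standard_graded_algebra) restrict_gfunctor_module:
  assumes F: "graded_cat_module C A F" and H: "cat_submodule C A F H"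
    and comp: "\<And>S x d. \<lbrakk>S \<in> objs C; x \<in> H S\<rbrakk> \<Longrightarrow> hcomp (Obj F S) (Gr F S) x d \<in> H S"
  shows "graded_cat_module C A (restrict_gfunctor F H)"
proof -
  interpret F: graded_cat_module C A F by (rule F)
  note c = cat_submodule_carrier[OF H]
  have sm: "a \<odot>\<^bsub>Obj F S\<^esub> x \<in> H S" if "S \<in> objs C" "a \<in> Gr A S d" "x \<in> H S" for S a d x
    using module.submoduleE(4)[OF F.module_Obj[OF that(1)] cat_submoduleD(1)[OF H that(1)]]
      graded_group.G_subset[OF A_graded[OF that(1)] that(2)] that(3) by simp
  show ?thesis
  proof (intro graded_cat_module.intro graded_cat_module_axioms.intro cat_module.intro set_functor.intro
      cat_module_axioms.intro, unfold restrict_gfunctor_simps)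
    show "module (Obj A S) (Obj F S\<lparr>carrier := H S\<rparr>)" if "S \<in> objs C" for S
      by (rule submodule.submodule_is_module[OF cat_submoduleD(1)[OF H that] F.module_Obj[OF that]])
    show "grading (Obj F S\<lparr>carrier := H S\<rparr>) (\<lambda>d. Gr F S d \<inter> H S)" if S: "S \<in> objs C" for S
      by (rule grading_submodule[OF F.module_Obj[OF S] cat_submoduleD(1)[OF H S] F.Gr_grading[OF S] comp[OF S]])
    show "Map F S S (id_mor S) x = x" if "S \<in> objs C" "x \<in> carrier (Obj F S\<lparr>carrier := H S\<rparr>)" for S x
      using F.Map_id[OF that(1) c[OF that(1)]] that(2) by simp
    show "Map F S U (comp_mor S \<eta> \<epsilon>) x = Map F T U \<eta> (Map F S T \<epsilon> x)"
      if "S \<in> objs C" "T \<in> objs C" "U \<in> objs C" "\<epsilon> \<in> mor S T" "\<eta> \<in> mor T U"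
        "x \<in> carrier (Obj F S\<lparr>carrier := H S\<rparr>)" for S T U \<epsilon> \<eta> x
      using F.Map_comp[OF that(1-5) c[OF that(1)]] that(6) by simp
    show "Map F S T \<epsilon> (x \<oplus>\<^bsub>Obj F S\<lparr>carrier := H S\<rparr>\<^esub> y)
        = Map F S T \<epsilon> x \<oplus>\<^bsub>Obj F T\<lparr>carrier := H T\<rparr>\<^esub> Map F S T \<epsilon> y"
      if "S \<in> objs C" "T \<in> objs C" "\<epsilon> \<in> mor S T" "x \<in> carrier (Obj F S\<lparr>carrier := H S\<rparr>)"
        "y \<in> carrier (Obj F S\<lparr>carrier := H S\<rparr>)" for S T \<epsilon> x y
      using F.Map_add[OF that(1-3) c[OF that(1)] c[OF that(1)]] that(4,5) by simp
    show "Map F S T \<epsilon> (Map A R S \<delta> a \<odot>\<^bsub>Obj F S\<lparr>carrier := H S\<rparr>\<^esub> q)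
        = Map A R T (comp_mor R \<epsilon> \<delta>) a \<odot>\<^bsub>Obj F T\<lparr>carrier := H T\<rparr>\<^esub> Map F S T \<epsilon> q"
      if "R \<in> objs C" "S \<in> objs C" "T \<in> objs C" "\<delta> \<in> mor R S" "\<epsilon> \<in> mor S T"
        "a \<in> carrier (Obj A R)" "q \<in> carrier (Obj F S\<lparr>carrier := H S\<rparr>)" for R S T \<delta> \<epsilon> a q
      using F.Map_smult[OF that(1-6) c[OF that(2)]] that(7) by simp
  qed (use sm F.Gr_smult F.Gr_Map cat_submoduleD(2)[OF H] in \<open>simp_all add: image_subset_iff\<close>)
qed

lemma graded_hom_hcomp:
  assumes F: "graded_cat_module C A F" and N: "graded_cat_module C A N" and f: "graded_hom C A F N f"
    and S: "S \<in> objs C" and x: "x \<in> carrier (Obj F S)"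
  shows "hcomp (Obj N S) (Gr N S) (f S x) d = f S (hcomp (Obj F S) (Gr F S) x d)"
proof -
  note l = linear_mapD[OF cat_hom_linear[OF graded_hom_cat_hom[OF f] S]]
  have "f S y \<in> Gr N S (e + 0)" if "y \<in> Gr F S e" for y e
    using graded_hom_Gr[OF f S that] by simp
  from hcomp_shift[OF graded_cat_module.M_graded[OF F S] graded_cat_module.M_graded[OF N S] l(1,2) this x]
  have "hcomp (Obj N S) (Gr N S) (f S x) d = f S (hcomp (Obj F S) (Gr F S) x (d - 0))" .
  then show ?thesis by simp
qed

lemma (in standard_graded_algebra) kernel_submodule:
  assumes F: "graded_cat_module C A F" and N: "graded_cat_module C A N" and f: "graded_hom C A F N f"
  defines "H \<equiv> \<lambda>S. {x \<in> carrier (Obj F S). f S x = \<zero>\<^bsub>Obj N S\<^esub>}"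
  shows "cat_submodule C A F H"
    and "\<lbrakk>S \<in> objs C; x \<in> H S\<rbrakk> \<Longrightarrow> hcomp (Obj F S) (Gr F S) x d \<in> H S"
proof -
  interpret F: graded_cat_module C A F by (rule F)
  interpret N: graded_cat_module C A N by (rule N)
  have Fm: "cat_module C A F" and Nm: "cat_module C A N" by unfold_locales
  note fc = graded_hom_cat_hom[OF f]
  have z: "cat_submodule C A N (\<lambda>S. {\<zero>\<^bsub>Obj N S\<^esub>})"
  proof (rule cat_submoduleI)
    fix S T \<epsilon> x assume a: "S \<in> objs C" "T \<in> objs C" "\<epsilon> \<in> mor S T" and x: "x \<in> {\<zero>\<^bsub>Obj N S\<^esub>}"
    then show "Map N S T \<epsilon> x \<in> {\<zero>\<^bsub>Obj N T\<^esub>}" using N.Map_zero[OF cat_algebra_axioms a] by simp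
  qed (simp add: submodule_zero_set N.module_Obj)
  show "cat_submodule C A F H"
    using cat_submodule_vimage[OF Fm Nm fc z] by (simp add: H_def)
  show "hcomp (Obj F S) (Gr F S) x d \<in> H S" if S: "S \<in> objs C" and x: "x \<in> H S"
  proof -
    have xF: "x \<in> carrier (Obj F S)" and fx: "f S x = \<zero>\<^bsub>Obj N S\<^esub>" using x by (simp_all add: H_def)
    have "hcomp (Obj N S) (Gr N S) (f S x) d = f S (hcomp (Obj F S) (Gr F S) x d)"
      by (rule graded_hom_hcomp[OF F N f S xF])
    then show ?thesis
      using graded_group.hcomp_closed[OF F.M_graded[OF S] xF] graded_group.hcomp_zero[OF N.M_graded[OF S]] fx
      by (simp add: H_def)
  qed
qed

text \<open>
  Cover \<open>M\<close>, then repeatedly the kernel of the last map.  A state of the recursion is a pair \<open>(F, H)\<close> of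
  the last term \<open>F\<close> and the kernel \<open>H\<close>, as a family of subsets of \<open>F\<close>.
\<close>

lemma (in standard_graded_algebra) graded_free_resolution_exists:
  fixes M :: "('a, 'm) gfunctr"
  assumes nt: "\<one>\<^bsub>K\<^esub> \<noteq> \<zero>\<^bsub>K\<^esub>" and M: "graded_cat_module C A M"
  shows "\<exists>P :: ('a, 'm, ('a + 'm) list \<Rightarrow> 'a) augmented_complex. graded_free_resolution C A M P"
proof -
  \<comment> \<open>Two different letters, as needed for the encodings; the one-letter lists \<open>[Inr b]\<close> encode \<open>M\<close>.\<close>
  define \<alpha> \<beta> :: "'a + 'm" where "\<alpha> = Inl \<zero>\<^bsub>Obj A (interval_obj C 0)\<^esub>" and "\<beta> = Inl \<one>\<^bsub>Obj A (interval_obj C 0)\<^esub>"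
  have \<alpha>\<beta>: "\<alpha> \<noteq> \<beta>" using one_not_zero[OF interval_obj_objs nt, of 0] by (simp add: \<alpha>_def \<beta>_def)
  define fin where "fin F \<longleftrightarrow> (\<forall>S \<in> objs C. \<exists>Y. carrier (Obj F S) = carrier (free_module (Obj A S) Y))"
    for F :: "('a, ('a + 'm) list \<Rightarrow> 'a) gfunctr"
  define good where "good = (\<lambda>(F, H). graded_cat_module C A F \<and> graded_free C A F \<and> fin F \<and>
    cat_submodule C A F H \<and> (\<forall>S \<in> objs C. \<forall>x \<in> H S. \<forall>d. hcomp (Obj F S) (Gr F S) x d \<in> H S))"
  define covers :: "('a, ('a + 'm) list \<Rightarrow> 'a) gfunctr \<times> (obj \<Rightarrow> (('a + 'm) list \<Rightarrow> 'a) set) \<Rightarrow>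
      ('a, ('a + 'm) list \<Rightarrow> 'a) gfunctr \<times> (obj \<Rightarrow> (('a + 'm) list \<Rightarrow> 'a) set) \<Rightarrow> bool"
    where "covers = (\<lambda>(F, H) (F', H'). \<exists>f. graded_hom C A F' F f \<and>
    (\<forall>S \<in> objs C. f S ` carrier (Obj F' S) = H S) \<and>
    (\<forall>S \<in> objs C. H' S = {x \<in> carrier (Obj F' S). f S x = \<zero>\<^bsub>Obj F S\<^esub>}))"
  have "\<forall>S \<in> objs C. \<exists>e :: 'm \<Rightarrow> ('a + 'm) list. inj_on e (carrier (Obj M S))"
    by (rule ballI, rule exI[of _ "\<lambda>b. [Inr b]"]) (simp add: inj_on_def)
  from free_cover[OF nt \<alpha>\<beta> M this]
  obtain F0 :: "('a, ('a + 'm) list \<Rightarrow> 'a) gfunctr" and aug where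
    F0': "graded_cat_module C A F0 \<and> graded_free C A F0 \<and> graded_hom C A F0 M aug \<and>
      (\<forall>S \<in> objs C. aug S ` carrier (Obj F0 S) = carrier (Obj M S)) \<and> fin F0"
    unfolding fin_def by (elim exE)
  then have F0: "graded_cat_module C A F0" "graded_free C A F0" "graded_hom C A F0 M aug"
    "\<And>S. S \<in> objs C \<Longrightarrow> aug S ` carrier (Obj F0 S) = carrier (Obj M S)" "fin F0"
    by simp_all
  define H0 where "H0 S = {x \<in> carrier (Obj F0 S). aug S x = \<zero>\<^bsub>Obj M S\<^esub>}" for S
  have good0: "good (F0, H0)"
    using F0 kernel_submodule[OF F0(1) M F0(3)] by (simp add: good_def H0_def[abs_def])
  have step: "\<exists>b. good b \<and> covers a b" if a: "good a" for a
  proof -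
    obtain F H where aFH: "a = (F, H)" by (cases a)
    have g: "graded_cat_module C A F" "fin F" "cat_submodule C A F H"
      "\<And>S x d. \<lbrakk>S \<in> objs C; x \<in> H S\<rbrakk> \<Longrightarrow> hcomp (Obj F S) (Gr F S) x d \<in> H S"
      using a by (simp_all add: aFH good_def)
    let ?N = "restrict_gfunctor F H"
    have N: "graded_cat_module C A ?N" by (rule restrict_gfunctor_module[OF g(1,3,4)])
    have enc: "\<exists>e :: (('a + 'm) list \<Rightarrow> 'a) \<Rightarrow> ('a + 'm) list. inj_on e (carrier (Obj ?N S))" if S: "S \<in> objs C" for S
    proof -
      obtain Y where Y: "carrier (Obj F S) = carrier (free_module (Obj A S) Y)" using g(2) S by (auto simp: fin_def)
      obtain e :: "(('a + 'm) list \<Rightarrow> 'a) \<Rightarrow> ('a + 'm) list" where "inj_on e (carrier (free_module (Obj A S) Y))"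
        using free_module_encoding[OF \<alpha>\<beta>] by blast
      then have "inj_on e (H S)"
        by (rule inj_on_subset) (use cat_submodule_carrier[OF g(3) S] Y in auto)
      then show ?thesis by (auto simp: restrict_gfunctor_simps)
    qed
    have "\<forall>S \<in> objs C. \<exists>e :: (('a + 'm) list \<Rightarrow> 'a) \<Rightarrow> ('a + 'm) list. inj_on e (carrier (Obj ?N S))"
      by (rule ballI) (rule enc)
    from free_cover[OF nt \<alpha>\<beta> N this]
    obtain F' :: "('a, ('a + 'm) list \<Rightarrow> 'a) gfunctr" and f where
      F'': "graded_cat_module C A F' \<and> graded_free C A F' \<and> graded_hom C A F' ?N f \<and>
        (\<forall>S \<in> objs C. f S ` carrier (Obj F' S) = carrier (Obj ?N S)) \<and> fin F'"
      unfolding fin_def by (elim exE)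
    then have F': "graded_cat_module C A F'" "graded_free C A F'" "graded_hom C A F' ?N f"
      "\<And>S. S \<in> objs C \<Longrightarrow> f S ` carrier (Obj F' S) = carrier (Obj ?N S)" "fin F'"
      by simp_all
    have f: "graded_hom C A F' F f"
      using F'(3) cat_submodule_carrier[OF g(3)]
      unfolding graded_hom_def restrict_gfunctor_simps by (simp add: Pi_iff image_subset_iff)
    define H' where "H' S = {x \<in> carrier (Obj F' S). f S x = \<zero>\<^bsub>Obj F S\<^esub>}" for S
    have "good (F', H')"
      using F' kernel_submodule[OF F'(1) g(1) f] by (simp add: good_def H'_def[abs_def])
    moreover have "covers a (F', H')"
      unfolding covers_def aFH prod.case
      by (intro exI[of _ f]) (use f F'(4) in \<open>simp add: H'_def restrict_gfunctor_simps\<close>)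
    ultimately show ?thesis by blast
  qed
  have "\<exists>s. \<forall>n. (good (s n) \<and> (n = 0 \<longrightarrow> s n = (F0, H0))) \<and> covers (s n) (s (Suc n))"
    by (rule dependent_nat_choice) (use good0 step in auto)
  then obtain s where s: "\<forall>n. (good (s n) \<and> (n = 0 \<longrightarrow> s n = (F0, H0))) \<and> covers (s n) (s (Suc n))" by (rule exE)
  define F where "F n = fst (s n)" for n
  define H where "H n = snd (s n)" for n
  have s_eq: "s n = (F n, H n)" for n by (simp add: F_def H_def)
  have good: "good (F n, H n)" and nxt: "covers (F n, H n) (F (Suc n), H (Suc n))" for n
    using s by (simp_all add: s_eq[symmetric])
  have "s 0 = (F0, H0)" using s by simp
  then have F00: "F 0 = F0" "H 0 = H0" by (simp_all add: F_def H_def)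
  have "\<forall>n. \<exists>f. graded_hom C A (F (Suc n)) (F n) f \<and>
    (\<forall>S \<in> objs C. f S ` carrier (Obj (F (Suc n)) S) = H n S) \<and>
    (\<forall>S \<in> objs C. H (Suc n) S = {x \<in> carrier (Obj (F (Suc n)) S). f S x = \<zero>\<^bsub>Obj (F n) S\<^esub>})"
    using nxt by (simp add: covers_def)
  from choice[OF this] obtain f where f': "\<forall>n. graded_hom C A (F (Suc n)) (F n) (f n) \<and>
    (\<forall>S \<in> objs C. f n S ` carrier (Obj (F (Suc n)) S) = H n S) \<and>
    (\<forall>S \<in> objs C. H (Suc n) S = {x \<in> carrier (Obj (F (Suc n)) S). f n S x = \<zero>\<^bsub>Obj (F n) S\<^esub>})"
    by (rule exE)
  then have f: "\<And>n. graded_hom C A (F (Suc n)) (F n) (f n)"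
    "\<And>n S. S \<in> objs C \<Longrightarrow> f n S ` carrier (Obj (F (Suc n)) S) = H n S"
    "\<And>n S. S \<in> objs C \<Longrightarrow> H (Suc n) S = {x \<in> carrier (Obj (F (Suc n)) S). f n S x = \<zero>\<^bsub>Obj (F n) S\<^esub>}"
    by simp_all
  have "graded_free_resolution C A M \<lparr>Term = F, Diff = f, Aug = aug\<rparr>"
    unfolding graded_free_resolution_def augmented_complex.simps
  proof (intro conjI allI ballI)
    show "graded_cat_module C A (F n)" "graded_free C A (F n)" for n using good by (simp_all add: good_def)
  qed (use f F0 in \<open>simp_all add: F00 H0_def\<close>)
  then show ?thesis by blast
qed

lemma (in standard_graded_algebra) free_resolution_resolves:
  assumes "\<one>\<^bsub>K\<^esub> \<noteq> \<zero>\<^bsub>K\<^esub>" "graded_cat_module C A M"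
  shows "graded_free_resolution C A M (free_resolution C A M)"
  unfolding free_resolution_def by (rule someI_ex[OF graded_free_resolution_exists[OF assms]])

section \<open>Homology of a complex tensored with a cyclic module\<close>

text \<open>
  Three consecutive terms of a complex, tensored with a cyclic module.  The homology in the middle is
  \<open>pre_cycles / pre_boundaries\<close>, the map from \<open>pre_cycles\<close> being \<open>homology_class\<close>.
\<close>

locale cyclic_tensor_complex =
  C2: cyclic_tensor R P2 N e + C1: cyclic_tensor R P1 N e + C0: cyclic_tensor R P0 N e
  for R :: "('a, 'y) ring_scheme" and P2 P1 P0 :: "('a, 'p) module" and N :: "('a, 'n) module" and e +
  fixes d1 d0 :: "'p \<Rightarrow> 'p"
  assumes d1: "linear_map R P2 P1 d1" and d0: "linear_map R P1 P0 d0"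
    and d0_d1: "x \<in> carrier P2 \<Longrightarrow> d0 (d1 x) = \<zero>\<^bsub>P0\<^esub>"
begin

abbreviation "T1 \<equiv> tensor R P1 N"

abbreviation "tensor_cycles \<equiv> {z \<in> carrier T1. tensor_map R P1 P0 N d0 z = \<zero>\<^bsub>tensor R P0 N\<^esub>}"
abbreviation "tensor_boundaries \<equiv> tensor_map R P2 P1 N d1 ` carrier (tensor R P2 N)"

definition "pre_cycles = {x \<in> carrier P1. d0 x \<in> ideal_smult R P0 C2.ann}"
definition "pre_boundaries = {x \<in> carrier P1. \<exists>z \<in> carrier P2. x \<ominus>\<^bsub>P1\<^esub> d1 z \<in> ideal_smult R P1 C2.ann}"

abbreviation "homology \<equiv> quotient_module (T1\<lparr>carrier := tensor_cycles\<rparr>) tensor_boundaries"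

definition "homology_class x = tensor_boundaries +>\<^bsub>T1\<^esub> C1.\<theta> x"

lemma tensor_map_theta:
  "x \<in> carrier P1 \<Longrightarrow> tensor_map R P1 P0 N d0 (C1.\<theta> x) = C0.\<theta> (d0 x)"
  "x \<in> carrier P2 \<Longrightarrow> tensor_map R P2 P1 N d1 (C2.\<theta> x) = C1.\<theta> (d1 x)"
  unfolding C1.\<theta>_def C0.\<theta>_def C2.\<theta>_def
  by (rule tensor_map_pure_tensor[OF C1.M.module_axioms C0.M.module_axioms C2.N.module_axioms d0 _ C2.e_closed],
      assumption)
    (rule tensor_map_pure_tensor[OF C2.M.module_axioms C1.M.module_axioms C2.N.module_axioms d1 _ C2.e_closed])

lemma pre_cycles_submodule: "submodule pre_cycles R P1"
  unfolding pre_cycles_def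
  by (rule submodule_vimage[OF d0 C1.M.module_axioms C0.M.module_axioms
        ideal_smult_submodule[OF C0.M.module_axioms C2.ann_subset]])

lemma tensor_cycles_eq: "tensor_cycles = C1.\<theta> ` pre_cycles"
proof -
  have "tensor_map R P1 P0 N d0 (C1.\<theta> x) = \<zero>\<^bsub>tensor R P0 N\<^esub> \<longleftrightarrow> d0 x \<in> ideal_smult R P0 C2.ann"
    if "x \<in> carrier P1" for x
    using C0.theta_zero_iff linear_mapD(1)[OF d0] that by (simp add: tensor_map_theta)
  then show ?thesis unfolding C1.theta_surj[symmetric] pre_cycles_def by auto
qed

lemma tensor_boundaries_eq: "tensor_boundaries = C1.\<theta> ` d1 ` carrier P2"
  unfolding C2.theta_surj[symmetric] by (auto simp: tensor_map_theta image_iff)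

lemma tensor_cycles_submodule: "submodule tensor_cycles R T1"
  unfolding tensor_cycles_eq
  by (rule submodule_image[OF C1.theta_linear C1.M.module_axioms C1.tensor_module pre_cycles_submodule])

lemma tensor_boundaries_submodule: "submodule tensor_boundaries R T1"
  unfolding tensor_boundaries_eq
  by (rule submodule_image[OF C1.theta_linear C1.M.module_axioms C1.tensor_module
        submodule_image[OF d1 C2.M.module_axioms C1.M.module_axioms C2.M.carrier_is_submodule]])

lemma boundaries_cycles: "tensor_boundaries \<subseteq> tensor_cycles"
proof -
  have "d1 z \<in> pre_cycles" if "z \<in> carrier P2" for z
    using linear_mapD(1)[OF d1 that] d0_d1[OF that]
      submodule_zero[OF ideal_smult_submodule[OF C0.M.module_axioms C2.ann_subset]]
    by (simp add: pre_cycles_def)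
  then show ?thesis unfolding tensor_boundaries_eq tensor_cycles_eq by auto
qed

lemma cycles_module: "module R (T1\<lparr>carrier := tensor_cycles\<rparr>)"
  by (rule submodule.submodule_is_module[OF tensor_cycles_submodule C1.tensor_module])

lemma boundaries_submodule: "submodule tensor_boundaries R (T1\<lparr>carrier := tensor_cycles\<rparr>)"
  by (rule submodule_restrict[OF C1.tensor_module tensor_cycles_submodule tensor_boundaries_submodule
        boundaries_cycles])

lemma homology_module: "module R homology"
  by (rule module.quotient_module_module[OF cycles_module boundaries_submodule])

lemma coset_restrict: "H +>\<^bsub>M\<lparr>carrier := Z\<rparr>\<^esub> x = H +>\<^bsub>M\<^esub> x"
  by (simp add: a_r_coset_def r_coset_def)

lemma homology_class_linear: "linear_map R (P1\<lparr>carrier := pre_cycles\<rparr>) homology homology_class"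
proof -
  have "linear_map R (P1\<lparr>carrier := pre_cycles\<rparr>) (T1\<lparr>carrier := tensor_cycles\<rparr>) C1.\<theta>"
    by (rule linear_submodule_codomain[OF linear_submodule_domain[OF C1.theta_linear
            submodule_subset[OF pre_cycles_submodule]]])
      (simp only: tensor_cycles_eq, simp)
  from linear_comp[OF this module.quotient_module_linear[OF cycles_module boundaries_submodule]]
  show ?thesis by (simp add: homology_class_def[abs_def] coset_restrict)
qed

lemma homology_class_zero_iff:
  assumes x: "x \<in> pre_cycles"
  shows "homology_class x = \<zero>\<^bsub>homology\<^esub> \<longleftrightarrow> x \<in> pre_boundaries"
proof -
  interpret T: module R "T1\<lparr>carrier := tensor_cycles\<rparr>" by (rule cycles_module)
  have xP: "x \<in> carrier P1" using x by (simp add: pre_cycles_def)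
  have "C1.\<theta> x \<in> carrier (T1\<lparr>carrier := tensor_cycles\<rparr>)"
    using imageI[OF x, of C1.\<theta>] unfolding tensor_cycles_eq[symmetric] by simp
  from T.coset_eq_self_iff[OF boundaries_submodule this]
  have "homology_class x = \<zero>\<^bsub>homology\<^esub> \<longleftrightarrow> C1.\<theta> x \<in> tensor_boundaries"
    by (simp add: T.quotient_module_zero homology_class_def coset_restrict)
  also have "\<dots> \<longleftrightarrow> (\<exists>z \<in> carrier P2. C1.\<theta> x = C1.\<theta> (d1 z))" unfolding tensor_boundaries_eq by auto
  also have "\<dots> \<longleftrightarrow> x \<in> pre_boundaries"
  proof -
    interpret TT: module R T1 by (rule C1.tensor_module)
    have "C1.\<theta> x = C1.\<theta> (d1 z) \<longleftrightarrow> x \<ominus>\<^bsub>P1\<^esub> d1 z \<in> ideal_smult R P1 C2.ann" if z: "z \<in> carrier P2" for z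
    proof -
      have dz: "d1 z \<in> carrier P1" by (rule linear_mapD(1)[OF d1 z])
      have "C1.\<theta> x = C1.\<theta> (d1 z) \<longleftrightarrow> C1.\<theta> x \<ominus>\<^bsub>T1\<^esub> C1.\<theta> (d1 z) = \<zero>\<^bsub>T1\<^esub>"
        using TT.M.minus_eq_zero_iff linear_mapD(1)[OF C1.theta_linear] xP dz by simp
      also have "\<dots> \<longleftrightarrow> C1.\<theta> (x \<ominus>\<^bsub>P1\<^esub> d1 z) = \<zero>\<^bsub>T1\<^esub>"
        using linear_minus[OF C1.theta_linear C1.M.module_axioms C1.tensor_module xP dz] by simp
      also have "\<dots> \<longleftrightarrow> x \<ominus>\<^bsub>P1\<^esub> d1 z \<in> ideal_smult R P1 C2.ann"
        using C1.theta_zero_iff xP dz by simp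
      finally show ?thesis .
    qed
    then show ?thesis using xP by (auto simp: pre_boundaries_def)
  qed
  finally show ?thesis .
qed

end

text \<open>
  If \<open>y = ae\<close> with \<open>a\<close> homogeneous, then \<open>x \<otimes> y = \<theta> (a x)\<close>, and \<open>ax\<close> has the total degree of \<open>x\<close> and \<open>y\<close>.
\<close>

lemma (in cyclic_tensor) tensor_Gr_eq:
  assumes G: "grading M G" and R: "\<one>\<^bsub>R\<^esub> \<in> RG 0" "\<And>d. RG d \<subseteq> carrier R"
    and smult: "\<And>a d x i. \<lbrakk>a \<in> RG d; x \<in> G i\<rbrakk> \<Longrightarrow> a \<odot>\<^bsub>M\<^esub> x \<in> G (d + i)"
    and H: "\<And>d. H d = (\<lambda>a. a \<odot>\<^bsub>N\<^esub> e) ` RG d"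
  shows "tensor_Gr R M G N H j = \<theta> ` G j"
proof
  interpret T: module R "tensor R M N" by (rule tensor_module)
  interpret G: graded_group M G by unfold_locales (rule G)
  note l = linear_mapD[OF theta_linear]
  have sub: "subgroup (\<theta> ` G j) (add_monoid (tensor R M N))"
  proof (rule T.M.add.subgroupI)
    show "\<theta> ` G j \<subseteq> carrier (tensor R M N)" using l(1) G.G_subset by auto
    show "\<theta> ` G j \<noteq> {}" using G.G_zero by auto
    show "\<ominus>\<^bsub>tensor R M N\<^esub> y \<in> \<theta> ` G j" if y: "y \<in> \<theta> ` G j" for y
    proof -
      obtain x where x: "x \<in> G j" "y = \<theta> x" using y by auto
      then have "\<ominus>\<^bsub>tensor R M N\<^esub> y = \<theta> (\<ominus>\<^bsub>M\<^esub> x)"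
        using linear_a_inv[OF theta_linear M.module_axioms tensor_module G.G_subset] by simp
      then show ?thesis using G.G_inv[OF x(1)] by simp
    qed
    show "y \<oplus>\<^bsub>tensor R M N\<^esub> y' \<in> \<theta> ` G j" if y: "y \<in> \<theta> ` G j" "y' \<in> \<theta> ` G j" for y y'
    proof -
      obtain x x' where x: "x \<in> G j" "y = \<theta> x" "x' \<in> G j" "y' = \<theta> x'" using y by auto
      then have "y \<oplus>\<^bsub>tensor R M N\<^esub> y' = \<theta> (x \<oplus>\<^bsub>M\<^esub> x')" using l(2) G.G_subset by simp
      then show ?thesis using G.G_add[OF x(1,3)] by simp
    qed
  qed
  show "tensor_Gr R M G N H j \<subseteq> \<theta> ` G j"
    unfolding tensor_Gr_def
  proof (rule T.M.add.generate_subgroup_incl[OF _ sub])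
    show "{pure_tensor R M N x y |x y i. x \<in> G i \<and> y \<in> H (j - i)} \<subseteq> \<theta> ` G j"
    proof clarify
      fix x y i assume x: "x \<in> G i" and "y \<in> H (j - i)"
      then obtain a where a: "a \<in> RG (j - i)" "y = a \<odot>\<^bsub>N\<^esub> e" using H by auto
      have "pure_tensor R M N x y = \<theta> (a \<odot>\<^bsub>M\<^esub> x)"
        using a R(2) G.G_subset[OF x] e_closed
        by (auto simp: \<theta>_def pure_tensor_smult_left pure_tensor_smult_right subset_eq)
      moreover have "a \<odot>\<^bsub>M\<^esub> x \<in> G j" using smult[OF a(1) x] by simp
      ultimately show "pure_tensor R M N x y \<in> \<theta> ` G j" by simp
    qed
  qed
  have e: "e \<in> H (j - j)" using H[of 0] R(1) e_closed by (auto intro!: rev_image_eqI)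
  show "\<theta> ` G j \<subseteq> tensor_Gr R M G N H j"
    unfolding tensor_Gr_def \<theta>_def
  proof (rule image_subsetI, rule generate.incl)
    fix x assume "x \<in> G j"
    with e show "pure_tensor R M N x e \<in> {pure_tensor R M N x y |x y i. x \<in> G i \<and> y \<in> H (j - i)}" by blast
  qed
qed

section \<open>Dimensions and restriction of scalars\<close>

lemma restrict_scalars_module:
  assumes "algebra K R" "module R M" shows "module K (restrict_scalars R M)"
proof -
  interpret al: algebra K R by fact
  interpret M: module R M by fact
  have [simp]: "k \<odot>\<^bsub>R\<^esub> \<one>\<^bsub>R\<^esub> \<in> carrier R" if "k \<in> carrier K" for k
    using that al.smult_closed al.one_closed by blast
  have mm: "(a \<otimes>\<^bsub>K\<^esub> b) \<odot>\<^bsub>R\<^esub> \<one>\<^bsub>R\<^esub> = (a \<odot>\<^bsub>R\<^esub> \<one>\<^bsub>R\<^esub>) \<otimes>\<^bsub>R\<^esub> (b \<odot>\<^bsub>R\<^esub> \<one>\<^bsub>R\<^esub>)"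
    if "a \<in> carrier K" "b \<in> carrier K" for a b
    using that by (simp add: al.smult_assoc2 al.smult_assoc1)
  show ?thesis
  proof (intro moduleI abelian_groupI)
    show "\<exists>y \<in> carrier (restrict_scalars R M). y \<oplus>\<^bsub>restrict_scalars R M\<^esub> x = \<zero>\<^bsub>restrict_scalars R M\<^esub>"
      if "x \<in> carrier (restrict_scalars R M)" for x
      using that M.M.l_neg by (auto simp: restrict_scalars_def intro!: bexI[of _ "\<ominus>\<^bsub>M\<^esub> x"])
  qed (auto simp: restrict_scalars_def al.R.is_cring M.M.a_ac M.smult_r_distr al.smult_l_distr
      M.smult_l_distr M.smult_assoc1 mm)
qed

lemma restrict_scalars_linear:
  assumes "algebra K R" "linear_map R M N f"
  shows "linear_map K (restrict_scalars R M) (restrict_scalars R N) f"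
proof -
  interpret al: algebra K R by fact
  have "k \<odot>\<^bsub>R\<^esub> \<one>\<^bsub>R\<^esub> \<in> carrier R" if "k \<in> carrier K" for k
    using that al.smult_closed al.one_closed by blast
  then show ?thesis using linear_mapD[OF assms(2)] by (intro linear_mapI) (simp_all add: restrict_scalars_def)
qed

text \<open>
  A nonzero vector is independent by itself, as scalars are invertible.
\<close>

lemma vdim_nonzero_iff:
  assumes K: "field K" and V: "module K V"
  shows "vdim K V \<noteq> 0 \<longleftrightarrow> (\<exists>v \<in> carrier V. v \<noteq> \<zero>\<^bsub>V\<^esub>)"
proof -
  interpret K: field K by fact
  interpret V: module K V by fact
  have nz: "vdim K V \<noteq> 0 \<longleftrightarrow> (\<exists>B. linearly_independent K V B \<and> card B \<noteq> 0)"
    unfolding vdim_def bot_enat_def[symmetric] Sup_bot_conv by (auto simp: bot_enat_def zero_enat_def)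
  have single: "finsum V (\<lambda>b. c b \<odot>\<^bsub>V\<^esub> b) {v} = c v \<odot>\<^bsub>V\<^esub> v"
    if "v \<in> carrier V" "c v \<in> carrier K" for c v
    using that by simp
  show ?thesis
  proof
    assume "vdim K V \<noteq> 0"
    then obtain B where B: "linearly_independent K V B" "card B \<noteq> 0" using nz by auto
    then obtain b where b: "b \<in> B" by (metis card.empty ex_in_conv)
    show "\<exists>v \<in> carrier V. v \<noteq> \<zero>\<^bsub>V\<^esub>"
    proof (rule ccontr)
      assume "\<not> ?thesis"
      moreover have "B \<subseteq> carrier V" using B(1) by (simp add: linearly_independent_def)
      ultimately have "B = {\<zero>\<^bsub>V\<^esub>}" using b by auto
      then have sum: "finsum V (\<lambda>b. \<one>\<^bsub>K\<^esub> \<odot>\<^bsub>V\<^esub> b) B = \<zero>\<^bsub>V\<^esub>" by simp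
      have one: "(\<lambda>_. \<one>\<^bsub>K\<^esub>) \<in> B \<rightarrow> carrier K" by simp
      have "\<forall>c \<in> B \<rightarrow> carrier K. finsum V (\<lambda>b. c b \<odot>\<^bsub>V\<^esub> b) B = \<zero>\<^bsub>V\<^esub> \<longrightarrow> (\<forall>b \<in> B. c b = \<zero>\<^bsub>K\<^esub>)"
        using B(1) by (simp add: linearly_independent_def)
      from mp[OF bspec[OF this one] sum] have "\<one>\<^bsub>K\<^esub> = \<zero>\<^bsub>K\<^esub>" using b by (rule bspec)
      then show False by simp
    qed
  next
    assume "\<exists>v \<in> carrier V. v \<noteq> \<zero>\<^bsub>V\<^esub>"
    then obtain v where v: "v \<in> carrier V" "v \<noteq> \<zero>\<^bsub>V\<^esub>" by auto
    have "c = \<zero>\<^bsub>K\<^esub>" if c: "c \<in> carrier K" "c \<odot>\<^bsub>V\<^esub> v = \<zero>\<^bsub>V\<^esub>" for c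
    proof (rule ccontr)
      assume "c \<noteq> \<zero>\<^bsub>K\<^esub>"
      then have u: "c \<in> Units K" using c(1) K.field_Units by auto
      have "v = (inv\<^bsub>K\<^esub> c \<otimes>\<^bsub>K\<^esub> c) \<odot>\<^bsub>V\<^esub> v" using u v by simp
      also have "\<dots> = inv\<^bsub>K\<^esub> c \<odot>\<^bsub>V\<^esub> (c \<odot>\<^bsub>V\<^esub> v)" using u v c by (intro V.smult_assoc1) auto
      also have "\<dots> = \<zero>\<^bsub>V\<^esub>" using c u by simp
      finally show False using v by simp
    qed
    then have "linearly_independent K V {v}"
      using v single by (auto simp: linearly_independent_def)
    then show "vdim K V \<noteq> 0" unfolding nz by (intro exI[of _ "{v}"]) simp
  qed
qed

section \<open>The irrelevant ideal and the residue module\<close>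

lemma (in module) submoduleI_no_inv:
  assumes "H \<subseteq> carrier M" "\<zero>\<^bsub>M\<^esub> \<in> H" "\<And>a b. \<lbrakk>a \<in> H; b \<in> H\<rbrakk> \<Longrightarrow> a \<oplus>\<^bsub>M\<^esub> b \<in> H"
    and smult: "\<And>a x. \<lbrakk>a \<in> carrier R; x \<in> H\<rbrakk> \<Longrightarrow> a \<odot>\<^bsub>M\<^esub> x \<in> H"
  shows "submodule H R M"
proof (rule submoduleI)
  show "\<ominus>\<^bsub>M\<^esub> x \<in> H" if "x \<in> H" for x
    using smult[of "\<ominus> \<one>" x] smult_minus_one[of x] that assms(1) by auto
qed (use assms in auto)

context standard_graded_algebra
begin

lemma self_module_simps:
  "carrier (Obj (self_module A) S) = carrier (Obj A S)"
  "\<zero>\<^bsub>Obj (self_module A) S\<^esub> = \<zero>\<^bsub>Obj A S\<^esub>"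
  "x \<oplus>\<^bsub>Obj (self_module A) S\<^esub> y = x \<oplus>\<^bsub>Obj A S\<^esub> y"
  "x \<odot>\<^bsub>Obj (self_module A) S\<^esub> y = x \<otimes>\<^bsub>Obj A S\<^esub> y"
  "H +>\<^bsub>Obj (self_module A) S\<^esub> x = H +>\<^bsub>Obj A S\<^esub> x"
  by (simp_all add: self_module_def a_r_coset_def r_coset_def)

lemma self_module_module:
  assumes "S \<in> objs C" shows "module (Obj A S) (Obj (self_module A) S)"
proof -
  interpret R: cring "Obj A S" by (rule Obj_cring[OF assms])
  show ?thesis
  proof (intro moduleI abelian_groupI)
    show "\<exists>y \<in> carrier (Obj (self_module A) S). y \<oplus>\<^bsub>Obj (self_module A) S\<^esub> x = \<zero>\<^bsub>Obj (self_module A) S\<^esub>"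
      if "x \<in> carrier (Obj (self_module A) S)" for x
      using that by (auto simp: self_module_simps R.l_neg intro!: bexI[of _ "\<ominus>\<^bsub>Obj A S\<^esub> x"])
  qed (auto simp: self_module_simps R.is_cring R.a_ac R.l_distr R.r_distr R.m_assoc)
qed

text \<open>
  Membership in a generated subgroup is hard to refute; components make it a condition that can be
  tested.
\<close>

lemma max_ideal_eq:
  assumes S: "S \<in> objs C"
  shows "max_ideal A S = {a \<in> carrier (Obj A S). \<forall>d \<le> 0. hcomp (Obj A S) (Gr A S) a d = \<zero>\<^bsub>Obj A S\<^esub>}"
proof
  interpret R: cring "Obj A S" by (rule Obj_cring[OF S])
  interpret G: graded_group "Obj A S" "Gr A S" by (rule A_graded[OF S])
  let ?h = "hcomp (Obj A S) (Gr A S)"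
  let ?J = "{a \<in> carrier (Obj A S). \<forall>d \<le> 0. ?h a d = \<zero>\<^bsub>Obj A S\<^esub>}"
  have sub: "subgroup ?J (add_monoid (Obj A S))"
  proof (rule R.add.subgroupI)
    show "?J \<noteq> {}" using G.hcomp_zero R.zero_closed by blast
    show "\<ominus>\<^bsub>Obj A S\<^esub> a \<in> ?J" if a: "a \<in> ?J" for a
    proof -
      have c: "a \<in> carrier (Obj A S)" using a by simp
      have sum: "?h a d \<oplus>\<^bsub>Obj A S\<^esub> ?h (\<ominus>\<^bsub>Obj A S\<^esub> a) d = \<zero>\<^bsub>Obj A S\<^esub>" for d
        using G.hcomp_add[OF c R.a_inv_closed[OF c], of d] c by (simp add: R.r_neg G.hcomp_zero)
      have "?h (\<ominus>\<^bsub>Obj A S\<^esub> a) d = \<zero>\<^bsub>Obj A S\<^esub>" if "d \<le> 0" for d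
        using sum[of d] a that G.hcomp_closed[OF R.a_inv_closed[OF c], of d] by simp
      then show ?thesis using c by simp
    qed
  qed (auto simp: G.hcomp_add)
  show "max_ideal A S \<subseteq> ?J"
    unfolding max_ideal_def
  proof (rule R.add.generate_subgroup_incl[OF _ sub], rule subsetI)
    fix a assume "a \<in> (\<Union>d \<in> {1..}. Gr A S d)"
    then obtain e where "e \<ge> 1" "a \<in> Gr A S e" by auto
    then show "a \<in> ?J" using G.G_subset G.hcomp_homogeneous by auto
  qed
  have gen: "subgroup (max_ideal A S) (add_monoid (Obj A S))"
    unfolding max_ideal_def by (rule R.add.generate_is_subgroup) (use G.G_subset in auto)
  have fin: "finsum (Obj A S) f I \<in> max_ideal A S" if "\<And>i. i \<in> I \<Longrightarrow> f i \<in> max_ideal A S" for f and I :: "int set"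
    using that
  proof (induction I rule: infinite_finite_induct)
    case (insert i I)
    have "f i \<in> carrier (Obj A S)" "f \<in> I \<rightarrow> carrier (Obj A S)"
      using insert.prems subgroup.subset[OF gen] by auto
    moreover have "f i \<oplus>\<^bsub>Obj A S\<^esub> finsum (Obj A S) f I \<in> max_ideal A S"
      using subgroup.m_closed[OF gen, of "f i" "finsum (Obj A S) f I"] insert by simp
    ultimately show ?case using insert by simp
  qed (use subgroup.one_closed[OF gen] in simp_all)
  show "?J \<subseteq> max_ideal A S"
  proof
    fix a assume a: "a \<in> ?J"
    then have c: "a \<in> carrier (Obj A S)" by simp
    have "finsum (Obj A S) (?h a) {d. ?h a d \<noteq> \<zero>\<^bsub>Obj A S\<^esub>} \<in> max_ideal A S"
    proof (rule fin)
      fix d assume "d \<in> {d. ?h a d \<noteq> \<zero>\<^bsub>Obj A S\<^esub>}"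
      then have "d \<in> {1..}" using a by (auto simp: not_le[symmetric] dest: spec[of _ d])
      then show "?h a d \<in> max_ideal A S"
        unfolding max_ideal_def using G.hcomp_props(1)[OF c] by (blast intro: generate.incl)
    qed
    then show "a \<in> max_ideal A S" using G.hcomp_props(3)[OF c] by simp
  qed
qed

lemma max_ideal_subset: "S \<in> objs C \<Longrightarrow> max_ideal A S \<subseteq> carrier (Obj A S)"
  using max_ideal_eq by auto

lemma max_ideal_Gr: "S \<in> objs C \<Longrightarrow> d \<ge> 1 \<Longrightarrow> Gr A S d \<subseteq> max_ideal A S"
  unfolding max_ideal_def by (auto intro!: generate.incl)

lemma max_ideal_hcomp:
  assumes "S \<in> objs C" "a \<in> max_ideal A S" shows "hcomp (Obj A S) (Gr A S) a d \<in> max_ideal A S"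
proof -
  interpret G: graded_group "Obj A S" "Gr A S" by (rule A_graded[OF assms(1)])
  have c: "a \<in> carrier (Obj A S)" using max_ideal_subset assms by blast
  show ?thesis
    using assms(2) unfolding max_ideal_eq[OF assms(1)]
    using G.hcomp_closed[OF c, of d] G.hcomp_homogeneous[OF G.hcomp_props(1)[OF c, of d]] by auto
qed

text \<open>
  A product of \<open>r\<close> with something of degree \<open>e \<ge> 1\<close> has in degree \<open>d \<le> 0\<close> the component
  \<open>r\<^sub>d\<^sub>-\<^sub>e\<close> times it, and \<open>A\<close> has nothing in negative degrees.
\<close>

lemma max_ideal_submodule:
  assumes S: "S \<in> objs C" shows "submodule (max_ideal A S) (Obj A S) (Obj (self_module A) S)"
proof -
  interpret R: cring "Obj A S" by (rule Obj_cring[OF S])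
  interpret G: graded_group "Obj A S" "Gr A S" by (rule A_graded[OF S])
  let ?h = "hcomp (Obj A S) (Gr A S)"
  have "?h (r \<otimes>\<^bsub>Obj A S\<^esub> a) d = \<zero>\<^bsub>Obj A S\<^esub>"
    if r: "r \<in> carrier (Obj A S)" and a: "a \<in> max_ideal A S" and d: "d \<le> 0" for r a d
  proof -
    have c: "a \<in> carrier (Obj A S)" using a max_ideal_subset[OF S] by blast
    have sum: "r \<otimes>\<^bsub>Obj A S\<^esub> a = finsum (Obj A S) (\<lambda>e. r \<otimes>\<^bsub>Obj A S\<^esub> ?h a e) {e. ?h a e \<noteq> \<zero>\<^bsub>Obj A S\<^esub>}"
      using additive_finsum[OF R.abelian_group_axioms R.abelian_group_axioms, where f = "\<lambda>x. r \<otimes>\<^bsub>Obj A S\<^esub> x"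
          and g = "?h a" and I = "{e. ?h a e \<noteq> \<zero>\<^bsub>Obj A S\<^esub>}"]
        G.hcomp_props(3)[OF c] G.hcomp_closed[OF c] r by (simp add: R.r_distr)
    have "?h (r \<otimes>\<^bsub>Obj A S\<^esub> ?h a e) d = \<zero>\<^bsub>Obj A S\<^esub>" if e: "?h a e \<noteq> \<zero>\<^bsub>Obj A S\<^esub>" for e
    proof -
      have "\<not> e \<le> 0" using e a unfolding max_ideal_eq[OF S] by auto
      then have "e \<ge> 1" by simp
      have "?h (r \<otimes>\<^bsub>Obj A S\<^esub> ?h a e) d = ?h r (d - e) \<otimes>\<^bsub>Obj A S\<^esub> ?h a e"
        by (rule hcomp_shift[OF A_graded[OF S] A_graded[OF S], where f = "\<lambda>r. r \<otimes>\<^bsub>Obj A S\<^esub> ?h a e"])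
          (use G.hcomp_closed[OF c] r Gr_mult[OF S _ G.hcomp_props(1)[OF c]] in \<open>auto simp: R.l_distr\<close>)
      moreover have "?h r (d - e) = \<zero>\<^bsub>Obj A S\<^esub>"
        using G.hcomp_props(1)[OF r, of "d - e"] Gr_negative[OF S, of "d - e"] d \<open>e \<ge> 1\<close> by simp
      ultimately show ?thesis using G.hcomp_closed[OF c] by simp
    qed
    then show ?thesis
      unfolding sum using r G.hcomp_closed[OF c] by (subst G.hcomp_finsum) (auto intro!: R.add.finprod_one_eqI)
  qed
  note ann = this
  show ?thesis
    by (rule module.submoduleI_no_inv[OF self_module_module[OF S]])
      (use ann in \<open>auto simp: self_module_simps max_ideal_eq[OF S] G.hcomp_add G.hcomp_zero\<close>)
qed

text \<open>
  The class of \<open>1\<close>, which generates the residue module.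
\<close>

definition residue_one :: "obj \<Rightarrow> 'a set" where
  "residue_one S = max_ideal A S +>\<^bsub>Obj A S\<^esub> \<one>\<^bsub>Obj A S\<^esub>"

lemma residue_Obj: "Obj (residue_module A) S = quotient_module (Obj (self_module A) S) (max_ideal A S)"
  by (simp add: residue_module_def)

lemma residue_smult_one:
  assumes S: "S \<in> objs C" and a: "a \<in> carrier (Obj A S)"
  shows "a \<odot>\<^bsub>Obj (residue_module A) S\<^esub> residue_one S = max_ideal A S +>\<^bsub>Obj A S\<^esub> a"
proof -
  interpret R: cring "Obj A S" by (rule Obj_cring[OF S])
  show ?thesis
    using linear_mapD(3)[OF module.quotient_module_linear[OF self_module_module[OF S] max_ideal_submodule[OF S]], of a "\<one>\<^bsub>Obj A S\<^esub>"] a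
    by (simp add: self_module_simps residue_Obj residue_one_def)
qed

lemma residue_cyclic:
  assumes S: "S \<in> objs C" and P: "module (Obj A S) P"
  shows "cyclic_tensor (Obj A S) P (Obj (residue_module A) S) (residue_one S)"
    and "cyclic_tensor.ann (Obj A S) (Obj (residue_module A) S) (residue_one S) = max_ideal A S"
proof -
  interpret R: cring "Obj A S" by (rule Obj_cring[OF S])
  interpret sm: module "Obj A S" "Obj (self_module A) S" by (rule self_module_module[OF S])
  note sub = max_ideal_submodule[OF S]
  note car = sm.quotient_module_carrier[of "max_ideal A S", unfolded self_module_simps, folded residue_Obj]
  show 1: "cyclic_tensor (Obj A S) P (Obj (residue_module A) S) (residue_one S)"
  proof (intro cyclic_tensor.intro two_modules.intro cyclic_tensor_axioms.intro P)
    show "module (Obj A S) (Obj (residue_module A) S)"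
      unfolding residue_Obj by (rule sm.quotient_module_module[OF sub])
    show "residue_one S \<in> carrier (Obj (residue_module A) S)"
      unfolding car residue_one_def by simp
    show "\<exists>a \<in> carrier (Obj A S). y = a \<odot>\<^bsub>Obj (residue_module A) S\<^esub> residue_one S"
      if "y \<in> carrier (Obj (residue_module A) S)" for y
      using that residue_smult_one[OF S] unfolding car by auto
  qed
  have z: "\<zero>\<^bsub>Obj (residue_module A) S\<^esub> = max_ideal A S"
    by (simp add: residue_Obj sm.quotient_module_zero)
  have "max_ideal A S +>\<^bsub>Obj A S\<^esub> a = max_ideal A S \<longleftrightarrow> a \<in> max_ideal A S" if "a \<in> carrier (Obj A S)" for a
    using sm.coset_eq_self_iff[OF sub, of a] that by (simp add: self_module_simps)
  then show "cyclic_tensor.ann (Obj A S) (Obj (residue_module A) S) (residue_one S) = max_ideal A S"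
    unfolding cyclic_tensor.ann_def[OF 1] z
    using residue_smult_one[OF S] max_ideal_subset[OF S] by auto
qed

lemma residue_Gr:
  assumes "S \<in> objs C"
  shows "Gr (residue_module A) S d = (\<lambda>a. a \<odot>\<^bsub>Obj (residue_module A) S\<^esub> residue_one S) ` Gr A S d"
proof -
  have "Gr (residue_module A) S d = (\<lambda>a. max_ideal A S +>\<^bsub>Obj A S\<^esub> a) ` Gr A S d"
    by (simp add: residue_module_def)
  also have "\<dots> = (\<lambda>a. a \<odot>\<^bsub>Obj (residue_module A) S\<^esub> residue_one S) ` Gr A S d"
    using residue_smult_one[OF assms] graded_group.G_subset[OF A_graded[OF assms]] by (intro image_cong) auto
  finally show ?thesis .
qed

section \<open>Nonvanishing of Betti numbers\<close>

text \<open>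
  The graded piece of \<open>Tor\<close> is the image of the homogeneous elements of \<open>pre_cycles\<close>, so it vanishes
  if and only if all of these lie in \<open>pre_boundaries\<close>.
\<close>

lemma betti_nonzero_iff:
  fixes M :: "('a, 'm) gfunctr"
  assumes K: "field K" and M: "graded_cat_module C A M" and S: "S \<in> objs C"
  defines "P \<equiv> free_resolution C A M"
  shows "betti K C A M S (Suc q) j \<noteq> 0 \<longleftrightarrow>
    (\<exists>x \<in> Gr (Term P (Suc q)) S j.
      Diff P q S x \<in> ideal_smult (Obj A S) (Obj (Term P q) S) (max_ideal A S) \<and>
      \<not> (\<exists>z \<in> carrier (Obj (Term P (Suc (Suc q))) S). x \<ominus>\<^bsub>Obj (Term P (Suc q)) S\<^esub> Diff P (Suc q) S z
          \<in> ideal_smult (Obj A S) (Obj (Term P (Suc q)) S) (max_ideal A S)))"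
proof -
  let ?R = "Obj A S" and ?N = "Obj (residue_module A) S"
  interpret K: field K by (rule K)
  have res: "graded_free_resolution C A M P"
    unfolding P_def by (rule free_resolution_resolves[OF _ M]) simp
  then have Pg: "graded_cat_module C A (Term P n)" and Pd: "graded_hom C A (Term P (Suc n)) (Term P n) (Diff P n)"
    and ex: "Diff P (Suc n) S ` carrier (Obj (Term P (Suc (Suc n))) S)
        = {x \<in> carrier (Obj (Term P (Suc n)) S). Diff P n S x = \<zero>\<^bsub>Obj (Term P n) S\<^esub>}" for n
    using S by (simp_all add: graded_free_resolution_def)
  have Pm: "module ?R (Obj (Term P n) S)" for n
    by (rule cat_module.module_Obj[OF graded_cat_module.axioms(1)[OF Pg] S])
  interpret T: cyclic_tensor_complex ?R "Obj (Term P (Suc (Suc q))) S" "Obj (Term P (Suc q)) S"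
    "Obj (Term P q) S" ?N "residue_one S" "Diff P (Suc q) S" "Diff P q S"
  proof (intro cyclic_tensor_complex.intro residue_cyclic(1)[OF S Pm] cyclic_tensor_complex_axioms.intro)
    show "linear_map ?R (Obj (Term P (Suc (Suc q))) S) (Obj (Term P (Suc q)) S) (Diff P (Suc q) S)"
      "linear_map ?R (Obj (Term P (Suc q)) S) (Obj (Term P q) S) (Diff P q S)"
      by (rule cat_hom_linear[OF graded_hom_cat_hom[OF Pd] S])+
    show "Diff P q S (Diff P (Suc q) S x) = \<zero>\<^bsub>Obj (Term P q) S\<^esub>"
      if "x \<in> carrier (Obj (Term P (Suc (Suc q))) S)" for x
      using imageI[OF that, of "Diff P (Suc q) S"] unfolding ex by simp
  qed
  let ?G = "Gr (Term P (Suc q)) S"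
  interpret G: graded_group "Obj (Term P (Suc q)) S" ?G
    by (rule graded_cat_module.M_graded[OF Pg S])
  note ann = residue_cyclic(2)[OF S Pm]
  have tor: "tor C A M (residue_module A) (Suc q) S = T.homology"
    by (simp add: tor_def tor_term_def tor_boundaries_def tor_diff_def Let_def P_def)
  have tGr: "tensor_Gr ?R (Obj (Term P (Suc q)) S) ?G ?N (Gr (residue_module A) S) j = T.C1.\<theta> ` ?G j"
  proof (rule T.C1.tensor_Gr_eq[where G = ?G and RG = "Gr A S",
        OF graded_cat_module.Gr_grading[OF Pg S] one_Gr_0[OF S]])
    show "Gr A S d \<subseteq> carrier ?R" for d using graded_group.G_subset[OF A_graded[OF S]] by auto
  qed (simp_all add: graded_cat_module.Gr_smult[OF Pg S] residue_Gr[OF S])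
  let ?Y = "T.homology_class ` (T.pre_cycles \<inter> ?G j)"
  have torGr: "tor_Gr C A M (residue_module A) (Suc q) S j = ?Y"
  proof -
    have "tor_Gr C A M (residue_module A) (Suc q) S j =
      (\<lambda>z. T.tensor_boundaries +>\<^bsub>T.T1\<^esub> z) ` (T.tensor_cycles \<inter> T.C1.\<theta> ` ?G j)"
      unfolding tGr[symmetric]
      by (auto simp: tor_Gr_def tor_term_def tor_boundaries_def tor_diff_def Let_def P_def)
    also have "T.tensor_cycles \<inter> T.C1.\<theta> ` ?G j = T.C1.\<theta> ` (T.pre_cycles \<inter> ?G j)"
    proof -
      have "x \<in> T.pre_cycles" if "x \<in> ?G j" "T.C1.\<theta> x \<in> T.tensor_cycles" for x
        using that T.C0.theta_zero_iff linear_mapD(1)[OF T.d0] G.G_subset[OF that(1)]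
        by (simp add: T.tensor_map_theta T.pre_cycles_def)
      then show ?thesis unfolding T.tensor_cycles_eq by auto
    qed
    finally show ?thesis by (simp add: image_image T.homology_class_def)
  qed
  interpret al: algebra K ?R by (rule algebra_Obj[OF S])
  define V where "V = restrict_scalars ?R T.homology"
  have Vm: "module K V" unfolding V_def by (rule restrict_scalars_module[OF al.algebra_axioms T.homology_module])
  let ?W = "Obj (Term P (Suc q)) S\<lparr>carrier := T.pre_cycles\<rparr>"
  have Wm: "module ?R ?W" by (rule submodule.submodule_is_module[OF T.pre_cycles_submodule Pm])
  have Wm': "module K (restrict_scalars ?R ?W)"
    by (rule restrict_scalars_module[OF al.algebra_axioms Wm])
  have "submodule (T.pre_cycles \<inter> ?G j) K (restrict_scalars ?R ?W)"
  proof (rule module.submoduleI_no_inv[OF Wm'])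
    fix k x assume k: "k \<in> carrier K" and x: "x \<in> T.pre_cycles \<inter> ?G j"
    have k1: "k \<odot>\<^bsub>?R\<^esub> \<one>\<^bsub>?R\<^esub> \<in> Gr A S 0" using bij_betw_apply[OF Gr_0[OF S] k] by simp
    have "(k \<odot>\<^bsub>?R\<^esub> \<one>\<^bsub>?R\<^esub>) \<odot>\<^bsub>Obj (Term P (Suc q)) S\<^esub> x \<in> ?G (0 + j)"
      by (rule graded_cat_module.Gr_smult[OF Pg S k1]) (use x in simp)
    moreover have "(k \<odot>\<^bsub>?R\<^esub> \<one>\<^bsub>?R\<^esub>) \<odot>\<^bsub>Obj (Term P (Suc q)) S\<^esub> x \<in> T.pre_cycles"
      by (rule module.submoduleE(4)[OF Pm T.pre_cycles_submodule])
        (use x graded_group.G_subset[OF A_graded[OF S] k1] in simp_all)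
    ultimately show "k \<odot>\<^bsub>restrict_scalars ?R ?W\<^esub> x \<in> T.pre_cycles \<inter> ?G j"
      by (simp add: restrict_scalars_def)
  qed (use submodule_zero[OF T.pre_cycles_submodule] submodule_add[OF T.pre_cycles_submodule] G.G_zero G.G_add
      in \<open>auto simp: restrict_scalars_def\<close>)
  from submodule_image[OF restrict_scalars_linear[OF al.algebra_axioms T.homology_class_linear] Wm' Vm[unfolded V_def] this]
  have Y: "submodule ?Y K V" unfolding V_def .
  have Ym: "module K (V\<lparr>carrier := ?Y\<rparr>)" by (rule submodule.submodule_is_module[OF Y Vm])
  have betti: "betti K C A M S (Suc q) j = vdim K (V\<lparr>carrier := ?Y\<rparr>)"
    by (simp add: betti_def tor torGr V_def restrict_scalars_def Let_def)
  have "betti K C A M S (Suc q) j \<noteq> 0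
      \<longleftrightarrow> (\<exists>v \<in> carrier (V\<lparr>carrier := ?Y\<rparr>). v \<noteq> \<zero>\<^bsub>V\<lparr>carrier := ?Y\<rparr>\<^esub>)"
    unfolding betti by (rule vdim_nonzero_iff[OF K Ym])
  also have "\<dots> \<longleftrightarrow> (\<exists>x \<in> T.pre_cycles \<inter> ?G j. T.homology_class x \<noteq> \<zero>\<^bsub>T.homology\<^esub>)"
    by (simp add: V_def restrict_scalars_def)
  also have "\<dots> \<longleftrightarrow> (\<exists>x \<in> T.pre_cycles \<inter> ?G j. x \<notin> T.pre_boundaries)"
    using T.homology_class_zero_iff by auto
  also have "\<dots> \<longleftrightarrow> (\<exists>x \<in> ?G j.
      Diff P q S x \<in> ideal_smult (Obj A S) (Obj (Term P q) S) (max_ideal A S) \<and>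
      \<not> (\<exists>z \<in> carrier (Obj (Term P (Suc (Suc q))) S). x \<ominus>\<^bsub>Obj (Term P (Suc q)) S\<^esub> Diff P (Suc q) S z
          \<in> ideal_smult (Obj A S) (Obj (Term P (Suc q)) S) (max_ideal A S)))"
    using G.G_subset unfolding T.pre_cycles_def T.pre_boundaries_def ann by blast
  finally show ?thesis .
qed

end

section \<open>Factorisation of morphisms\<close>

text \<open>
  For a linear order \<open>r\<close>, the position of \<open>x\<close> in \<open>V\<close>, counted from \<open>1\<close>.
\<close>

definition rank :: "nat rel \<Rightarrow> nat set \<Rightarrow> nat \<Rightarrow> nat" where
  "rank r V x = card {y \<in> V. (y, x) \<in> r}"

lemma rank_mono:
  assumes V: "finite V" and r: "trans r" "antisym r" and x: "(x, y) \<in> r" "y \<in> V" "(y, y) \<in> r"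
  shows "rank r V x \<le> rank r V y" and "x \<noteq> y \<Longrightarrow> rank r V x < rank r V y"
proof -
  have sub: "{z \<in> V. (z, x) \<in> r} \<subseteq> {z \<in> V. (z, y) \<in> r}" using transD[OF r(1) _ x(1)] by blast
  then show "rank r V x \<le> rank r V y" unfolding rank_def by (rule card_mono[rotated]) (simp add: V)
  assume "x \<noteq> y"
  then have "y \<notin> {z \<in> V. (z, x) \<in> r}" using antisymD[OF r(2)] x(1) by blast
  then have "{z \<in> V. (z, x) \<in> r} \<subset> {z \<in> V. (z, y) \<in> r}" using sub x by blast
  then show "rank r V x < rank r V y" unfolding rank_def by (rule psubset_card_mono[rotated]) (simp add: V)
qed

lemma rank_bij:
  assumes V: "finite V" "V \<subseteq> U" and r: "linear_order_on U r"
  shows "bij_betw (rank r V) V {1..card V}"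
proof -
  have o: "trans r" "antisym r" using r by (auto simp: order_on_defs)
  have tot: "(x, y) \<in> r \<or> (y, x) \<in> r" if "x \<in> U" "y \<in> U" for x y
    using r that by (cases "x = y") (auto simp: order_on_defs total_on_def refl_on_def)
  have inj: "inj_on (rank r V) V"
  proof (rule inj_onI)
    fix x y assume a: "x \<in> V" "y \<in> V" "rank r V x = rank r V y"
    have xy: "(x, y) \<in> r \<or> (y, x) \<in> r" "(x, x) \<in> r" "(y, y) \<in> r" using tot[of x y] tot[of x x] tot[of y y] a V by auto
    show "x = y"
      using rank_mono(2)[OF V(1) o(1,2) _ a(2) xy(3), of x] rank_mono(2)[OF V(1) o(1,2) _ a(1) xy(2), of y] xy(1) a(3)
      by auto
  qed
  have "rank r V ` V \<subseteq> {1..card V}"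
  proof
    fix n assume "n \<in> rank r V ` V"
    then obtain x where x: "x \<in> V" "n = rank r V x" by auto
    have "x \<in> {y \<in> V. (y, x) \<in> r}" using x tot[of x x] V by auto
    then have "n \<noteq> 0" using V(1) x by (auto simp: rank_def)
    moreover have "n \<le> card V" unfolding x(2) rank_def by (rule card_mono) (use V in auto)
    ultimately show "n \<in> {1..card V}" by simp
  qed
  then have "rank r V ` V = {1..card V}" by (rule card_subset_eq[rotated]) (simp_all add: card_image[OF inj])
  with inj show ?thesis by (simp add: bij_betw_def)
qed

text \<open>
  For OI the morphism matches elements of equal rank.
\<close>

lemma mor_onto_subset:
  assumes S: "S \<in> objs C" and T: "T \<in> objs C" and V: "V \<subseteq> fst T" "card V = card (fst S)"
  obtains \<eta> where "\<eta> \<in> mor S T" "\<eta> ` fst S = V"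
proof (cases C)
  case FI
  have "finite V" using V(1) objs_finite[OF T] by (rule finite_subset)
  then obtain h where h: "bij_betw h (fst S) V"
    using finite_same_card_bij[OF objs_finite[OF S] _ V(2)[symmetric]] by blast
  have "restrict h (fst S) \<in> mor S T"
    using h V S by (auto simp: mor_def FI bij_betw_def inj_on_def)
  moreover have "restrict h (fst S) ` fst S = V" using h by (auto simp: bij_betw_def)
  ultimately show ?thesis by (rule that)
next
  case OI
  have lS: "linear_order_on (fst S) (snd S)" and lT: "linear_order_on (fst T) (snd T)"
    using S T by (auto simp: OI)
  have fV: "finite V" using V(1) objs_finite[OF T] by (rule finite_subset)
  let ?f = "rank (snd S) (fst S)" and ?g = "rank (snd T) V"
  have f: "bij_betw ?f (fst S) {1..card (fst S)}" by (rule rank_bij[OF objs_finite[OF S] subset_refl lS])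
  have g: "bij_betw ?g V {1..card (fst S)}" using rank_bij[OF fV V(1) lT] V(2) by simp
  define h where "h = restrict (\<lambda>x. inv_into V ?g (?f x)) (fst S)"
  have bij: "bij_betw h (fst S) V"
    using bij_betw_trans[OF f bij_betw_inv_into[OF g]] unfolding h_def
    by (subst bij_betw_restrict_eq) (simp add: comp_def)
  have gh: "?g (h x) = ?f x" if "x \<in> fst S" for x
    using that g bij_betw_apply[OF f that] by (auto simp: h_def bij_betw_def intro: f_inv_into_f)
  have "(h x, h y) \<in> snd T" if xy: "(x, y) \<in> snd S" for x y
  proof (rule ccontr)
    assume n: "(h x, h y) \<notin> snd T"
    have x: "x \<in> fst S" "y \<in> fst S" using xy objs_rel[OF S] by auto
    have hV: "h x \<in> V" "h y \<in> V" using bij_betw_apply[OF bij] x by auto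
    then have hT: "h x \<in> fst T" "h y \<in> fst T" using V by auto
    have oT: "trans (snd T)" "antisym (snd T)" "refl_on (fst T) (snd T)" "total_on (fst T) (snd T)"
      and oS: "trans (snd S)" "antisym (snd S)" "refl_on (fst S) (snd S)"
      using lS lT by (auto simp: order_on_defs)
    have ne: "h x \<noteq> h y" using n refl_onD[OF oT(3) hT(1)] by auto
    then have "(h y, h x) \<in> snd T" using n oT(4) hT by (auto simp: total_on_def)
    then have "?g (h y) < ?g (h x)"
      using rank_mono(2)[OF fV oT(1,2) _ hV(1) refl_onD[OF oT(3) hT(1)]] ne by auto
    moreover have "?f x \<le> ?f y"
      by (rule rank_mono(1)[OF objs_finite[OF S] oS(1,2) xy x(2) refl_onD[OF oS(3) x(2)]])
    ultimately show False using gh x by simp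
  qed
  moreover have "h \<in> fst S \<rightarrow>\<^sub>E fst T" using bij V by (auto simp: h_def bij_betw_def)
  moreover have "inj_on h (fst S)" using bij by (simp add: bij_betw_def)
  ultimately have "h \<in> mor S T" by (auto simp: mor_def)
  moreover have "h ` fst S = V" using bij by (simp add: bij_betw_def)
  ultimately show ?thesis by (rule that)
qed

text \<open>
  Enlarge the image of \<open>\<epsilon>\<close> to a subset of \<open>T\<close> of the size of \<open>S\<close>, and let \<open>\<eta>\<close> map \<open>S\<close> onto it.  That
  \<open>\<delta> = \<eta>\<inverse>\<epsilon>\<close> preserves the order is seen by contradiction, since the orders are total.
\<close>

lemma mor_factor:
  assumes D: "D \<in> objs C" and S: "S \<in> objs C" and T: "T \<in> objs C"
    and card: "card (fst D) \<le> card (fst S)" "card (fst S) \<le> card (fst T)" and \<epsilon>: "\<epsilon> \<in> mor D T"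
  obtains \<delta> \<eta> where "\<delta> \<in> mor D S" "\<eta> \<in> mor S T" "\<epsilon> = comp_mor D \<eta> \<delta>"
proof -
  note fin = objs_finite[OF D] objs_finite[OF S] objs_finite[OF T]
  let ?U = "\<epsilon> ` fst D"
  have inj: "inj_on \<epsilon> (fst D)" and UT: "?U \<subseteq> fst T" using \<epsilon> by (auto simp: mor_def)
  have cU: "card ?U = card (fst D)" using inj by (rule card_image)
  have "card (fst S) - card ?U \<le> card (fst T - ?U)"
    using card cU fin UT by (simp add: card_Diff_subset finite_subset)
  then obtain W where W: "W \<subseteq> fst T - ?U" "card W = card (fst S) - card ?U" by (meson obtain_subset_with_card_n)
  have "card (?U \<union> W) = card (fst S)"
    using W fin card cU by (subst card_Un_disjoint) (auto intro: finite_subset)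
  then obtain \<eta> where \<eta>: "\<eta> \<in> mor S T" "\<eta> ` fst S = ?U \<union> W"
    using mor_onto_subset[OF S T, of "?U \<union> W"] UT W by blast
  define \<delta> where "\<delta> = (\<lambda>x \<in> fst D. inv_into (fst S) \<eta> (\<epsilon> x))"
  have \<delta>: "\<delta> x \<in> fst S" "\<eta> (\<delta> x) = \<epsilon> x" if "x \<in> fst D" for x
  proof -
    have "\<epsilon> x \<in> \<eta> ` fst S" using that \<eta>(2) by auto
    then show "\<delta> x \<in> fst S" "\<eta> (\<delta> x) = \<epsilon> x"
      using that by (simp_all add: \<delta>_def inv_into_into f_inv_into_f)
  qed
  have inj\<delta>: "inj_on \<delta> (fst D)"
  proof (rule inj_onI)
    fix x y assume "x \<in> fst D" "y \<in> fst D" "\<delta> x = \<delta> y"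
    then show "x = y" using \<delta>(2) inj by (metis inj_onD)
  qed
  have ord: "(\<delta> x, \<delta> y) \<in> snd S" if xy: "(x, y) \<in> snd D" for x y
  proof (cases C)
    case FI
    then show ?thesis using xy D by auto
  next
    case OI
    have x: "x \<in> fst D" "y \<in> fst D" using xy objs_rel[OF D] by auto
    have lS: "linear_order_on (fst S) (snd S)" and lT: "linear_order_on (fst T) (snd T)"
      using S T by (auto simp: OI)
    show ?thesis
    proof (rule ccontr)
      assume n: "(\<delta> x, \<delta> y) \<notin> snd S"
      have tot: "total_on (fst S) (snd S)" "refl_on (fst S) (snd S)" "antisym (snd T)"
        using lS lT by (auto simp: order_on_defs)
      have "\<delta> x \<noteq> \<delta> y" using n refl_onD[OF tot(2) \<delta>(1)[OF x(1)]] by auto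
      then have "(\<delta> y, \<delta> x) \<in> snd S" using n tot(1) \<delta>(1) x by (auto simp: total_on_def)
      then have "(\<epsilon> y, \<epsilon> x) \<in> snd T" using \<eta>(1) \<delta>(2) x by (force simp: mor_def)
      moreover have "(\<epsilon> x, \<epsilon> y) \<in> snd T" using \<epsilon> xy by (auto simp: mor_def)
      ultimately have "\<epsilon> y = \<epsilon> x" by (rule antisymD[OF tot(3)])
      then have "x = y" using inj x by (auto dest: inj_onD)
      then show False using \<open>\<delta> x \<noteq> \<delta> y\<close> by simp
    qed
  qed
  have "\<delta> \<in> fst D \<rightarrow>\<^sub>E fst S" using \<delta>(1) by (simp add: PiE_iff) (simp add: \<delta>_def)
  then have "\<delta> \<in> mor D S" using inj\<delta> ord by (auto simp: mor_def)
  moreover have "\<epsilon> = comp_mor D \<eta> \<delta>"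
    using \<epsilon> \<delta>(2) by (auto simp: mor_def compose_def fun_eq_iff PiE_iff extensional_def)
  ultimately show ?thesis using \<eta>(1) that by blast
qed

section \<open>Cycles and boundaries modulo the irrelevant ideal\<close>

lemma graded_free_basis:
  assumes P: "graded_cat_module C A P" and free: "graded_free C A P" and S: "S \<in> objs C"
  shows "\<exists>X (g :: obj \<times> 'p \<times> (nat \<Rightarrow> nat) \<Rightarrow> 'p). module_basis (Obj A S) (Obj P S) X g"
proof -
  interpret P: graded_cat_module C A P by (rule P)
  obtain B where B1: "\<forall>(D, b) \<in> B. D \<in> objs C \<and> (\<exists>d. b \<in> Gr P D d)"
    and B2: "\<forall>T \<in> objs C. \<forall>x \<in> carrier (Obj P T). \<exists>!c.
      c \<in> carrier (free_module (Obj A T) {(D, b, \<epsilon>). (D, b) \<in> B \<and> \<epsilon> \<in> mor D T}) \<and>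
      x = finsum (Obj P T) (\<lambda>(D, b, \<epsilon>). c (D, b, \<epsilon>) \<odot>\<^bsub>Obj P T\<^esub> Map P D T \<epsilon> b)
            {z. c z \<noteq> \<zero>\<^bsub>Obj A T\<^esub>}"
    using free unfolding graded_free_def by (elim exE conjE)
  let ?X = "{(D, b, \<epsilon>). (D, b) \<in> B \<and> \<epsilon> \<in> mor D S}"
  let ?g = "\<lambda>(D, b, \<epsilon>). Map P D S \<epsilon> b"
  have "?g \<in> ?X \<rightarrow> carrier (Obj P S)"
  proof (rule Pi_I, clarify)
    fix D b \<epsilon> assume b: "(D, b) \<in> B" and \<epsilon>: "\<epsilon> \<in> mor D S"
    then obtain d where D: "D \<in> objs C" "b \<in> Gr P D d" using B1 by auto
    show "Map P D S \<epsilon> b \<in> carrier (Obj P S)"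
      by (rule P.Map_closed[OF D(1) S \<epsilon> graded_group.G_subset[OF P.M_graded[OF D(1)] D(2)]])
  qed
  moreover have "\<forall>x \<in> carrier (Obj P S). \<exists>!c. c \<in> carrier (free_module (Obj A S) ?X) \<and> x = lin_comb (Obj A S) (Obj P S) ?g c"
    using bspec[OF B2 S] unfolding lin_comb_def by (simp add: case_prod_unfold)
  ultimately show ?thesis unfolding module_basis_def by blast
qed

text \<open>
  The set is the sum \<open>H + H'\<close>, seen as the preimage of the image of \<open>H\<close> in \<open>M/H'\<close>.
\<close>

lemma submodule_sum:
  assumes M: "module R M" and H: "submodule H R M" and H': "submodule H' R M"
  shows "submodule {x \<in> carrier M. \<exists>y \<in> H. x \<ominus>\<^bsub>M\<^esub> y \<in> H'} R M"
proof -
  interpret M: module R M by (rule M)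
  note q = M.quotient_module_linear[OF H'] and Q = M.quotient_module_module[OF H']
  have "{x \<in> carrier M. \<exists>y \<in> H. x \<ominus>\<^bsub>M\<^esub> y \<in> H'} = {x \<in> carrier M. H' +>\<^bsub>M\<^esub> x \<in> (\<lambda>x. H' +>\<^bsub>M\<^esub> x) ` H}"
    using M.coset_eq_iff[OF H'] submodule_subset[OF H] by (auto simp: image_iff subset_iff)
  then show ?thesis using submodule_vimage[OF q M Q submodule_image[OF q M Q H]] by simp
qed

lemma (in module) submodule_diff_cancel:
  assumes "submodule H R M" "x \<in> carrier M" "y \<in> H" "x \<ominus>\<^bsub>M\<^esub> y \<in> H" shows "x \<in> H"
proof -
  have "x = (x \<ominus>\<^bsub>M\<^esub> y) \<oplus>\<^bsub>M\<^esub> y"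
    using assms submodule_subset[OF assms(1)] by (auto simp: a_minus_def M.a_assoc M.l_neg)
  then show ?thesis using submodule_add[OF assms(1,4,3)] by simp
qed

context standard_graded_algebra
begin

text \<open>
  The submodule \<open>\<mm>N\<close>.
\<close>

definition mP :: "('a, 'm) gfunctr \<Rightarrow> obj \<Rightarrow> 'm set" where
  "mP N S = ideal_smult (Obj A S) (Obj N S) (max_ideal A S)"

lemma Map_max_ideal:
  assumes a: "S \<in> objs C" "T \<in> objs C" "\<eta> \<in> mor S T" and x: "x \<in> max_ideal A S"
  shows "Map A S T \<eta> x \<in> max_ideal A T"
proof -
  have xc: "x \<in> carrier (Obj A S)" using x max_ideal_subset[OF a(1)] by blast
  have gr: "Map A S T \<eta> y \<in> Gr A T (d + 0)" if "y \<in> Gr A S d" for y d using Gr_Map[OF a, of d] that by auto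
  have "hcomp (Obj A T) (Gr A T) (Map A S T \<eta> x) d = Map A S T \<eta> (hcomp (Obj A S) (Gr A S) x (d - 0))" for d
    by (rule hcomp_shift[OF A_graded[OF a(1)] A_graded[OF a(2)] Map_hom(1,2)[OF a] gr xc])
  then show ?thesis
    using x Map_hom(1,5)[OF a] unfolding max_ideal_eq[OF a(1)] max_ideal_eq[OF a(2)] by simp
qed

context
  fixes N :: "('a, 'm) gfunctr"
  assumes N: "graded_cat_module C A N"
begin

interpretation N: graded_cat_module C A N by (rule N)

lemma mP_submodule: "S \<in> objs C \<Longrightarrow> submodule (mP N S) (Obj A S) (Obj N S)"
  unfolding mP_def by (rule ideal_smult_submodule[OF N.module_Obj max_ideal_subset])

lemma mP_cat_submodule: "cat_submodule C A N (mP N)"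
proof (rule cat_submoduleI[OF mP_submodule])
  fix S T \<eta> x assume a: "S \<in> objs C" "T \<in> objs C" "\<eta> \<in> mor S T" and x: "x \<in> mP N S"
  have "{a \<odot>\<^bsub>Obj N S\<^esub> x |a x. a \<in> max_ideal A S \<and> x \<in> carrier (Obj N S)}
      \<subseteq> {y \<in> carrier (Obj N S). Map N S T \<eta> y \<in> mP N T}"
  proof clarify
    fix b y assume b: "b \<in> max_ideal A S" and y: "y \<in> carrier (Obj N S)"
    have bc: "b \<in> carrier (Obj A S)" using b max_ideal_subset[OF a(1)] by blast
    have "b \<odot>\<^bsub>Obj N S\<^esub> y \<in> carrier (Obj N S)" using module.smult_closed[OF N.module_Obj[OF a(1)] bc y] .
    moreover have "Map N S T \<eta> (b \<odot>\<^bsub>Obj N S\<^esub> y) \<in> mP N T"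
      unfolding cat_module_smult[OF cat_algebra_axioms N.cat_module_axioms a bc y] mP_def
      by (rule ideal_smultI[OF Map_max_ideal[OF a b] N.Map_closed[OF a y]])
    ultimately show "b \<odot>\<^bsub>Obj N S\<^esub> y \<in> carrier (Obj N S) \<and> Map N S T \<eta> (b \<odot>\<^bsub>Obj N S\<^esub> y) \<in> mP N T" by simp
  qed
  from module_span_least[OF N.Map_vimage_submodule[OF cat_algebra_axioms a mP_submodule[OF a(2)]] this]
  show "Map N S T \<eta> x \<in> mP N T" using x unfolding mP_def ideal_smult_def by auto
qed

lemma hcomp_smult:
  assumes S: "S \<in> objs C" and a: "a \<in> carrier (Obj A S)" and w: "w \<in> Gr N S i"
  shows "hcomp (Obj N S) (Gr N S) (a \<odot>\<^bsub>Obj N S\<^esub> w) d = hcomp (Obj A S) (Gr A S) a (d - i) \<odot>\<^bsub>Obj N S\<^esub> w"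
proof -
  interpret NS: module "Obj A S" "Obj N S" by (rule N.module_Obj[OF S])
  have wc: "w \<in> carrier (Obj N S)" by (rule graded_group.G_subset[OF N.M_graded[OF S] w])
  show ?thesis
    by (rule hcomp_shift[OF A_graded[OF S] N.M_graded[OF S], where f = "\<lambda>a. a \<odot>\<^bsub>Obj N S\<^esub> w"])
      (use wc a N.Gr_smult[OF S _ w] in \<open>simp_all add: NS.smult_l_distr\<close>)
qed

text \<open>The elements all of whose multiples have their degree \<open>d\<close> component in \<open>H\<close> form a
  submodule even though taking components is not linear.\<close>

lemma hcomp_multiples_submodule:
  assumes S: "S \<in> objs C" and H: "submodule H (Obj A S) (Obj N S)"
  shows "submodule {u \<in> carrier (Obj N S). \<forall>a \<in> carrier (Obj A S).
    hcomp (Obj N S) (Gr N S) (a \<odot>\<^bsub>Obj N S\<^esub> u) d \<in> H} (Obj A S) (Obj N S)"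
proof -
  interpret NS: module "Obj A S" "Obj N S" by (rule N.module_Obj[OF S])
  interpret G: graded_group "Obj N S" "Gr N S" by (rule N.M_graded[OF S])
  show ?thesis
    by (rule NS.submoduleI_no_inv)
      (use submodule_zero[OF H] submodule_add[OF H] in
        \<open>auto simp: G.hcomp_zero NS.smult_r_distr G.hcomp_add NS.smult_assoc1[symmetric]\<close>)
qed

text \<open>
  For a product \<open>by\<close> with \<open>b \<in> \<mm>\<close> decompose \<open>y\<close>: the components of \<open>by\<close> are sums of components of \<open>b\<close>,
  which are in \<open>\<mm>\<close>, times components of \<open>y\<close>.  Such products span \<open>\<mm>N\<close>.
\<close>

lemma hcomp_mP:
  assumes S: "S \<in> objs C" and x: "x \<in> mP N S"
  shows "hcomp (Obj N S) (Gr N S) x d \<in> mP N S"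
proof -
  interpret NS: module "Obj A S" "Obj N S" by (rule N.module_Obj[OF S])
  interpret G: graded_group "Obj N S" "Gr N S" by (rule N.M_graded[OF S])
  let ?h = "hcomp (Obj N S) (Gr N S)"
  let ?H = "{u \<in> carrier (Obj N S). \<forall>a \<in> carrier (Obj A S). ?h (a \<odot>\<^bsub>Obj N S\<^esub> u) d \<in> mP N S}"
  have mult: "?h (b \<odot>\<^bsub>Obj N S\<^esub> y) d \<in> mP N S" if b: "b \<in> max_ideal A S" and y: "y \<in> carrier (Obj N S)" for b y
  proof -
    have bc: "b \<in> carrier (Obj A S)" using b max_ideal_subset[OF S] by blast
    let ?I = "{e. ?h y e \<noteq> \<zero>\<^bsub>Obj N S\<^esub>}"
    have "b \<odot>\<^bsub>Obj N S\<^esub> y = b \<odot>\<^bsub>Obj N S\<^esub> finsum (Obj N S) (?h y) ?I" using G.hcomp_props(3)[OF y] by simp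
    also have "\<dots> = finsum (Obj N S) (\<lambda>e. b \<odot>\<^bsub>Obj N S\<^esub> ?h y e) ?I"
      by (rule NS.finsum_smult_ldistr) (use G.hcomp_props(2)[OF y] G.hcomp_closed[OF y] bc in auto)
    finally have "?h (b \<odot>\<^bsub>Obj N S\<^esub> y) d = finsum (Obj N S) (\<lambda>e. ?h (b \<odot>\<^bsub>Obj N S\<^esub> ?h y e) d) ?I"
      using G.hcomp_finsum[of ?I "\<lambda>e. b \<odot>\<^bsub>Obj N S\<^esub> ?h y e" d] G.hcomp_closed[OF y] bc by simp
    also have "\<dots> \<in> mP N S"
    proof (rule submodule_finsum[OF mP_submodule[OF S] N.module_Obj[OF S]])
      fix e
      show "?h (b \<odot>\<^bsub>Obj N S\<^esub> ?h y e) d \<in> mP N S"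
        unfolding hcomp_smult[OF S bc G.hcomp_props(1)[OF y]] mP_def
        by (rule ideal_smultI[OF max_ideal_hcomp[OF S b] G.hcomp_closed[OF y]])
    qed
    finally show ?thesis .
  qed
  have "{b \<odot>\<^bsub>Obj N S\<^esub> y |b y. b \<in> max_ideal A S \<and> y \<in> carrier (Obj N S)} \<subseteq> ?H"
  proof clarify
    fix b y assume b: "b \<in> max_ideal A S" and y: "y \<in> carrier (Obj N S)"
    have bc: "b \<in> carrier (Obj A S)" using b max_ideal_subset[OF S] by blast
    have "?h (a \<odot>\<^bsub>Obj N S\<^esub> (b \<odot>\<^bsub>Obj N S\<^esub> y)) d \<in> mP N S" if a: "a \<in> carrier (Obj A S)" for a
    proof -
      have "a \<otimes>\<^bsub>Obj A S\<^esub> b \<in> max_ideal A S"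
        using module.submoduleE(4)[OF self_module_module[OF S] max_ideal_submodule[OF S] a b]
        by (simp add: self_module_simps)
      then show ?thesis unfolding NS.smult_assoc1[OF a bc y, symmetric] using y by (rule mult)
    qed
    then show "b \<odot>\<^bsub>Obj N S\<^esub> y \<in> carrier (Obj N S) \<and> (\<forall>a \<in> carrier (Obj A S).
        ?h (a \<odot>\<^bsub>Obj N S\<^esub> (b \<odot>\<^bsub>Obj N S\<^esub> y)) d \<in> mP N S)" using bc y by simp
  qed
  from module_span_least[OF hcomp_multiples_submodule[OF S mP_submodule[OF S]] this]
  have "x \<in> ?H" using x unfolding mP_def ideal_smult_def by auto
  then have "x \<in> carrier (Obj N S)" "?h (\<one>\<^bsub>Obj A S\<^esub> \<odot>\<^bsub>Obj N S\<^esub> x) d \<in> mP N S"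
    using NS.R.one_closed by blast+
  then show ?thesis by simp
qed

end

lemma mP_hom:
  assumes F: "graded_cat_module C A F" and N: "graded_cat_module C A N" and f: "graded_hom C A F N f"
    and S: "S \<in> objs C" and x: "x \<in> mP F S"
  shows "f S x \<in> mP N S"
  unfolding mP_def
  by (rule ideal_smult_linear[OF cat_hom_linear[OF graded_hom_cat_hom[OF f] S]
        cat_module.module_Obj[OF graded_cat_module.axioms(1)[OF F] S]
        cat_module.module_Obj[OF graded_cat_module.axioms(1)[OF N] S] max_ideal_subset[OF S] x[unfolded mP_def]])

end

text \<open>
  The cycles \<open>Z\<close> and boundaries \<open>B\<close> modulo \<open>\<mm>\<close>, whose quotient is \<open>Tor\<close>, as submodules of the middle
  term of a graded complex.
\<close>

locale graded_complex3 = standard_graded_algebra K C A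
  for K :: "'k ring" and C and A :: "('k, 'a) gfunctr" +
  fixes P2 P1 P0 :: "('a, 'p) gfunctr" and d1 d0 :: "obj \<Rightarrow> 'p \<Rightarrow> 'p"
  assumes P2: "graded_cat_module C A P2" and P1: "graded_cat_module C A P1" and P0: "graded_cat_module C A P0"
    and d1: "graded_hom C A P2 P1 d1" and d0: "graded_hom C A P1 P0 d0"
    and d0_d1: "\<lbrakk>S \<in> objs C; x \<in> carrier (Obj P2 S)\<rbrakk> \<Longrightarrow> d0 S (d1 S x) = \<zero>\<^bsub>Obj P0 S\<^esub>"
begin

definition Z :: "obj \<Rightarrow> 'p set" where
  "Z S = {x \<in> carrier (Obj P1 S). d0 S x \<in> mP P0 S}"

definition B :: "obj \<Rightarrow> 'p set" where
  "B S = {x \<in> carrier (Obj P1 S). \<exists>y \<in> d1 S ` carrier (Obj P2 S). x \<ominus>\<^bsub>Obj P1 S\<^esub> y \<in> mP P1 S}"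

lemma B_I: "\<lbrakk>x \<in> carrier (Obj P1 S); y \<in> d1 S ` carrier (Obj P2 S); x \<ominus>\<^bsub>Obj P1 S\<^esub> y \<in> mP P1 S\<rbrakk> \<Longrightarrow> x \<in> B S"
  unfolding B_def by blast

sublocale P1: graded_cat_module C A P1 by (rule P1)

lemma cat_modules: "cat_module C A P2" "cat_module C A P1" "cat_module C A P0"
  using P2 P1 P0 by (simp_all add: graded_cat_module.axioms(1))

lemma Z_cat_submodule: "cat_submodule C A P1 Z"
  using cat_submodule_vimage[OF cat_modules(2,3) graded_hom_cat_hom[OF d0] mP_cat_submodule[OF P0]]
  by (simp add: Z_def[abs_def])

lemma Z_hcomp:
  assumes S: "S \<in> objs C" and x: "x \<in> Z S" shows "hcomp (Obj P1 S) (Gr P1 S) x d \<in> Z S"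
proof -
  have xc: "x \<in> carrier (Obj P1 S)" using x by (simp add: Z_def)
  show ?thesis
    using x graded_group.hcomp_closed[OF P1.M_graded[OF S] xc] hcomp_mP[OF P0 S, of "d0 S x" d]
      graded_hom_hcomp[OF P1 P0 d0 S xc, of d] by (simp add: Z_def)
qed

lemma image_cat_submodule: "cat_submodule C A P1 (\<lambda>S. d1 S ` carrier (Obj P2 S))"
  by (rule cat_submodule_image[OF cat_modules(1,2) graded_hom_cat_hom[OF d1] cat_submodule_full[OF cat_modules(1)]])

lemma B_submodule: "S \<in> objs C \<Longrightarrow> submodule (B S) (Obj A S) (Obj P1 S)"
  unfolding B_def
  by (rule submodule_sum[OF P1.module_Obj cat_submoduleD(1)[OF image_cat_submodule] mP_submodule[OF P1]])

lemma B_Map: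
  assumes a: "S \<in> objs C" "T \<in> objs C" "\<eta> \<in> mor S T" and x: "x \<in> B S"
  shows "Map P1 S T \<eta> x \<in> B T"
proof -
  interpret PS: module "Obj A S" "Obj P1 S" by (rule P1.module_Obj[OF a(1)])
  interpret PT: module "Obj A T" "Obj P1 T" by (rule P1.module_Obj[OF a(2)])
  obtain y where y: "y \<in> d1 S ` carrier (Obj P2 S)" "x \<ominus>\<^bsub>Obj P1 S\<^esub> y \<in> mP P1 S" and xc: "x \<in> carrier (Obj P1 S)"
    using x by (auto simp: B_def)
  have yc: "y \<in> carrier (Obj P1 S)" by (rule cat_submodule_carrier[OF image_cat_submodule a(1) y(1)])
  let ?M = "Map P1 S T \<eta>"
  have c: "?M x \<in> carrier (Obj P1 T)" "?M y \<in> carrier (Obj P1 T)" "?M (x \<ominus>\<^bsub>Obj P1 S\<^esub> y) \<in> carrier (Obj P1 T)"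
    using P1.Map_closed[OF a] xc yc by simp_all
  have "?M ((x \<ominus>\<^bsub>Obj P1 S\<^esub> y) \<oplus>\<^bsub>Obj P1 S\<^esub> y) = ?M (x \<ominus>\<^bsub>Obj P1 S\<^esub> y) \<oplus>\<^bsub>Obj P1 T\<^esub> ?M y"
    using P1.Map_add[OF a] xc yc by simp
  moreover have "(x \<ominus>\<^bsub>Obj P1 S\<^esub> y) \<oplus>\<^bsub>Obj P1 S\<^esub> y = x"
    using xc yc by (simp add: a_minus_def PS.M.a_assoc PS.M.l_neg)
  ultimately have "?M x \<ominus>\<^bsub>Obj P1 T\<^esub> ?M y = ?M (x \<ominus>\<^bsub>Obj P1 S\<^esub> y)"
    using c by (simp add: a_minus_def PT.M.a_assoc PT.M.r_neg)
  then have "?M x \<ominus>\<^bsub>Obj P1 T\<^esub> ?M y \<in> mP P1 T"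
    using cat_submoduleD(2)[OF mP_cat_submodule[OF P1] a y(2)] by simp
  then show ?thesis by (rule B_I[OF c(1) cat_submoduleD(2)[OF image_cat_submodule a y(1)]])
qed

lemma B_hcomp:
  assumes S: "S \<in> objs C" and x: "x \<in> B S" shows "hcomp (Obj P1 S) (Gr P1 S) x d \<in> B S"
proof -
  interpret PS: module "Obj A S" "Obj P1 S" by (rule P1.module_Obj[OF S])
  interpret G: graded_group "Obj P1 S" "Gr P1 S" by (rule P1.M_graded[OF S])
  let ?h = "hcomp (Obj P1 S) (Gr P1 S)"
  obtain z where z: "z \<in> carrier (Obj P2 S)" "x \<ominus>\<^bsub>Obj P1 S\<^esub> d1 S z \<in> mP P1 S" and xc: "x \<in> carrier (Obj P1 S)"
    using x by (auto simp: B_def)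
  have dz: "d1 S z \<in> carrier (Obj P1 S)" using cat_submodule_carrier[OF image_cat_submodule S] z(1) by auto
  have hz: "?h (d1 S z) d = d1 S (hcomp (Obj P2 S) (Gr P2 S) z d)" by (rule graded_hom_hcomp[OF P2 P1 d1 S z(1)])
  have "(x \<ominus>\<^bsub>Obj P1 S\<^esub> d1 S z) \<oplus>\<^bsub>Obj P1 S\<^esub> d1 S z = x"
    using xc dz by (simp add: a_minus_def PS.M.a_assoc PS.M.l_neg)
  then have "?h x d = ?h (x \<ominus>\<^bsub>Obj P1 S\<^esub> d1 S z) d \<oplus>\<^bsub>Obj P1 S\<^esub> ?h (d1 S z) d"
    using G.hcomp_add[of "x \<ominus>\<^bsub>Obj P1 S\<^esub> d1 S z" "d1 S z" d] xc dz by simp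
  then have "?h x d \<ominus>\<^bsub>Obj P1 S\<^esub> ?h (d1 S z) d = ?h (x \<ominus>\<^bsub>Obj P1 S\<^esub> d1 S z) d"
    using xc dz G.hcomp_closed by (simp add: a_minus_def PS.M.a_assoc PS.M.r_neg)
  then have "?h x d \<ominus>\<^bsub>Obj P1 S\<^esub> d1 S (hcomp (Obj P2 S) (Gr P2 S) z d) \<in> mP P1 S"
    using hcomp_mP[OF P1 S z(2)] hz by simp
  then show ?thesis
    using G.hcomp_closed[OF xc] graded_group.hcomp_closed[OF graded_cat_module.M_graded[OF P2 S] z(1)]
    unfolding B_def by blast
qed

lemma image_B: "S \<in> objs C \<Longrightarrow> z \<in> carrier (Obj P2 S) \<Longrightarrow> d1 S z \<in> B S"
proof -
  assume S: "S \<in> objs C" and z: "z \<in> carrier (Obj P2 S)"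
  interpret PS: module "Obj A S" "Obj P1 S" by (rule P1.module_Obj[OF S])
  have dz: "d1 S z \<in> carrier (Obj P1 S)" using cat_submodule_carrier[OF image_cat_submodule S] z by auto
  then have "d1 S z \<ominus>\<^bsub>Obj P1 S\<^esub> d1 S z \<in> mP P1 S"
    using submodule_zero[OF mP_submodule[OF P1 S]] by (simp add: a_minus_def PS.M.r_neg)
  then show ?thesis using dz z unfolding B_def by blast
qed

lemma mP_B: "S \<in> objs C \<Longrightarrow> mP P1 S \<subseteq> B S"
proof
  fix x assume S: "S \<in> objs C" and x: "x \<in> mP P1 S"
  interpret PS: module "Obj A S" "Obj P1 S" by (rule P1.module_Obj[OF S])
  have z: "\<zero>\<^bsub>Obj P1 S\<^esub> \<in> d1 S ` carrier (Obj P2 S)"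
    by (rule submodule_zero[OF cat_submoduleD(1)[OF image_cat_submodule S]])
  have xc: "x \<in> carrier (Obj P1 S)" using submodule_subset[OF mP_submodule[OF P1 S]] x by blast
  have "\<ominus>\<^bsub>Obj P1 S\<^esub> \<zero>\<^bsub>Obj P1 S\<^esub> = \<zero>\<^bsub>Obj P1 S\<^esub>" by (rule PS.M.minus_equality) simp_all
  then have "x \<ominus>\<^bsub>Obj P1 S\<^esub> \<zero>\<^bsub>Obj P1 S\<^esub> = x" using xc by (simp add: a_minus_def)
  then show "x \<in> B S" using x by (intro B_I[OF xc z]) simp
qed

lemma B_subset_Z: assumes S: "S \<in> objs C" shows "B S \<subseteq> Z S"
proof
  fix x assume "x \<in> B S"
  then obtain z where z: "z \<in> carrier (Obj P2 S)" "x \<ominus>\<^bsub>Obj P1 S\<^esub> d1 S z \<in> mP P1 S" and xc: "x \<in> carrier (Obj P1 S)"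
    by (auto simp: B_def)
  have dz: "d1 S z \<in> carrier (Obj P1 S)" using cat_submodule_carrier[OF image_cat_submodule S] z(1) by auto
  have sub: "submodule (Z S) (Obj A S) (Obj P1 S)" by (rule cat_submoduleD(1)[OF Z_cat_submodule S])
  have "d1 S z \<in> Z S"
    using dz d0_d1[OF S z(1)] submodule_zero[OF mP_submodule[OF P0 S]] by (simp add: Z_def)
  moreover have "x \<ominus>\<^bsub>Obj P1 S\<^esub> d1 S z \<in> Z S"
    using mP_hom[OF P1 P0 d0 S z(2)] submodule_subset[OF mP_submodule[OF P1 S]] z(2) by (auto simp: Z_def)
  ultimately show "x \<in> Z S" using module.submodule_diff_cancel[OF P1.module_Obj[OF S] sub xc] by simp
qed

text \<open>
  Modulo \<open>B\<close>, the cycles are spanned by the translates of the homogeneous elements \<open>w\<close>.  Quantifying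
  over the submodules \<open>H\<close> that contain both avoids sums of spans.
\<close>

definition spanning :: "(nat \<times> int \<times> 'p) set \<Rightarrow> bool" where
  "spanning W \<longleftrightarrow> finite W \<and>
    (\<forall>n d w. (n, d, w) \<in> W \<longrightarrow> w \<in> Gr P1 (interval_obj C n) d \<and> w \<in> Z (interval_obj C n)) \<and>
    (\<forall>S \<in> objs C. \<forall>H. submodule H (Obj A S) (Obj P1 S) \<longrightarrow> B S \<subseteq> H \<longrightarrow>
      (\<forall>n d w \<epsilon>. (n, d, w) \<in> W \<longrightarrow> \<epsilon> \<in> mor (interval_obj C n) S \<longrightarrow>
        Map P1 (interval_obj C n) S \<epsilon> w \<in> H) \<longrightarrow> Z S \<subseteq> H)"

lemma spanningD:
  assumes "spanning W"
  shows "finite W"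
    and "(n, d, w) \<in> W \<Longrightarrow> w \<in> Gr P1 (interval_obj C n) d"
    and "(n, d, w) \<in> W \<Longrightarrow> w \<in> Z (interval_obj C n)"
    and "\<lbrakk>S \<in> objs C; submodule H (Obj A S) (Obj P1 S); B S \<subseteq> H;
      \<forall>n d w \<epsilon>. (n, d, w) \<in> W \<longrightarrow> \<epsilon> \<in> mor (interval_obj C n) S \<longrightarrow>
        Map P1 (interval_obj C n) S \<epsilon> w \<in> H\<rbrakk> \<Longrightarrow> Z S \<subseteq> H"
  using assms unfolding spanning_def by simp_all

text \<open>
  A multiple of a translate of \<open>w\<close> has in degree \<open>j\<close> the component \<open>a\<^sub>j\<^sub>-\<^sub>d \<cdot> w\<close>, where \<open>d\<close> is the degree of
  \<open>w\<close>.  It is zero for \<open>j < d\<close> and in \<open>\<mm>P \<subseteq> B\<close> for \<open>j > d\<close>, so only generators of degree \<open>j\<close> matter.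
\<close>

lemma spanning_degree:
  assumes W: "spanning W" and S: "S \<in> objs C" and H: "submodule H (Obj A S) (Obj P1 S)" "B S \<subseteq> H"
    and gen: "\<And>n w \<epsilon>. \<lbrakk>(n, j, w) \<in> W; \<epsilon> \<in> mor (interval_obj C n) S\<rbrakk> \<Longrightarrow> Map P1 (interval_obj C n) S \<epsilon> w \<in> H"
  shows "Z S \<inter> Gr P1 S j \<subseteq> H"
proof
  fix x assume x: "x \<in> Z S \<inter> Gr P1 S j"
  interpret PS: module "Obj A S" "Obj P1 S" by (rule P1.module_Obj[OF S])
  interpret G: graded_group "Obj P1 S" "Gr P1 S" by (rule P1.M_graded[OF S])
  interpret GA: graded_group "Obj A S" "Gr A S" by (rule A_graded[OF S])
  let ?h = "hcomp (Obj P1 S) (Gr P1 S)"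
  let ?H = "{u \<in> carrier (Obj P1 S). \<forall>a \<in> carrier (Obj A S). ?h (a \<odot>\<^bsub>Obj P1 S\<^esub> u) j \<in> H}"
  have sub: "submodule ?H (Obj A S) (Obj P1 S)" by (rule hcomp_multiples_submodule[OF P1 S H(1)])
  have BH: "B S \<subseteq> ?H"
  proof
    fix b assume b: "b \<in> B S"
    have "?h (a \<odot>\<^bsub>Obj P1 S\<^esub> b) j \<in> H" if "a \<in> carrier (Obj A S)" for a
      using B_hcomp[OF S PS.submoduleE(4)[OF B_submodule[OF S] that b]] H(2) by blast
    then show "b \<in> ?H" using b submodule_subset[OF B_submodule[OF S]] by blast
  qed
  have WH: "Map P1 (interval_obj C n) S \<epsilon> w \<in> ?H"
    if w: "(n, d, w) \<in> W" and \<epsilon>: "\<epsilon> \<in> mor (interval_obj C n) S" for n d w \<epsilon>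
  proof -
    let ?w = "Map P1 (interval_obj C n) S \<epsilon> w"
    have "w \<in> Gr P1 (interval_obj C n) d" by (rule spanningD(2)[OF W w])
    then have wG: "?w \<in> Gr P1 S d" using P1.Gr_Map[OF interval_obj_objs S \<epsilon>] by blast
    have wc: "?w \<in> carrier (Obj P1 S)" by (rule G.G_subset[OF wG])
    have "?h (a \<odot>\<^bsub>Obj P1 S\<^esub> ?w) j \<in> H" if a: "a \<in> carrier (Obj A S)" for a
    proof -
      let ?a = "hcomp (Obj A S) (Gr A S) a (j - d)"
      have aG: "?a \<in> Gr A S (j - d)" by (rule GA.hcomp_props(1)[OF a])
      have "?a \<odot>\<^bsub>Obj P1 S\<^esub> ?w \<in> H"
      proof (cases "j - d" "0 :: int" rule: linorder_cases)
        case less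
        then have "?a = \<zero>\<^bsub>Obj A S\<^esub>" using aG Gr_negative[OF S] by auto
        then show ?thesis using wc submodule_zero[OF H(1)] by simp
      next
        case equal
        then have "?w \<in> H" using gen[OF _ \<epsilon>] w by simp
        then show ?thesis by (rule PS.submoduleE(4)[OF H(1) GA.hcomp_closed[OF a]])
      next
        case greater
        then have "?a \<in> max_ideal A S" using aG max_ideal_Gr[OF S, of "j - d"] by auto
        then have "?a \<odot>\<^bsub>Obj P1 S\<^esub> ?w \<in> mP P1 S" unfolding mP_def using wc by (rule ideal_smultI)
        then show ?thesis using mP_B[OF S] H(2) by blast
      qed
      then show ?thesis using hcomp_smult[OF P1 S a wG] by simp
    qed
    then show ?thesis using wc by blast
  qed
  have "Z S \<subseteq> ?H" by (rule spanningD(4)[OF W S sub BH]) (use WH in blast)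
  then have "x \<in> carrier (Obj P1 S)" "?h (\<one>\<^bsub>Obj A S\<^esub> \<odot>\<^bsub>Obj P1 S\<^esub> x) j \<in> H"
    using x PS.R.one_closed by blast+
  then have "?h x j \<in> H" by simp
  then show "x \<in> H" using G.hcomp_homogeneous[of x j] x by simp
qed

lemma spanning_nonzero_degree:
  assumes "spanning W" "S \<in> objs C" "\<not> Z S \<inter> Gr P1 S j \<subseteq> B S"
  shows "j \<in> (\<lambda>(n, d, w). d) ` W"
proof (rule ccontr)
  assume j: "j \<notin> (\<lambda>(n, d, w). d) ` W"
  have "(n, j, w) \<notin> W" for n w using j by force
  then show False using spanning_degree[OF assms(1,2) B_submodule[OF assms(2)] subset_refl] assms(3) by blast
qed

text \<open>
  Every translate to \<open>T\<close> is a translate of a translate to \<open>S\<close>, and the latter is in \<open>B\<close>.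
\<close>

lemma spanning_vanishing_persists:
  assumes W: "spanning W" and S: "S \<in> objs C" and T: "T \<in> objs C"
    and card: "\<And>n d w. (n, d, w) \<in> W \<Longrightarrow> n \<le> card (fst S)" "card (fst S) \<le> card (fst T)"
    and van: "Z S \<inter> Gr P1 S j \<subseteq> B S"
  shows "Z T \<inter> Gr P1 T j \<subseteq> B T"
proof (rule spanning_degree[OF W T B_submodule[OF T] subset_refl])
  fix n w \<epsilon> assume w: "(n, j, w) \<in> W" and \<epsilon>: "\<epsilon> \<in> mor (interval_obj C n) T"
  let ?D = "interval_obj C n"
  note wD = spanningD(2,3)[OF W w]
  have wc: "w \<in> carrier (Obj P1 ?D)" by (rule graded_group.G_subset[OF P1.M_graded[OF interval_obj_objs] wD(1)])
  have "card (fst ?D) \<le> card (fst S)" using card(1)[OF w] by (simp add: fst_interval_obj)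
  from mor_factor[OF interval_obj_objs S T this card(2) \<epsilon>]
  obtain \<delta> \<eta> where f: "\<delta> \<in> mor ?D S" "\<eta> \<in> mor S T" "\<epsilon> = comp_mor ?D \<eta> \<delta>" by blast
  have "Map P1 ?D S \<delta> w \<in> Z S" by (rule cat_submoduleD(2)[OF Z_cat_submodule interval_obj_objs S f(1) wD(2)])
  moreover have "Map P1 ?D S \<delta> w \<in> Gr P1 S j" using P1.Gr_Map[OF interval_obj_objs S f(1)] wD(1) by blast
  ultimately have "Map P1 ?D S \<delta> w \<in> B S" using van by blast
  from B_Map[OF S T f(2) this]
  show "Map P1 ?D T \<epsilon> w \<in> B T"
    unfolding f(3) P1.Map_comp[OF interval_obj_objs S T f(1,2) wc] .
qed

text \<open>
  The components of \<open>G\<close> serve: they are in \<open>Z\<close>, which is graded, and \<open>G\<close> is in their span.  The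
  submodule generated by \<open>G\<close> itself need not be graded.
\<close>

lemma spanning_from_generators:
  assumes G: "finite G" "\<And>n q. (n, q) \<in> G \<Longrightarrow> q \<in> Z (interval_obj C n)"
    and Zgen: "\<And>S H. \<lbrakk>S \<in> objs C; submodule H (Obj A S) (Obj P1 S); B S \<subseteq> H; cat_span C A P1 G S \<subseteq> H\<rbrakk> \<Longrightarrow> Z S \<subseteq> H"
  obtains W where "spanning W"
proof -
  define h where "h n q = hcomp (Obj P1 (interval_obj C n)) (Gr P1 (interval_obj C n)) q" for n q
  define supp where "supp n q = {d. h n q d \<noteq> \<zero>\<^bsub>Obj P1 (interval_obj C n)\<^esub>}" for n q
  define W where "W = (\<Union>(n, q) \<in> G. (\<lambda>d. (n, d, h n q d)) ` supp n q)"
  have qc: "q \<in> carrier (Obj P1 (interval_obj C n))" if "(n, q) \<in> G" for n q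
    using G(2)[OF that] by (simp add: Z_def)
  have hp: "h n q d \<in> Gr P1 (interval_obj C n) d" "finite (supp n q)" "h n q d \<in> carrier (Obj P1 (interval_obj C n))"
    "q = finsum (Obj P1 (interval_obj C n)) (h n q) (supp n q)" if "(n, q) \<in> G" for n q d
    using graded_group.hcomp_props[OF P1.M_graded[OF interval_obj_objs] qc[OF that]]
      graded_group.hcomp_closed[OF P1.M_graded[OF interval_obj_objs] qc[OF that]]
    by (simp_all add: h_def supp_def)
  have "finite W" unfolding W_def using G(1) hp(2) by auto
  moreover have "w \<in> Gr P1 (interval_obj C n) d \<and> w \<in> Z (interval_obj C n)" if "(n, d, w) \<in> W" for n d w
    using that hp(1) Z_hcomp[OF interval_obj_objs G(2)] by (auto simp: W_def h_def)
  moreover have "Z S \<subseteq> H" if S: "S \<in> objs C" and H: "submodule H (Obj A S) (Obj P1 S)" "B S \<subseteq> H"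
    and WH: "\<forall>n d w \<epsilon>. (n, d, w) \<in> W \<longrightarrow> \<epsilon> \<in> mor (interval_obj C n) S \<longrightarrow>
      Map P1 (interval_obj C n) S \<epsilon> w \<in> H" for S H
  proof (rule Zgen[OF S H], unfold cat_span_def, rule module_span_least[OF H(1)], rule subsetI)
    fix x assume "x \<in> translates C P1 G S"
    then obtain n q \<epsilon> where x: "(n, q) \<in> G" "\<epsilon> \<in> mor (interval_obj C n) S" "x = Map P1 (interval_obj C n) S \<epsilon> q"
      by (auto simp: translates_def)
    let ?D = "interval_obj C n"
    have "Map P1 ?D S \<epsilon> (finsum (Obj P1 ?D) (h n q) (supp n q)) = finsum (Obj P1 S) (\<lambda>d. Map P1 ?D S \<epsilon> (h n q d)) (supp n q)"
      by (rule additive_finsum)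
        (use P1.M_graded[OF interval_obj_objs[of C n]] P1.M_graded[OF S] P1.Map_closed[OF interval_obj_objs S x(2)] P1.Map_add[OF interval_obj_objs S x(2)] hp(3)[OF x(1)] in
          \<open>simp_all add: graded_group_def\<close>)
    also have "\<dots> \<in> H"
    proof (rule submodule_finsum[OF H(1) P1.module_Obj[OF S]])
      fix d assume "d \<in> supp n q"
      then have "(n, d, h n q d) \<in> W" using x(1) by (auto simp: W_def)
      then show "Map P1 ?D S \<epsilon> (h n q d) \<in> H" using WH x(2) by blast
    qed
    finally show "x \<in> H" using hp(4)[OF x(1)] x(3) by simp
  qed
  ultimately have "spanning W" unfolding spanning_def by simp
  then show ?thesis by (rule that)
qed

end

section \<open>Stabilisation of Betti numbers\<close>

context standard_graded_algebra
begin

context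
  fixes M :: "('a, 'm) gfunctr" and P :: "('a, 'm, ('a + 'm) list \<Rightarrow> 'a) augmented_complex"
  assumes K: "field K" and M: "graded_cat_module C A M"
  defines "P \<equiv> free_resolution C A M"
begin

lemma resolution: "graded_free_resolution C A M P"
proof -
  interpret K: field K by (rule K)
  show ?thesis unfolding P_def by (rule free_resolution_resolves[OF _ M]) simp
qed

lemma resolutionD:
  "graded_cat_module C A (Term P n)" "graded_free C A (Term P n)"
  "graded_hom C A (Term P (Suc n)) (Term P n) (Diff P n)" "graded_hom C A (Term P 0) M (Aug P)"
  using resolution by (simp_all add: graded_free_resolution_def)

lemma resolution_exact:
  assumes "S \<in> objs C"
  shows "Aug P S ` carrier (Obj (Term P 0) S) = carrier (Obj M S)"
    and "Diff P 0 S ` carrier (Obj (Term P 1) S)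
        = {x \<in> carrier (Obj (Term P 0) S). Aug P S x = \<zero>\<^bsub>Obj M S\<^esub>}"
    and "Diff P (Suc n) S ` carrier (Obj (Term P (Suc (Suc n))) S)
        = {x \<in> carrier (Obj (Term P (Suc n)) S). Diff P n S x = \<zero>\<^bsub>Obj (Term P n) S\<^esub>}"
  using resolution assms by (simp_all add: graded_free_resolution_def)

lemma resolution_complex3:
  "graded_complex3 K C A (Term P (Suc (Suc q))) (Term P (Suc q)) (Term P q) (Diff P (Suc q)) (Diff P q)"
proof (intro graded_complex3.intro graded_complex3_axioms.intro resolutionD standard_graded_algebra_axioms)
  fix S x assume S: "S \<in> objs C" and x: "x \<in> carrier (Obj (Term P (Suc (Suc q))) S)"
  show "Diff P q S (Diff P (Suc q) S x) = \<zero>\<^bsub>Obj (Term P q) S\<^esub>"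
    using imageI[OF x, of "Diff P (Suc q) S"] unfolding resolution_exact(3)[OF S] by simp
qed

lemma resolution_free_complex:
  assumes S: "S \<in> objs C"
  obtains X :: "nat \<Rightarrow> (obj \<times> (('a + 'm) list \<Rightarrow> 'a) \<times> (nat \<Rightarrow> nat)) set" and g where
    "free_complex (Obj A S) (\<lambda>n. Obj (Term P n) S) (\<lambda>n. Diff P n S) (Obj M S) (Aug P S) X g"
proof -
  have "\<exists>Xg :: (obj \<times> (('a + 'm) list \<Rightarrow> 'a) \<times> (nat \<Rightarrow> nat)) set \<times> _.
      module_basis (Obj A S) (Obj (Term P n) S) (fst Xg) (snd Xg)" for n
  proof -
    obtain X and g :: "obj \<times> (('a + 'm) list \<Rightarrow> 'a) \<times> (nat \<Rightarrow> nat) \<Rightarrow> ('a + 'm) list \<Rightarrow> 'a"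
      where "module_basis (Obj A S) (Obj (Term P n) S) X g"
      using graded_free_basis[OF resolutionD(1,2) S] by blast
    then show "\<exists>Xg :: (obj \<times> (('a + 'm) list \<Rightarrow> 'a) \<times> (nat \<Rightarrow> nat)) set \<times> _.
      module_basis (Obj A S) (Obj (Term P n) S) (fst Xg) (snd Xg)"
      by (intro exI[of _ "(X, g)"]) simp
  qed
  then have "\<exists>Xg :: nat \<Rightarrow> (obj \<times> (('a + 'm) list \<Rightarrow> 'a) \<times> (nat \<Rightarrow> nat)) set \<times> _.
      \<forall>n. module_basis (Obj A S) (Obj (Term P n) S) (fst (Xg n)) (snd (Xg n))"
    by (intro choice allI)
  then obtain Xg :: "nat \<Rightarrow> (obj \<times> (('a + 'm) list \<Rightarrow> 'a) \<times> (nat \<Rightarrow> nat)) set \<times> _"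
    where Xg: "\<forall>n. module_basis (Obj A S) (Obj (Term P n) S) (fst (Xg n)) (snd (Xg n))"
    by (rule exE)
  have "free_complex (Obj A S) (\<lambda>n. Obj (Term P n) S) (\<lambda>n. Diff P n S) (Obj M S) (Aug P S)
      (\<lambda>n. fst (Xg n)) (\<lambda>n. snd (Xg n))"
  proof (rule free_complex.intro)
    show "module (Obj A S) (Obj (Term P n) S)" for n
      by (rule cat_module.module_Obj[OF graded_cat_module.axioms(1)[OF resolutionD(1)] S])
    show "module (Obj A S) (Obj M S)"
      by (rule cat_module.module_Obj[OF graded_cat_module.axioms(1)[OF M] S])
    show "linear_map (Obj A S) (Obj (Term P (Suc n)) S) (Obj (Term P n) S) (Diff P n S)" for n
      by (rule cat_hom_linear[OF graded_hom_cat_hom[OF resolutionD(3)] S])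
    show "linear_map (Obj A S) (Obj (Term P 0) S) (Obj M S) (Aug P S)"
      by (rule cat_hom_linear[OF graded_hom_cat_hom[OF resolutionD(4)] S])
    show "module_basis (Obj A S) (Obj (Term P n) S) (fst (Xg n)) (snd (Xg n))" for n using Xg by simp
  qed (rule resolution_exact[OF S])+
  then show ?thesis by (rule that)
qed

text \<open>
  With \<open>G\<close> the span of \<open>Gs (q + 1)\<close>, the intersection \<open>Z \<inter> G\<close> is finitely generated, and the
  compression shows \<open>Z = (Z \<inter> G) + B\<close>.
\<close>

lemma resolution_spanning:
  assumes noeth: "\<And>N :: ('a, nat \<Rightarrow> 'a) functr.
      cat_module C A N \<Longrightarrow> finitely_generated C A N \<Longrightarrow> noetherian_module C A N"
    and fg: "finitely_generated C A M"
  obtains W where "graded_complex3.spanning C A (Term P (Suc (Suc q))) (Term P (Suc q)) (Term P q) (Diff P (Suc q)) (Diff P q) W"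
proof -
  interpret T: graded_complex3 K C A "Term P (Suc (Suc q))" "Term P (Suc q)" "Term P q" "Diff P (Suc q)" "Diff P q"
    by (rule resolution_complex3)
  have cm: "cat_module C A (Term P n)" for n by (rule graded_cat_module.axioms(1)[OF resolutionD(1)])
  have Mc: "cat_module C A M" by (rule graded_cat_module.axioms(1)[OF M])
  have "\<exists>Gs. (\<forall>n. finite (Gs n) \<and> Gs n \<subseteq> gens C (Term P n)) \<and>
    (\<forall>S \<in> objs C. Aug P S ` cat_span C A (Term P 0) (Gs 0) S = carrier (Obj M S)) \<and>
    (\<forall>n. \<forall>S \<in> objs C. cat_span C A (Term P n) (Gs n) S \<inter> Diff P n S ` carrier (Obj (Term P (Suc n)) S)
      \<subseteq> Diff P n S ` cat_span C A (Term P (Suc n)) (Gs (Suc n)) S)"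
    by (rule exact_sequence_generators[OF noeth cm Mc graded_hom_cat_hom[OF resolutionD(3)]
          graded_hom_cat_hom[OF resolutionD(4)] resolution_exact(1) fg])
  then obtain Gs where "(\<forall>n. finite (Gs n) \<and> Gs n \<subseteq> gens C (Term P n)) \<and>
    (\<forall>S \<in> objs C. Aug P S ` cat_span C A (Term P 0) (Gs 0) S = carrier (Obj M S)) \<and>
    (\<forall>n. \<forall>S \<in> objs C. cat_span C A (Term P n) (Gs n) S \<inter> Diff P n S ` carrier (Obj (Term P (Suc n)) S)
      \<subseteq> Diff P n S ` cat_span C A (Term P (Suc n)) (Gs (Suc n)) S)"
    by (rule exE)
  then have Gs: "\<And>n. finite (Gs n)" "\<And>n. Gs n \<subseteq> gens C (Term P n)"
    "\<And>S. S \<in> objs C \<Longrightarrow> Aug P S ` cat_span C A (Term P 0) (Gs 0) S = carrier (Obj M S)"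
    "\<And>n S. S \<in> objs C \<Longrightarrow> cat_span C A (Term P n) (Gs n) S \<inter> Diff P n S ` carrier (Obj (Term P (Suc n)) S)
      \<subseteq> Diff P n S ` cat_span C A (Term P (Suc n)) (Gs (Suc n)) S"
    by simp_all
  have span: "cat_submodule C A (Term P n) (cat_span C A (Term P n) (Gs n))" for n
    by (rule cat_module.cat_span_submodule[OF cm cat_algebra_axioms Gs(2)])
  let ?N = "\<lambda>S. T.Z S \<inter> cat_span C A (Term P (Suc q)) (Gs (Suc q)) S"
  have N: "cat_submodule C A (Term P (Suc q)) ?N"
    by (rule cat_submodule_Int[OF cm T.Z_cat_submodule span])
  obtain G' where G': "finite G'" "\<And>n q. (n, q) \<in> G' \<Longrightarrow> q \<in> ?N (interval_obj C n)"
    "\<And>S. S \<in> objs C \<Longrightarrow> ?N S \<subseteq> cat_span C A (Term P (Suc q)) G' S"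
    by (rule submodule_of_finitely_generated[OF noeth cm Gs(1,2) N]) auto
  have "T.Z S \<subseteq> H" if S: "S \<in> objs C" and H: "submodule H (Obj A S) (Obj (Term P (Suc q)) S)" "T.B S \<subseteq> H"
    "cat_span C A (Term P (Suc q)) G' S \<subseteq> H" for S H
  proof
    fix x assume x: "x \<in> T.Z S"
    let ?R = "Obj A S" and ?P1 = "Obj (Term P (Suc q)) S"
    obtain X :: "nat \<Rightarrow> (obj \<times> (('a + 'm) list \<Rightarrow> 'a) \<times> (nat \<Rightarrow> nat)) set" and g
      where "free_complex ?R (\<lambda>n. Obj (Term P n) S) (\<lambda>n. Diff P n S) (Obj M S) (Aug P S) X g"
      by (rule resolution_free_complex[OF S])
    then interpret F: free_complex ?R "\<lambda>n. Obj (Term P n) S" "\<lambda>n. Diff P n S" "Obj M S" "Aug P S" X g .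
    interpret P1: module ?R ?P1 by (rule F.P_module)
    have xc: "x \<in> carrier ?P1" using x by (simp add: T.Z_def)
    have "\<exists>h. linear_map ?R (Obj (Term P q) S) ?P1 h \<and> (\<forall>x \<in> carrier ?P1.
      \<exists>y \<in> cat_span C A (Term P (Suc q)) (Gs (Suc q)) S. \<exists>z \<in> carrier (Obj (Term P (Suc (Suc q))) S).
        x = y \<oplus>\<^bsub>?P1\<^esub> Diff P (Suc q) S z \<oplus>\<^bsub>?P1\<^esub> h (Diff P q S x))"
      by (rule F.compression_decomposition[where G = "\<lambda>n. cat_span C A (Term P n) (Gs n) S"])
        (use cat_submoduleD(1)[OF span S] Gs(3)[OF S] Gs(4)[OF S] resolution_exact(1)[OF S] in
          \<open>simp_all add: F.cycles_def\<close>)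
    then obtain h y z where h: "linear_map ?R (Obj (Term P q) S) ?P1 h"
      and y: "y \<in> cat_span C A (Term P (Suc q)) (Gs (Suc q)) S" and z: "z \<in> carrier (Obj (Term P (Suc (Suc q))) S)"
      and xeq: "x = y \<oplus>\<^bsub>?P1\<^esub> Diff P (Suc q) S z \<oplus>\<^bsub>?P1\<^esub> h (Diff P q S x)"
      using xc by blast
    have yc: "y \<in> carrier ?P1" by (rule cat_submodule_carrier[OF span S y])
    let ?b = "Diff P (Suc q) S z \<oplus>\<^bsub>?P1\<^esub> h (Diff P q S x)"
    have "h (Diff P q S x) \<in> mP (Term P (Suc q)) S"
      unfolding mP_def
      by (rule ideal_smult_linear[OF h F.P_module F.P_module max_ideal_subset[OF S]])
        (use x in \<open>simp add: T.Z_def mP_def\<close>)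
    then have b: "?b \<in> T.B S"
      using submodule_add[OF T.B_submodule[OF S] T.image_B[OF S z]] T.mP_B[OF S] by blast
    have bc: "Diff P (Suc q) S z \<in> carrier ?P1" "h (Diff P q S x) \<in> carrier ?P1"
      using linear_mapD(1)[OF F.d_linear z] linear_mapD(1)[OF h] linear_mapD(1)[OF F.d_linear xc] by auto
    have xb: "x = y \<oplus>\<^bsub>?P1\<^esub> ?b" using xeq yc bc by (simp add: P1.M.a_assoc)
    have "y = x \<ominus>\<^bsub>?P1\<^esub> ?b"
      using yc bc by (subst xb) (simp add: a_minus_def P1.M.a_assoc P1.M.r_neg)
    moreover have "x \<ominus>\<^bsub>?P1\<^esub> ?b \<in> T.Z S"
      by (rule submodule_minus[OF cat_submoduleD(1)[OF T.Z_cat_submodule S] F.P_module x])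
        (use b T.B_subset_Z[OF S] in blast)
    ultimately have "y \<in> H" using y G'(3)[OF S] H(3) by auto
    moreover have "?b \<in> H" using b H(2) by blast
    ultimately have "y \<oplus>\<^bsub>?P1\<^esub> ?b \<in> H" by (rule submodule_add[OF H(1)])
    then show "x \<in> H" using xb by simp
  qed
  then show ?thesis
    using T.spanning_from_generators[OF G'(1)] G'(2) that by blast
qed

lemma betti_nonzero_iff_not_boundary:
  assumes S: "S \<in> objs C"
  shows "betti K C A M S (Suc q) j \<noteq> 0 \<longleftrightarrow>
    \<not> graded_complex3.Z A (Term P (Suc q)) (Term P q) (Diff P q) S \<inter> Gr (Term P (Suc q)) S j
      \<subseteq> graded_complex3.B A (Term P (Suc (Suc q))) (Term P (Suc q)) (Diff P (Suc q)) S"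
proof -
  interpret T: graded_complex3 K C A "Term P (Suc (Suc q))" "Term P (Suc q)" "Term P q" "Diff P (Suc q)" "Diff P q"
    by (rule resolution_complex3)
  have "Gr (Term P (Suc q)) S j \<subseteq> carrier (Obj (Term P (Suc q)) S)"
    using graded_group.G_subset[OF T.P1.M_graded[OF S]] by blast
  then show ?thesis
    unfolding betti_nonzero_iff[OF K M S, folded P_def] T.Z_def T.B_def mP_def by blast
qed

end

text \<open>
  \<open>J\<close> are the degrees of a finite spanning set, and \<open>m\<close> bounds the sizes of the objects in which it
  lives.
\<close>

lemma betti_stabilisation:
  fixes M :: "('a, 'm) gfunctr"
  assumes K: "field K" and M: "graded_cat_module C A M"
    and noeth: "\<And>N :: ('a, nat \<Rightarrow> 'a) functr.
      cat_module C A N \<Longrightarrow> finitely_generated C A N \<Longrightarrow> noetherian_module C A N"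
    and fg: "finitely_generated C A M"
  obtains J m where "finite J" "\<And>S j. \<lbrakk>S \<in> objs C; betti K C A M S (Suc q) j \<noteq> 0\<rbrakk> \<Longrightarrow> j \<in> J"
    "\<And>S T j. \<lbrakk>S \<in> objs C; T \<in> objs C; m \<le> card (fst S); card (fst S) \<le> card (fst T);
      betti K C A M T (Suc q) j \<noteq> 0\<rbrakk> \<Longrightarrow> betti K C A M S (Suc q) j \<noteq> 0"
proof -
  let ?P = "free_resolution C A M"
  interpret T: graded_complex3 K C A "Term ?P (Suc (Suc q))" "Term ?P (Suc q)" "Term ?P q" "Diff ?P (Suc q)" "Diff ?P q"
    by (rule resolution_complex3[OF K M])
  obtain W where W: "T.spanning W" by (rule resolution_spanning[OF K M noeth fg])
  note iff = betti_nonzero_iff_not_boundary[OF K M]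
  have fin: "finite W" by (rule T.spanningD(1)[OF W])
  define m where "m = Max (insert 0 (fst ` W))"
  have m: "n \<le> m" if "(n, d, w) \<in> W" for n d w
    unfolding m_def using fin that by (intro Max_ge) (auto intro!: rev_image_eqI)
  show ?thesis
  proof (rule that[of "(\<lambda>(n, d, w). d) ` W" m])
    show "finite ((\<lambda>(n, d, w). d) ` W)" using fin by simp
    show "j \<in> (\<lambda>(n, d, w). d) ` W" if "S \<in> objs C" "betti K C A M S (Suc q) j \<noteq> 0" for S j
      using T.spanning_nonzero_degree[OF W that(1)] that(2) unfolding iff[OF that(1)] by blast
    show "betti K C A M S (Suc q) j \<noteq> 0"
      if "S \<in> objs C" "T \<in> objs C" "m \<le> card (fst S)" "card (fst S) \<le> card (fst T)"
        "betti K C A M T (Suc q) j \<noteq> 0" for S T j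
    proof (rule ccontr)
      assume "\<not> betti K C A M S (Suc q) j \<noteq> 0"
      then have van: "T.Z S \<inter> Gr (Term ?P (Suc q)) S j \<subseteq> T.B S" using iff[OF that(1)] by blast
      have "T.Z T \<inter> Gr (Term ?P (Suc q)) T j \<subseteq> T.B T"
        by (rule T.spanning_vanishing_persists[OF W that(1,2) _ that(4) van]) (rule order_trans[OF m that(3)])
      then show False using that(5) iff[OF that(2)] by blast
    qed
  qed
qed

end

theorem theorem7p7:
  fixes K :: "'k ring" and C :: index_cat
    and A :: "('k, 'a) gfunctr" and M :: "('a, 'm) gfunctr" and p :: nat
  assumes "field K"
    and "standard_graded_algebra K C A"
    and "noetherian_algebra C A"
    and "\<And>N :: ('a, nat \<Rightarrow> 'a) functr.
      cat_module C A N \<Longrightarrow> finitely_generated C A N \<Longrightarrow> noetherian_module C A N"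
    and "graded_cat_module C A M"
    and "finitely_generated C A M"
    and "p \<ge> 1"
  shows "max_degree K C A M p < \<infinity> \<and>
    (betti_degrees K C A M p \<noteq> {} \<longrightarrow>
      (\<exists>j \<in> betti_degrees K C A M p. max_degree K C A M p = ereal (of_int j))) \<and>
    (\<exists>js :: int list. sorted_wrt (<) js \<and>
      (\<forall>j \<in> set js. ereal (of_int j) \<le> max_degree K C A M p) \<and>
      (\<exists>n0. \<forall>S \<in> objs C. card (fst S) \<ge> n0 \<longrightarrow>
        (\<forall>j. betti K C A M S p j \<noteq> 0 \<longleftrightarrow> j \<in> set js)))"
proof -
  interpret standard_graded_algebra K C A by fact
  obtain q where p: "p = Suc q" using assms(7) by (cases p) auto
  let ?nz = "\<lambda>S j. betti K C A M S p j \<noteq> 0"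
  obtain J m where J: "finite J" "\<And>S j. \<lbrakk>S \<in> objs C; ?nz S j\<rbrakk> \<Longrightarrow> j \<in> J"
    and persist: "\<And>S T j. \<lbrakk>S \<in> objs C; T \<in> objs C; m \<le> card (fst S); card (fst S) \<le> card (fst T); ?nz T j\<rbrakk>
      \<Longrightarrow> ?nz S j"
    using betti_stabilisation[OF assms(1,5,4,6), of q] unfolding p by blast
  let ?D = "betti_degrees K C A M p"
  have D: "?D \<subseteq> J" using J(2) by (auto simp: betti_degrees_def)
  then have finD: "finite ?D" using J(1) by (rule finite_subset)
  have attained: "max_degree K C A M p = ereal (of_int (Max ?D))" if "?D \<noteq> {}"
    unfolding max_degree_def
  proof (rule antisym)
    show "(SUP j \<in> ?D. ereal (of_int j)) \<le> ereal (of_int (Max ?D))"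
      by (rule SUP_least) (use Max_ge[OF finD] in simp)
    show "ereal (of_int (Max ?D)) \<le> (SUP j \<in> ?D. ereal (of_int j))"
      by (rule SUP_upper[OF Max_in[OF finD that]])
  qed
  have "max_degree K C A M p < \<infinity>"
  proof (cases "?D = {}")
    case True
    then show ?thesis by (simp add: max_degree_def bot_ereal_def)
  next
    case False
    then show ?thesis using attained by simp
  qed
  moreover have "\<exists>j \<in> ?D. max_degree K C A M p = ereal (of_int j)" if "?D \<noteq> {}"
    using attained[OF that] Max_in[OF finD that] by blast
  \<comment> \<open>The stable degrees.  Every other degree in \<open>J\<close> vanishes at some large object, hence from there on.\<close>
  moreover define E where "E = {j \<in> J. \<forall>S \<in> objs C. m \<le> card (fst S) \<longrightarrow> ?nz S j}"
  have finE: "finite E" using J(1) by (simp add: E_def)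
  have "E \<subseteq> ?D"
  proof
    fix j assume "j \<in> E"
    then have "?nz (interval_obj C m) j" using interval_obj_objs by (simp add: E_def fst_interval_obj)
    then show "j \<in> ?D" using interval_obj_objs by (auto simp: betti_degrees_def)
  qed
  then have "\<forall>j \<in> set (sorted_list_of_set E). ereal (of_int j) \<le> max_degree K C A M p"
    unfolding max_degree_def using finE by (auto intro!: SUP_upper)
  moreover have "\<exists>n0. \<forall>S \<in> objs C. card (fst S) \<ge> n0 \<longrightarrow> (\<forall>j. ?nz S j \<longleftrightarrow> j \<in> E)"
  proof -
    have "\<forall>j \<in> J - E. \<exists>S. S \<in> objs C \<and> m \<le> card (fst S) \<and> \<not> ?nz S j" by (auto simp: E_def)
    then obtain f where f: "\<forall>j \<in> J - E. f j \<in> objs C \<and> m \<le> card (fst (f j)) \<and> \<not> ?nz (f j) j"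
      using bchoice[of "J - E" "\<lambda>j S. S \<in> objs C \<and> m \<le> card (fst S) \<and> \<not> ?nz S j"] by blast
    define n0 where "n0 = Max (insert m ((\<lambda>j. card (fst (f j))) ` (J - E)))"
    have n0: "m \<le> n0" "\<And>j. j \<in> J - E \<Longrightarrow> card (fst (f j)) \<le> n0"
      unfolding n0_def using J(1) by (auto intro: Max_ge)
    have "?nz S j \<longleftrightarrow> j \<in> E" if S: "S \<in> objs C" "n0 \<le> card (fst S)" for S j
    proof
      assume nz: "?nz S j"
      show "j \<in> E"
      proof (rule ccontr)
        assume "j \<notin> E"
        then have j: "j \<in> J - E" using J(2)[OF S(1) nz] by simp
        have fj: "f j \<in> objs C" "m \<le> card (fst (f j))" "\<not> ?nz (f j) j" using f j by auto
        have "?nz (f j) j" by (rule persist[OF fj(1) S(1) fj(2) order_trans[OF n0(2)[OF j] S(2)] nz])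
        then show False using fj(3) by simp
      qed
    next
      assume "j \<in> E"
      then show "?nz S j" using S n0(1) by (simp add: E_def)
    qed
    then show ?thesis by blast
  qed
  ultimately show ?thesis
    using finE by (intro conjI impI exI[of _ "sorted_list_of_set E"]) simp_all
qed

end
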